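(* Let $G$ be a compact Vilenkin group, with sequence of compact open subgroups $\mathscr{G}=\{G_n\}_{n\in\mathbb{N}_0}$, satisfying Condition (A). For every $f\in L^2(\mu_G)$ and every $n\in\mathbb{N}_0$ the following inequalities hold: $$\frac12\,\omega_2(f,\mathscr{G},n)\le\Big(\sum_{[\xi]\in\widehat G:\ \langle\xi\rangle_{\mathscr{G}}>|G/G_n|}d_\xi\|\widehat f(\xi)\|_{HS}^2\Big)^{1/2}\le\frac{1}{\sqrt2}\,\omega_2(f,\mathscr{G},n),$$ where the constant $1/\sqrt2$ appearing in the right-hand inequality is sharp. Consequently, for every sequence $\omega=\{\omega_n\}_{n\in\mathbb{N}_0}$ of real numbers monotonically decreasing to zero and every $f\in L^2(\mu_G)$, one has $f\in\mathscr{M}_2^\omega(\mathscr{G})$ if and only if there is $C>0$ such that $$\Big(\sum_{[\xi]\in\widehat G:\ \langle\xi\rangle_{\mathscr{G}}>|G/G_n|}d_\xi\|\widehat f(\xi)\|_{HS}^2\Big)^{1/2}\le C\,\omega_n\quad\text{for all }n\in\mathbb{N}_0.$$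
   Context: **Compact Vilenkin group.** A profinite group $G$ endowed with a strictly decreasing sequence $\mathscr{G}=\{G_n\}_{n\in\mathbb{N}_0}$ of compact open subgroups such that (i) $2\le|G_n/G_{n+1}|<\infty$ for every $n\in\mathbb{N}_0$; (ii) $G=\bigcup_n G_n$ (so $G_0=G$) and $\bigcap_n G_n=\{e\}$; (iii) $\{G_n\}$ is a basis of neighbourhoods at $e$. Here $|H/K|$ denotes the index of $K$ in $H$, $\mu_G$ is the normalized Haar measure and $|G_n|=\mu_G(G_n)=|G/G_n|^{-1}$. Put $|e|_{\mathscr{G}}=0$ and $|x|_{\mathscr{G}}=|G_n|$ if $x\in G_n\setminus G_{n+1}$. **Representations.** $Rep(G)$ is the collection of (classes of) continuous finite-dimensional unitary representations and $\widehat G$ the irreducible ones; $d_\xi$ is the dimension of $\xi$. For $n\in\mathbb{N}_0$ let $G_n^\perp=\{[\pi]\in Rep(G):\pi|_{G_n}=I_{d_\pi}\}$ and, for $n\ge1$, $Rep_n(G)=G_n^\perp\setminus G_{n-1}^\perp$. Put $\langle\pi\rangle_{\mathscr{G}}=1$ if $\pi$ is the identity (trivial) representation and $\langle\pi\rangle_{\mathscr{G}}=|G/G_n|$ if $[\pi]\in Rep_n(G)$, $n\ge1$. The Fourier coefficient is $\widehat f(\xi)=\int_G f(x)\xi(x)^*\,d\mu_G(x)\in\mathbb{C}^{d_\xi\times d_\xi}$; $\|\cdot\|_{HS}$ is the Hilbert–Schmidt norm. **Condition (A).** There is a natural number $N$ such that for all $k\in\mathbb{N}_0$ there are $N$ points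 $h_1,\dots,h_N\in G$ with $|h_1|_{\mathscr{G}}=\dots=|h_N|_{\mathscr{G}}=|G/G_k|^{-1}$ and, for every $1\le q<\infty$, $$|G/G_k|^q\langle\xi\rangle_{\mathscr{G}}^{-q}\|A\|_{HS}^q\lesssim\sum_{i=1}^{N}\|A(\xi(h_i)-I_{d_\xi})\|_{HS}^q$$ for every $[\xi]\in\widehat G$ non-trivial on $G_k\setminus G_{k+1}$ and every matrix $A=\widehat f(\xi)\in\mathbb{C}^{d_\xi\times d_\xi}$, with implied constant independent of $k$, $\xi$ and $A$. **Modulus of continuity.** For $f\in L^2(\mu_G)$, $\omega_2(f,\mathscr{G},n)=\sup_{h\in G_n}\|f(h\,\cdot)-f(\cdot)\|_{L^2(\mu_G)}$. For a sequence $\omega=\{\omega_n\}_{n\in\mathbb{N}_0}$ of real numbers monotonically decreasing to zero, $\mathscr{M}_2^\omega(\mathscr{G})$ is the set of $f\in L^2(\mu_G)$ for which there is a constant $C_f>0$ with $\omega_2(f,\mathscr{G},n)\le C_f\,\omega_n$ for all $n\in\mathbb{N}_0$. "Sharp" means that $1/\sqrt2$ cannot be replaced by a smaller constant in the right-hand inequality for all $f\in L^2(\mu_G)$ and $n\in\mathbb{N}_0$. *)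

theory Defs
  imports
    "HOL-Analysis.Analysis"
    "HOL-Algebra.Coset"
    "Jordan_Normal_Form.Schur_Decomposition"
    "Jordan_Normal_Form.VS_Connect"
begin

section \<open>Compact Vilenkin groups\<close>

locale topological_group = group G for G :: "('a, 'b) monoid_scheme" (structure) +
  fixes T :: "'a topology"
  assumes topspace_eq: "topspace T = carrier G"
    and continuous_mult: "continuous_map (prod_topology T T) T (\<lambda>(x, y). x \<otimes> y)"
    and continuous_inv: "continuous_map T T (\<lambda>x. inv x)"

locale profinite_group = topological_group +
  assumes compact: "compact_space T"
    and Hausdorff: "Hausdorff_space T"
    and totally_disconnected: "\<And>S x y. connectedin T S \<Longrightarrow> x \<in> S \<Longrightarrow> y \<in> S \<Longrightarrow> x = y"

text \<open>The index is the cardinality of the set of cosets; it is \<open>0\<close> if that set is infinite.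
  The index of \<open>K\<close> in a subgroup \<open>H\<close> of \<open>G\<close> is taken in the group \<open>G\<lparr>carrier := H\<rparr>\<close>.\<close>

definition group_index :: "('a, 'b) monoid_scheme \<Rightarrow> 'a set \<Rightarrow> nat" where
  "group_index G K = card (rcosets\<^bsub>G\<^esub> K)"

locale compact_vilenkin_group = profinite_group +
  fixes Gs :: "nat \<Rightarrow> 'a set"
  assumes subgroups: "\<And>n. subgroup (Gs n) G"
    and compact_subgroups: "\<And>n. compactin T (Gs n)"
    and open_subgroups: "\<And>n. openin T (Gs n)"
    and strictly_decreasing: "\<And>n. Gs (Suc n) \<subset> Gs n"
    and index_finite: "\<And>n. finite (rcosets\<^bsub>G\<lparr>carrier := Gs n\<rparr>\<^esub> (Gs (Suc n)))"
    and index_ge_2: "\<And>n. 2 \<le> group_index (G\<lparr>carrier := Gs n\<rparr>) (Gs (Suc n))"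
    and union: "(\<Union>n. Gs n) = carrier G"
    and inter: "(\<Inter>n. Gs n) = {\<one>}"
    and nhds_basis: "\<And>U. openin T U \<Longrightarrow> \<one> \<in> U \<Longrightarrow> \<exists>n. Gs n \<subseteq> U"

text \<open>In a compact Vilenkin group every open set is a countable union of cosets of the \<open>Gs n\<close>, so a
  left-invariant Borel probability measure is automatically regular and is the normalized
  Haar measure.\<close>

definition normalized_haar_measure ::
  "('a, 'b) monoid_scheme \<Rightarrow> 'a topology \<Rightarrow> 'a measure \<Rightarrow> bool" where
  "normalized_haar_measure G T \<mu> \<longleftrightarrow>
     space \<mu> = topspace T \<and>
     sets \<mu> = sigma_sets (topspace T) {U. openin T U} \<and>
     emeasure \<mu> (space \<mu>) = 1 \<and>
     (\<forall>g\<in>carrier G. \<forall>A\<in>sets \<mu>. emeasure \<mu> (g <#\<^bsub>G\<^esub> A) = emeasure \<mu> A)"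

definition vilenkin_abs ::
  "('a, 'b) monoid_scheme \<Rightarrow> (nat \<Rightarrow> 'a set) \<Rightarrow> 'a measure \<Rightarrow> 'a \<Rightarrow> real" where
  "vilenkin_abs G Gs \<mu> x =
     (if x = \<one>\<^bsub>G\<^esub> then 0 else measure \<mu> (Gs (THE n. x \<in> Gs n - Gs (Suc n))))"


section \<open>Unitary representations and the dual\<close>

text \<open>A finite-dimensional unitary representation is a function into complex \<open>d \<times> d\<close> matrices; its
  dimension \<open>d\<close> is read off from the matrix at the identity.  Values outside \<open>carrier G\<close> are
  unconstrained, and are ignored by the equivalence relation below.\<close>

definition rep_dim :: "('a, 'b) monoid_scheme \<Rightarrow> ('a \<Rightarrow> complex mat) \<Rightarrow> nat" where
  "rep_dim G \<pi> = dim_row (\<pi> \<one>\<^bsub>G\<^esub>)"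

definition unitary_matrix :: "complex mat \<Rightarrow> bool" where
  "unitary_matrix U \<longleftrightarrow> (\<exists>d. U \<in> carrier_mat d d \<and>
     mat_adjoint U * U = 1\<^sub>m d \<and> U * mat_adjoint U = 1\<^sub>m d)"

definition unitary_reps ::
  "('a, 'b) monoid_scheme \<Rightarrow> 'a topology \<Rightarrow> ('a \<Rightarrow> complex mat) set" where
  "unitary_reps G T = {\<pi>.
     (\<forall>x\<in>carrier G. \<pi> x \<in> carrier_mat (rep_dim G \<pi>) (rep_dim G \<pi>) \<and> unitary_matrix (\<pi> x)) \<and>
     (\<forall>x\<in>carrier G. \<forall>y\<in>carrier G. \<pi> (x \<otimes>\<^bsub>G\<^esub> y) = \<pi> x * \<pi> y) \<and>
     (\<forall>i<rep_dim G \<pi>. \<forall>j<rep_dim G \<pi>. continuous_map T euclidean (\<lambda>x. \<pi> x $$ (i, j)))}"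

definition irreducible_reps ::
  "('a, 'b) monoid_scheme \<Rightarrow> 'a topology \<Rightarrow> ('a \<Rightarrow> complex mat) set" where
  "irreducible_reps G T = {\<pi> \<in> unitary_reps G T. rep_dim G \<pi> > 0 \<and>
     (\<forall>W. VectorSpace.subspace class_ring W (module_vec TYPE(complex) (rep_dim G \<pi>)) \<and>
          (\<forall>x\<in>carrier G. \<forall>w\<in>W. \<pi> x *\<^sub>v w \<in> W) \<longrightarrow>
          W = {0\<^sub>v (rep_dim G \<pi>)} \<or> W = carrier_vec (rep_dim G \<pi>))}"

definition rep_equiv :: "('a, 'b) monoid_scheme \<Rightarrow> 'a topology \<Rightarrow>
    (('a \<Rightarrow> complex mat) \<times> ('a \<Rightarrow> complex mat)) set" where
  "rep_equiv G T = {(\<pi>, \<rho>). \<pi> \<in> unitary_reps G T \<and> \<rho> \<in> unitary_reps G T \<and>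
     rep_dim G \<pi> = rep_dim G \<rho> \<and>
     (\<exists>U \<in> carrier_mat (rep_dim G \<pi>) (rep_dim G \<pi>). unitary_matrix U \<and>
        (\<forall>x\<in>carrier G. U * \<pi> x = \<rho> x * U))}"

definition unitary_dual ::
  "('a, 'b) monoid_scheme \<Rightarrow> 'a topology \<Rightarrow> ('a \<Rightarrow> complex mat) set set" where
  "unitary_dual G T = irreducible_reps G T // rep_equiv G T"

definition class_rep :: "('a \<Rightarrow> complex mat) set \<Rightarrow> ('a \<Rightarrow> complex mat)" where
  "class_rep c = (SOME \<xi>. \<xi> \<in> c)"

definition annihilator ::
  "('a, 'b) monoid_scheme \<Rightarrow> 'a topology \<Rightarrow> 'a set \<Rightarrow> ('a \<Rightarrow> complex mat) set" where
  "annihilator G T H = {\<pi> \<in> unitary_reps G T. \<forall>x\<in>H. \<pi> x = 1\<^sub>m (rep_dim G \<pi>)}"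

definition Rep_level :: "('a, 'b) monoid_scheme \<Rightarrow> 'a topology \<Rightarrow> (nat \<Rightarrow> 'a set) \<Rightarrow>
    nat \<Rightarrow> ('a \<Rightarrow> complex mat) set" where
  "Rep_level G T Gs n = annihilator G T (Gs n) - annihilator G T (Gs (n - 1))"

text \<open>The sets \<open>Rep_level G T Gs n\<close>, \<open>n \<ge> 1\<close>, are pairwise disjoint and, there being no small
  subgroups in the unitary groups, exhaust the representations that are not trivial on \<open>G\<close>.\<close>

definition rep_bracket :: "('a, 'b) monoid_scheme \<Rightarrow> 'a topology \<Rightarrow> (nat \<Rightarrow> 'a set) \<Rightarrow>
    ('a \<Rightarrow> complex mat) \<Rightarrow> real" where
  "rep_bracket G T Gs \<pi> =
     (if \<pi> \<in> annihilator G T (carrier G) then 1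
      else real (group_index G (Gs (THE n. n \<ge> 1 \<and> \<pi> \<in> Rep_level G T Gs n))))"


section \<open>Fourier coefficients and the modulus of continuity\<close>

definition L2 :: "'a measure \<Rightarrow> ('a \<Rightarrow> complex) set" where
  "L2 \<mu> = {f \<in> borel_measurable \<mu>. integrable \<mu> (\<lambda>x. (cmod (f x))\<^sup>2)}"

definition L2_norm :: "'a measure \<Rightarrow> ('a \<Rightarrow> complex) \<Rightarrow> real" where
  "L2_norm \<mu> f = sqrt (LINT x|\<mu>. (cmod (f x))\<^sup>2)"

definition HS_norm :: "complex mat \<Rightarrow> real" where
  "HS_norm A = sqrt (\<Sum>i<dim_row A. \<Sum>j<dim_col A. (cmod (A $$ (i, j)))\<^sup>2)"

definition fourier_coeff :: "('a, 'b) monoid_scheme \<Rightarrow> 'a measure \<Rightarrow> ('a \<Rightarrow> complex) \<Rightarrow>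
    ('a \<Rightarrow> complex mat) \<Rightarrow> complex mat" where
  "fourier_coeff G \<mu> f \<xi> = mat (rep_dim G \<xi>) (rep_dim G \<xi>)
     (\<lambda>(i, j). LINT x|\<mu>. f x * (mat_adjoint (\<xi> x) $$ (i, j)))"

definition modulus2 :: "('a, 'b) monoid_scheme \<Rightarrow> 'a measure \<Rightarrow> (nat \<Rightarrow> 'a set) \<Rightarrow>
    ('a \<Rightarrow> complex) \<Rightarrow> nat \<Rightarrow> real" where
  "modulus2 G \<mu> Gs f n = (SUP h\<in>Gs n. L2_norm \<mu> (\<lambda>x. f (h \<otimes>\<^bsub>G\<^esub> x) - f x))"

definition M2_class :: "('a, 'b) monoid_scheme \<Rightarrow> 'a measure \<Rightarrow> (nat \<Rightarrow> 'a set) \<Rightarrow>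
    (nat \<Rightarrow> real) \<Rightarrow> ('a \<Rightarrow> complex) set" where
  "M2_class G \<mu> Gs \<omega> = {f \<in> L2 \<mu>. \<exists>C>0. \<forall>n. modulus2 G \<mu> Gs f n \<le> C * \<omega> n}"

definition tail_classes :: "('a, 'b) monoid_scheme \<Rightarrow> 'a topology \<Rightarrow> (nat \<Rightarrow> 'a set) \<Rightarrow>
    nat \<Rightarrow> ('a \<Rightarrow> complex mat) set set" where
  "tail_classes G T Gs n =
     {c \<in> unitary_dual G T. rep_bracket G T Gs (class_rep c) > real (group_index G (Gs n))}"

text \<open>The bracket, the dimension and the Hilbert-Schmidt norm of a Fourier coefficient are invariant
  under unitary equivalence, so the choice made by \<open>class_rep\<close> is immaterial.\<close>

definition tail_term :: "('a, 'b) monoid_scheme \<Rightarrow> 'a measure \<Rightarrow> ('a \<Rightarrow> complex) \<Rightarrow>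
    ('a \<Rightarrow> complex mat) set \<Rightarrow> real" where
  "tail_term G \<mu> f c =
     real (rep_dim G (class_rep c)) * (HS_norm (fourier_coeff G \<mu> f (class_rep c)))\<^sup>2"

definition fourier_tail :: "('a, 'b) monoid_scheme \<Rightarrow> 'a topology \<Rightarrow> 'a measure \<Rightarrow>
    (nat \<Rightarrow> 'a set) \<Rightarrow> ('a \<Rightarrow> complex) \<Rightarrow> nat \<Rightarrow> real" where
  "fourier_tail G T \<mu> Gs f n = sqrt (\<Sum>\<^sub>\<infinity>c\<in>tail_classes G T Gs n. tail_term G \<mu> f c)"


section \<open>Condition (A)\<close>

text \<open>The implied constant \<open>C\<close> may depend on \<open>q\<close>; the points \<open>h k i\<close> depend on \<open>k\<close> only.  The matrices
  \<open>A\<close> are the Fourier coefficients at \<open>\<xi>\<close> of square-integrable functions.\<close>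

definition condition_A :: "('a, 'b) monoid_scheme \<Rightarrow> 'a topology \<Rightarrow> 'a measure \<Rightarrow>
    (nat \<Rightarrow> 'a set) \<Rightarrow> bool" where
  "condition_A G T \<mu> Gs \<longleftrightarrow>
     (\<exists>(N::nat) (h :: nat \<Rightarrow> nat \<Rightarrow> 'a).
        (\<forall>k. \<forall>i<N. h k i \<in> carrier G \<and>
           vilenkin_abs G Gs \<mu> (h k i) = 1 / real (group_index G (Gs k))) \<and>
        (\<forall>q::real. q \<ge> 1 \<longrightarrow> (\<exists>C>0. \<forall>k. \<forall>\<xi>\<in>irreducible_reps G T.
           (\<exists>x \<in> Gs k - Gs (Suc k). \<xi> x \<noteq> 1\<^sub>m (rep_dim G \<xi>)) \<longrightarrow>
           (\<forall>f\<in>L2 \<mu>. let A = fourier_coeff G \<mu> f \<xi> in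
              real (group_index G (Gs k)) powr q * rep_bracket G T Gs \<xi> powr (- q)
                * HS_norm A powr q
              \<le> C * (\<Sum>i<N. HS_norm (A * (\<xi> (h k i) - 1\<^sub>m (rep_dim G \<xi>))) powr q)))))"

end

theory Submission
  imports Defs "Jordan_Normal_Form.Spectral_Radius"
begin

text \<open>For \<open>A = \<close> the Fourier coefficient of \<open>f\<close> at \<open>\<xi>\<close>, the coefficient of \<open>f(h \<cdot>) - f\<close> is \<open>A \<xi>(h) - A\<close>.
  By Plancherel \<open>\<parallel>f(h \<cdot>) - f\<parallel>\<^sup>2\<close> is the sum of the \<open>d\<^sub>\<xi> \<parallel>A \<xi>(h) - A\<parallel>\<^sup>2\<close>; for \<open>h \<in> G\<^sub>n\<close> only the \<open>\<xi>\<close> that are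
  nontrivial on \<open>G\<^sub>n\<close> contribute, each at most \<open>4 d\<^sub>\<xi> \<parallel>A\<parallel>\<^sup>2\<close>, which is the lower estimate of the tail.
  For the upper one, Condition (A) applied to the indicator function of \<open>G\<^sub>n\<close> shows that the mean of
  such a \<open>\<xi>\<close> over \<open>G\<^sub>n\<close> vanishes, so the mean of \<open>\<parallel>A \<xi>(h) - A\<parallel>\<^sup>2\<close> over \<open>h \<in> G\<^sub>n\<close> is \<open>2 \<parallel>A\<parallel>\<^sup>2\<close>, and
  a mean is at most the supremum.  Completeness of the matrix coefficients needs only the
  permutation representations on the finite sets \<open>G/G\<^sub>n\<close>, whose coefficients include the indicator
  functions of the cosets.\<close>

section \<open>Orthonormal systems in \<open>L2\<close>\<close>

text \<open>The subgroups \<open>Gs n\<close> are not assumed normal, so an irreducible \<xi> that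
  is nontrivial on \<open>Gs n\<close> could still have vectors fixed by \<open>Gs n\<close>, and
  its mean over \<open>Gs n\<close> would be the projection onto these vectors rather than 0. This
  is the obstacle to the constant 1/sqrt 2. The coefficient of the indicator of \<open>Gs n\<close>
  is that projection times the measure of \<open>Gs n\<close>; it absorbs every \<xi>(h) with h in
  \<open>Gs n\<close>, so the right side of Condition (A) is zero for it and the projection must
  vanish. The mean over \<open>Gs n\<close> is taken as an L2 inner product with the indicator of
  \<open>Gs n\<close>, which keeps all integrals on G. The dual is not known in advance to be
  countable, so sums over it are controlled through finite subsets: Bessel from above, Parseval up
  to an arbitrary \<epsilon> from below. Sharpness is tested at n = 0 on indicators of small
  subgroups. A translate of such an indicator by an element outside the subgroup is disjoint from
  it, so the squared distance is twice the squared norm, while only the mean value is missing from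
  the tail.\<close>

definition L2_inner :: "'a measure \<Rightarrow> ('a \<Rightarrow> complex) \<Rightarrow> ('a \<Rightarrow> complex) \<Rightarrow> complex" where
  "L2_inner M f g = (LINT x|M. f x * cnj (g x))"

lemma L2_norm_sq: "(L2_norm M f)\<^sup>2 = (LINT x|M. (cmod (f x))\<^sup>2)"
  by (simp add: L2_norm_def)

lemma L2_norm_nonneg [simp]: "0 \<le> L2_norm M f"
  by (simp add: L2_norm_def)

lemma L2_measurable [measurable_dest]: "f \<in> L2 M \<Longrightarrow> f \<in> borel_measurable M"
  by (simp add: L2_def)

lemma L2_cong: "(\<And>x. x \<in> space M \<Longrightarrow> f x = g x) \<Longrightarrow> f \<in> L2 M \<longleftrightarrow> g \<in> L2 M"
  by (simp add: L2_def cong: measurable_cong Bochner_Integration.integrable_cong)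

lemma L2_norm_cong: "(\<And>x. x \<in> space M \<Longrightarrow> f x = g x) \<Longrightarrow> L2_norm M f = L2_norm M g"
  by (simp add: L2_norm_def cong: Bochner_Integration.integral_cong)

lemma L2_inner_cong:
  "(\<And>x. x \<in> space M \<Longrightarrow> f x = f' x) \<Longrightarrow> (\<And>x. x \<in> space M \<Longrightarrow> g x = g' x) \<Longrightarrow>
    L2_inner M f g = L2_inner M f' g'"
  by (simp add: L2_inner_def cong: Bochner_Integration.integral_cong)

text \<open>The triangle inequality in squared form. It integrates termwise without Minkowski, and
  its constant is exact when both norms agree, as for a function and its translate.\<close>

lemma cmod_add_sq_le: "(cmod (a + b))\<^sup>2 \<le> 2 * (cmod a)\<^sup>2 + 2 * (cmod b)\<^sup>2"
proof -
  have "(cmod (a + b))\<^sup>2 \<le> (cmod a + cmod b)\<^sup>2"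
    by (simp add: norm_triangle_ineq power_mono)
  also have "\<dots> \<le> 2 * (cmod a)\<^sup>2 + 2 * (cmod b)\<^sup>2"
    using sum_squares_bound[of "cmod a" "cmod b"] by (simp add: power2_sum)
  finally show ?thesis .
qed

lemma L2_add:
  assumes "f \<in> L2 M" "g \<in> L2 M"
  shows "(\<lambda>x. f x + g x) \<in> L2 M"
proof -
  have "integrable M (\<lambda>x. (cmod (f x + g x))\<^sup>2)"
    by (rule Bochner_Integration.integrable_bound[where f = "\<lambda>x. 2 * (cmod (f x))\<^sup>2 + 2 * (cmod (g x))\<^sup>2"])
      (use assms in \<open>auto simp: L2_def intro!: cmod_add_sq_le\<close>)
  with assms show ?thesis by (auto simp: L2_def)
qed

lemma L2_norm_add_sq_le:
  assumes "f \<in> L2 M" "g \<in> L2 M"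
  shows "(L2_norm M (\<lambda>x. f x + g x))\<^sup>2 \<le> 2 * (L2_norm M f)\<^sup>2 + 2 * (L2_norm M g)\<^sup>2"
proof -
  have "(LINT x|M. (cmod (f x + g x))\<^sup>2) \<le> (LINT x|M. 2 * (cmod (f x))\<^sup>2 + 2 * (cmod (g x))\<^sup>2)"
    by (rule integral_mono) (use assms L2_add[OF assms] in \<open>auto simp: L2_def intro!: cmod_add_sq_le\<close>)
  with assms show ?thesis by (simp add: L2_norm_sq L2_def)
qed

lemma L2_scale: "f \<in> L2 M \<Longrightarrow> (\<lambda>x. c * f x) \<in> L2 M"
  by (auto simp: L2_def norm_mult power_mult_distrib)

lemma L2_diff: "f \<in> L2 M \<Longrightarrow> g \<in> L2 M \<Longrightarrow> (\<lambda>x. f x - g x) \<in> L2 M"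
  using L2_add[of f M "\<lambda>x. - 1 * g x"] L2_scale[of g M "- 1"] by simp

lemma L2_zero: "(\<lambda>x. 0) \<in> L2 M"
  by (simp add: L2_def)

lemma L2_sum: "(\<And>i. i \<in> I \<Longrightarrow> f i \<in> L2 M) \<Longrightarrow> (\<lambda>x. \<Sum>i\<in>I. f i x) \<in> L2 M"
  by (induction I rule: infinite_finite_induct) (auto intro: L2_add L2_zero)

lemma L2_norm_diff_sq_le:
  assumes "f \<in> L2 M" "g \<in> L2 M"
  shows "(L2_norm M (\<lambda>x. f x - g x))\<^sup>2 \<le> 2 * (L2_norm M f)\<^sup>2 + 2 * (L2_norm M g)\<^sup>2"
proof -
  have "L2_norm M (\<lambda>x. - 1 * g x) = L2_norm M g" by (simp add: L2_norm_def)
  then show ?thesis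
    using L2_norm_add_sq_le[OF assms(1) L2_scale[OF assms(2), of "- 1"]] by simp
qed

lemma L2_bounded:
  assumes "finite_measure M" "f \<in> borel_measurable M" "\<And>x. x \<in> space M \<Longrightarrow> cmod (f x) \<le> B"
  shows "f \<in> L2 M"
proof -
  interpret finite_measure M by fact
  have "integrable M (\<lambda>x. (cmod (f x))\<^sup>2)"
    by (rule integrable_const_bound[where B = "B\<^sup>2"])
      (use assms in \<open>auto intro!: AE_I2 power_mono\<close>)
  with assms show ?thesis by (simp add: L2_def)
qed

lemma borel_measurable_cnj [measurable (raw)]:
  "f \<in> borel_measurable M \<Longrightarrow> (\<lambda>x. cnj (f x)) \<in> borel_measurable M"
  by (rule borel_measurable_continuous_on[of cnj]) (auto intro: continuous_intros)

lemma L2_mult_cnj_integrable: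
  assumes "f \<in> L2 M" "g \<in> L2 M"
  shows "integrable M (\<lambda>x. f x * cnj (g x))"
proof (rule Bochner_Integration.integrable_bound[where f = "\<lambda>x. (cmod (f x))\<^sup>2 + (cmod (g x))\<^sup>2"])
  show "AE x in M. norm (f x * cnj (g x)) \<le> norm ((cmod (f x))\<^sup>2 + (cmod (g x))\<^sup>2)"
  proof (rule AE_I2)
    fix x
    have "0 \<le> cmod (f x) * cmod (g x)" "2 * (cmod (f x) * cmod (g x)) \<le> (cmod (f x))\<^sup>2 + (cmod (g x))\<^sup>2"
      using sum_squares_bound[of "cmod (f x)" "cmod (g x)"] by auto
    then have "cmod (f x) * cmod (g x) \<le> (cmod (f x))\<^sup>2 + (cmod (g x))\<^sup>2" by linarith
    then show "norm (f x * cnj (g x)) \<le> norm ((cmod (f x))\<^sup>2 + (cmod (g x))\<^sup>2)"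
      by (simp add: norm_mult)
  qed
qed (use assms in \<open>auto simp: L2_def\<close>)

lemma L2_inner_self: "L2_inner M f f = complex_of_real ((L2_norm M f)\<^sup>2)"
  by (simp add: L2_inner_def L2_norm_sq complex_norm_square[symmetric] flip: integral_complex_of_real)

lemma L2_inner_add_left:
  "f \<in> L2 M \<Longrightarrow> g \<in> L2 M \<Longrightarrow> h \<in> L2 M \<Longrightarrow>
    L2_inner M (\<lambda>x. f x + g x) h = L2_inner M f h + L2_inner M g h"
  by (simp add: L2_inner_def distrib_right L2_mult_cnj_integrable)

lemma L2_inner_diff_left:
  "f \<in> L2 M \<Longrightarrow> g \<in> L2 M \<Longrightarrow> h \<in> L2 M \<Longrightarrow>
    L2_inner M (\<lambda>x. f x - g x) h = L2_inner M f h - L2_inner M g h"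
  by (simp add: L2_inner_def left_diff_distrib L2_mult_cnj_integrable)

lemma L2_inner_scale_left: "L2_inner M (\<lambda>x. c * f x) g = c * L2_inner M f g"
  by (simp add: L2_inner_def mult.assoc)

lemma L2_inner_cnj: "cnj (L2_inner M f g) = L2_inner M g f"
  using Bochner_Integration.integral_cnj[of M "\<lambda>x. f x * cnj (g x)"] by (simp add: L2_inner_def mult.commute)

lemma L2_inner_scale_right: "L2_inner M f (\<lambda>x. c * g x) = cnj c * L2_inner M f g"
  using L2_inner_scale_left[of M c g f] by (metis L2_inner_cnj complex_cnj_mult)

lemma L2_inner_sum_left:
  assumes "\<And>i. i \<in> I \<Longrightarrow> f i \<in> L2 M" "h \<in> L2 M"
  shows "L2_inner M (\<lambda>x. \<Sum>i\<in>I. f i x) h = (\<Sum>i\<in>I. L2_inner M (f i) h)"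
  unfolding L2_inner_def sum_distrib_right
  by (rule Bochner_Integration.integral_sum) (use assms in \<open>auto intro: L2_mult_cnj_integrable\<close>)

lemma L2_norm_diff_sq:
  assumes "f \<in> L2 M" "g \<in> L2 M"
  shows "(L2_norm M (\<lambda>x. f x - g x))\<^sup>2 = (L2_norm M f)\<^sup>2 + (L2_norm M g)\<^sup>2 - 2 * Re (L2_inner M f g)"
proof -
  have i: "integrable M (\<lambda>x. f x * cnj (g x))" by (rule L2_mult_cnj_integrable[OF assms])
  have "(cmod (f x - g x))\<^sup>2 = (cmod (f x))\<^sup>2 + (cmod (g x))\<^sup>2 - 2 * Re (f x * cnj (g x))" for x
    unfolding cmod_power2 by (simp add: power2_eq_square algebra_simps)
  then have "(LINT x|M. (cmod (f x - g x))\<^sup>2)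
      = (LINT x|M. (cmod (f x))\<^sup>2 + (cmod (g x))\<^sup>2 - 2 * Re (f x * cnj (g x)))" by simp
  also have "\<dots> = (LINT x|M. (cmod (f x))\<^sup>2) + (LINT x|M. (cmod (g x))\<^sup>2)
      - 2 * (LINT x|M. Re (f x * cnj (g x)))"
    using assms i by (simp add: L2_def integrable_Re del: times_complex.sel)
  finally show ?thesis
    unfolding L2_norm_sq L2_inner_def using integral_Re[OF i] by simp
qed

section \<open>Orthogonal residuals and Bessel's inequality\<close>

definition orthonormal_family :: "'a measure \<Rightarrow> ('i \<Rightarrow> 'a \<Rightarrow> complex) \<Rightarrow> 'i set \<Rightarrow> bool" where
  "orthonormal_family M e I \<longleftrightarrow> (\<forall>i\<in>I. e i \<in> L2 M) \<and>
     (\<forall>i\<in>I. \<forall>j\<in>I. L2_inner M (e i) (e j) = (if i = j then 1 else 0))"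

text \<open>For an orthonormal family and finite \<open>F\<close>, the component of \<open>f\<close>
  orthogonal to the span of the \<open>e i\<close> with \<open>i \<in> F\<close>; its norm is the
  distance of \<open>f\<close> from that span.\<close>

definition ortho_residual ::
  "'a measure \<Rightarrow> ('i \<Rightarrow> 'a \<Rightarrow> complex) \<Rightarrow> 'i set \<Rightarrow> ('a \<Rightarrow> complex) \<Rightarrow> 'a \<Rightarrow> complex" where
  "ortho_residual M e F f x = f x - (\<Sum>i\<in>F. L2_inner M f (e i) * e i x)"

lemma ortho_residual_L2:
  "orthonormal_family M e I \<Longrightarrow> F \<subseteq> I \<Longrightarrow> f \<in> L2 M \<Longrightarrow> ortho_residual M e F f \<in> L2 M"
  unfolding ortho_residual_def[abs_def] orthonormal_family_def
  by (intro L2_diff L2_sum L2_scale) auto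

text \<open>Pythagoras: for the projection \<open>g\<close>, both \<open>L2_inner M g g\<close> and
  \<open>L2_inner M g f\<close> equal the sum of the squared coefficients, so the cross term removes
  twice what the norm of \<open>g\<close> adds.\<close>

lemma ortho_residual_norm:
  assumes "orthonormal_family M e I" "finite F" "F \<subseteq> I" "f \<in> L2 M"
  shows "(L2_norm M (ortho_residual M e F f))\<^sup>2 = (L2_norm M f)\<^sup>2 - (\<Sum>i\<in>F. (cmod (L2_inner M f (e i)))\<^sup>2)"
proof -
  define a where "a i = L2_inner M f (e i)" for i
  define g where "g x = (\<Sum>i\<in>F. a i * e i x)" for x
  have eL2: "e i \<in> L2 M" if "i \<in> F" for i
    using assms that by (auto simp: orthonormal_family_def)
  have gL2: "g \<in> L2 M" unfolding g_def[abs_def] by (intro L2_sum L2_scale eL2)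
  have g_left: "L2_inner M g h = (\<Sum>i\<in>F. a i * L2_inner M (e i) h)" if "h \<in> L2 M" for h
    unfolding g_def[abs_def] using that eL2
    by (subst L2_inner_sum_left) (auto intro: L2_scale simp: L2_inner_scale_left)
  have "L2_inner M (e i) g = cnj (a i)" if "i \<in> F" for i
  proof -
    have "L2_inner M g (e i) = (\<Sum>j\<in>F. a j * (if j = i then 1 else 0))"
      unfolding g_left[OF eL2[OF that]]
      by (intro sum.cong refl) (use assms that in \<open>auto simp: orthonormal_family_def subset_iff\<close>)
    also have "\<dots> = a i" using assms(2) that by (simp add: if_distrib cong: if_cong)
    finally show ?thesis by (metis L2_inner_cnj)
  qed
  then have gg: "L2_inner M g g = (\<Sum>i\<in>F. complex_of_real ((cmod (a i))\<^sup>2))"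
    unfolding g_left[OF gL2] by (intro sum.cong) (auto simp: complex_norm_square simp flip: of_real_power)
  have gf: "L2_inner M g f = (\<Sum>i\<in>F. complex_of_real ((cmod (a i))\<^sup>2))"
    unfolding g_left[OF assms(4)]
    by (intro sum.cong) (auto simp: complex_norm_square a_def L2_inner_cnj simp flip: of_real_power)
  have "(L2_norm M g)\<^sup>2 = (\<Sum>i\<in>F. (cmod (a i))\<^sup>2)"
    using gg unfolding L2_inner_self by (simp flip: of_real_sum of_real_power)
  moreover have "Re (L2_inner M f g) = (\<Sum>i\<in>F. (cmod (a i))\<^sup>2)"
    using gf L2_inner_cnj[of M g f] by (metis Re_complex_of_real complex_cnj_complex_of_real of_real_sum)
  ultimately show ?thesis
    using L2_norm_diff_sq[OF assms(4) gL2]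
    unfolding ortho_residual_def[abs_def] g_def[abs_def] a_def by simp
qed

lemma bessel_inequality:
  assumes "orthonormal_family M e I" "finite F" "F \<subseteq> I" "f \<in> L2 M"
  shows "(\<Sum>i\<in>F. (cmod (L2_inner M f (e i)))\<^sup>2) \<le> (L2_norm M f)\<^sup>2"
  using ortho_residual_norm[OF assms] zero_le_power2[of "L2_norm M (ortho_residual M e F f)"] by linarith

lemma ortho_residual_antimono:
  assumes "orthonormal_family M e I" "finite F'" "F \<subseteq> F'" "F' \<subseteq> I" "f \<in> L2 M"
  shows "(L2_norm M (ortho_residual M e F' f))\<^sup>2 \<le> (L2_norm M (ortho_residual M e F f))\<^sup>2"
proof -
  have "(\<Sum>i\<in>F. (cmod (L2_inner M f (e i)))\<^sup>2) \<le> (\<Sum>i\<in>F'. (cmod (L2_inner M f (e i)))\<^sup>2)"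
    using assms by (intro sum_mono2) auto
  moreover have "F \<subseteq> I" "finite F" using assms finite_subset by auto
  ultimately show ?thesis using assms by (simp add: ortho_residual_norm)
qed

lemma ortho_residual_le:
  assumes "orthonormal_family M e I" "finite F" "F \<subseteq> I" "f \<in> L2 M"
  shows "(L2_norm M (ortho_residual M e F f))\<^sup>2 \<le> (L2_norm M f)\<^sup>2"
  using ortho_residual_norm[OF assms] sum_nonneg[of F "\<lambda>i. (cmod (L2_inner M f (e i)))\<^sup>2"] by simp

lemma ortho_residual_add:
  assumes "orthonormal_family M e I" "F \<subseteq> I" "f \<in> L2 M" "g \<in> L2 M"
  shows "ortho_residual M e F (\<lambda>x. f x + g x) = (\<lambda>x. ortho_residual M e F f x + ortho_residual M e F g x)"
proof
  fix x
  have "(\<Sum>i\<in>F. L2_inner M (\<lambda>x. f x + g x) (e i) * e i x)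
      = (\<Sum>i\<in>F. L2_inner M f (e i) * e i x + L2_inner M g (e i) * e i x)"
    by (intro sum.cong refl, subst L2_inner_add_left)
      (use assms in \<open>auto simp: orthonormal_family_def algebra_simps\<close>)
  then show "ortho_residual M e F (\<lambda>x. f x + g x) x = ortho_residual M e F f x + ortho_residual M e F g x"
    by (simp add: ortho_residual_def sum.distrib)
qed

lemma ortho_residual_scale:
  "ortho_residual M e F (\<lambda>x. c * f x) = (\<lambda>x. c * ortho_residual M e F f x)"
  by (auto simp: ortho_residual_def L2_inner_scale_left right_diff_distrib sum_distrib_left mult.assoc)

section \<open>The closed span of an orthonormal family and a density criterion\<close>

text \<open>For an orthonormal family this is the closed linear span. Projection onto a finite span
  is the best approximation, so it suffices to quantify over finite index sets, without
  coefficients.\<close>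

definition ortho_closure :: "'a measure \<Rightarrow> ('i \<Rightarrow> 'a \<Rightarrow> complex) \<Rightarrow> 'i set \<Rightarrow> ('a \<Rightarrow> complex) set" where
  "ortho_closure M e I = {f \<in> L2 M. \<forall>\<epsilon>>0. \<exists>F. finite F \<and> F \<subseteq> I \<and>
     (L2_norm M (ortho_residual M e F f))\<^sup>2 < \<epsilon>}"

lemma ortho_closure_L2: "f \<in> ortho_closure M e I \<Longrightarrow> f \<in> L2 M"
  by (simp add: ortho_closure_def)

lemma ortho_closureD:
  assumes "f \<in> ortho_closure M e I" "\<epsilon> > 0"
  obtains F where "finite F" "F \<subseteq> I" "(L2_norm M (ortho_residual M e F f))\<^sup>2 < \<epsilon>"
  using assms unfolding ortho_closure_def by blast

lemma ortho_closure_cong: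
  assumes "f \<in> ortho_closure M e I" "\<And>x. x \<in> space M \<Longrightarrow> f x = g x"
  shows "g \<in> ortho_closure M e I"
proof -
  have "L2_inner M f (e i) = L2_inner M g (e i)" for i
    using assms(2) by (intro L2_inner_cong) auto
  then have "L2_norm M (ortho_residual M e F f) = L2_norm M (ortho_residual M e F g)" for F
    using assms(2) by (intro L2_norm_cong) (auto simp: ortho_residual_def)
  moreover have "f \<in> L2 M \<longleftrightarrow> g \<in> L2 M" by (rule L2_cong) (use assms in auto)
  ultimately show ?thesis using assms by (simp add: ortho_closure_def)
qed

lemma ortho_closure_base:
  assumes "orthonormal_family M e I" "i \<in> I"
  shows "e i \<in> ortho_closure M e I"
proof -
  have "ortho_residual M e {i} (e i) = (\<lambda>x. 0)"
    using assms by (auto simp: ortho_residual_def orthonormal_family_def)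
  then have "(L2_norm M (ortho_residual M e {i} (e i)))\<^sup>2 = 0" by (simp add: L2_norm_def)
  moreover have "e i \<in> L2 M" using assms by (simp add: orthonormal_family_def)
  ultimately show ?thesis
    unfolding ortho_closure_def using assms(2) by (intro CollectI conjI allI impI exI[of _ "{i}"]) simp_all
qed

lemma ortho_closure_zero: "(\<lambda>x. 0) \<in> ortho_closure M e I"
  unfolding ortho_closure_def
  by (intro CollectI conjI allI impI exI[of _ "{}"]) (simp_all add: L2_zero ortho_residual_def L2_norm_def)

lemma ortho_closure_scale:
  assumes "f \<in> ortho_closure M e I"
  shows "(\<lambda>x. c * f x) \<in> ortho_closure M e I"
proof (cases "c = 0")
  case True
  then show ?thesis by (simp add: ortho_closure_zero)
next
  case False
  have n: "(L2_norm M (\<lambda>x. c * g x))\<^sup>2 = (cmod c)\<^sup>2 * (L2_norm M g)\<^sup>2" for g :: "'a \<Rightarrow> complex"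
    by (simp add: L2_norm_sq norm_mult power_mult_distrib)
  have "\<exists>F. finite F \<and> F \<subseteq> I \<and> (L2_norm M (ortho_residual M e F (\<lambda>x. c * f x)))\<^sup>2 < \<epsilon>" if "\<epsilon> > 0" for \<epsilon>
  proof -
    have "\<epsilon> / (cmod c)\<^sup>2 > 0" using that False by simp
    then obtain F where "finite F" "F \<subseteq> I" "(L2_norm M (ortho_residual M e F f))\<^sup>2 < \<epsilon> / (cmod c)\<^sup>2"
      using ortho_closureD[OF assms] by blast
    then show ?thesis
      using False by (intro exI[of _ F]) (simp add: ortho_residual_scale n field_simps)
  qed
  then show ?thesis using assms by (auto simp: ortho_closure_def L2_scale)
qed

lemma ortho_closure_add:
  assumes o: "orthonormal_family M e I" and f: "f \<in> ortho_closure M e I" and g: "g \<in> ortho_closure M e I"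
  shows "(\<lambda>x. f x + g x) \<in> ortho_closure M e I"
proof -
  have L: "f \<in> L2 M" "g \<in> L2 M" using f g by (auto simp: ortho_closure_def)
  have "\<exists>F. finite F \<and> F \<subseteq> I \<and> (L2_norm M (ortho_residual M e F (\<lambda>x. f x + g x)))\<^sup>2 < \<epsilon>"
    if "\<epsilon> > 0" for \<epsilon>
  proof -
    have "\<epsilon> / 4 > 0" using that by simp
    then obtain F F' where F: "finite F" "F \<subseteq> I" "(L2_norm M (ortho_residual M e F f))\<^sup>2 < \<epsilon> / 4"
        and F': "finite F'" "F' \<subseteq> I" "(L2_norm M (ortho_residual M e F' g))\<^sup>2 < \<epsilon> / 4"
      using ortho_closureD[OF f] ortho_closureD[OF g] by metis
    \<comment> \<open>Residuals shrink as the index set grows, so the union serves both functions;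
      \<epsilon>/4 absorbs the factor 2 of the squared triangle inequality.\<close>
    let ?F = "F \<union> F'"
    have FI: "finite ?F" "?F \<subseteq> I" using F F' by auto
    have "(L2_norm M (ortho_residual M e ?F (\<lambda>x. f x + g x)))\<^sup>2
        \<le> 2 * (L2_norm M (ortho_residual M e ?F f))\<^sup>2 + 2 * (L2_norm M (ortho_residual M e ?F g))\<^sup>2"
      unfolding ortho_residual_add[OF o FI(2) L]
      by (intro L2_norm_add_sq_le ortho_residual_L2[OF o FI(2)] L)
    also have "\<dots> \<le> 2 * (L2_norm M (ortho_residual M e F f))\<^sup>2 + 2 * (L2_norm M (ortho_residual M e F' g))\<^sup>2"
      by (intro add_mono mult_left_mono ortho_residual_antimono[OF o] FI L) auto
    also have "\<dots> < \<epsilon>" using F F' by simp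
    finally show ?thesis using FI by blast
  qed
  then show ?thesis using L by (simp add: ortho_closure_def L2_add)
qed

lemma ortho_closure_diff:
  assumes o: "orthonormal_family M e I" and f: "f \<in> ortho_closure M e I" and g: "g \<in> ortho_closure M e I"
  shows "(\<lambda>x. f x - g x) \<in> ortho_closure M e I"
  using ortho_closure_add[OF o f ortho_closure_scale[OF g, of "- 1"]] by simp

lemma ortho_closure_sum:
  assumes "orthonormal_family M e I" "\<And>k. k \<in> K \<Longrightarrow> f k \<in> ortho_closure M e I"
  shows "(\<lambda>x. \<Sum>k\<in>K. f k x) \<in> ortho_closure M e I"
  using assms(2)
  by (induction K rule: infinite_finite_induct)
    (auto intro: ortho_closure_add[OF assms(1)] ortho_closure_zero)

text \<open>Split \<open>f\<close> as \<open>(f - g) + g\<close>: taking residuals is linear and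
  does not increase the norm, so a finite set that is good for \<open>g\<close> is good for
  \<open>f\<close>.\<close>

lemma ortho_closure_limit:
  assumes o: "orthonormal_family M e I" and f: "f \<in> L2 M"
    and approx: "\<And>\<epsilon>. \<epsilon> > 0 \<Longrightarrow> \<exists>g \<in> ortho_closure M e I. (L2_norm M (\<lambda>x. f x - g x))\<^sup>2 < \<epsilon>"
  shows "f \<in> ortho_closure M e I"
proof -
  have "\<exists>F. finite F \<and> F \<subseteq> I \<and> (L2_norm M (ortho_residual M e F f))\<^sup>2 < \<epsilon>" if "\<epsilon> > 0" for \<epsilon>
  proof -
    have e4: "\<epsilon> / 4 > 0" using that by simp
    then obtain g where g: "g \<in> ortho_closure M e I" "(L2_norm M (\<lambda>x. f x - g x))\<^sup>2 < \<epsilon> / 4"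
      using approx by blast
    from ortho_closureD[OF g(1) e4] obtain F where
      F: "finite F" "F \<subseteq> I" "(L2_norm M (ortho_residual M e F g))\<^sup>2 < \<epsilon> / 4" .
    have gL: "g \<in> L2 M" and hL: "(\<lambda>x. f x - g x) \<in> L2 M"
      using g f by (auto simp: ortho_closure_def L2_diff)
    have "ortho_residual M e F f = (\<lambda>x. ortho_residual M e F (\<lambda>x. f x - g x) x + ortho_residual M e F g x)"
      using ortho_residual_add[OF o F(2) hL gL] by simp
    then have "(L2_norm M (ortho_residual M e F f))\<^sup>2
        \<le> 2 * (L2_norm M (ortho_residual M e F (\<lambda>x. f x - g x)))\<^sup>2 + 2 * (L2_norm M (ortho_residual M e F g))\<^sup>2"
      using L2_norm_add_sq_le[OF ortho_residual_L2[OF o F(2) hL] ortho_residual_L2[OF o F(2) gL]] by simp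
    also have "\<dots> < \<epsilon>"
      using ortho_residual_le[OF o F(1,2) hL] F(3) g(2) by linarith
    finally show ?thesis using F by blast
  qed
  with f show ?thesis by (simp add: ortho_closure_def)
qed

text \<open>Parseval up to \<epsilon> on a finite set. In this form it combines with termwise
  estimates before any infinite sum is formed.\<close>

lemma ortho_closure_parseval:
  assumes "orthonormal_family M e I" "f \<in> ortho_closure M e I" "\<epsilon> > 0"
  obtains F where "finite F" "F \<subseteq> I" "(L2_norm M f)\<^sup>2 < (\<Sum>i\<in>F. (cmod (L2_inner M f (e i)))\<^sup>2) + \<epsilon>"
proof -
  obtain F where F: "finite F" "F \<subseteq> I" "(L2_norm M (ortho_residual M e F f))\<^sup>2 < \<epsilon>"
    using ortho_closureD[OF assms(2,3)] by blast
  with ortho_residual_norm[OF assms(1) F(1,2) ortho_closure_L2[OF assms(2)]] show ?thesis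
    by (intro that[of F]) auto
qed

lemma L2_indicator:
  assumes "finite_measure M" "A \<in> sets M"
  shows "(\<lambda>x. indicator A x :: complex) \<in> L2 M"
    "(L2_norm M (\<lambda>x. indicator A x :: complex))\<^sup>2 = measure M A"
proof -
  have 1: "(cmod (indicator A x))\<^sup>2 = indicator A x" for x by (simp split: split_indicator)
  show "(\<lambda>x. indicator A x :: complex) \<in> L2 M"
    by (rule L2_bounded[OF assms(1), where B = 1]) (use assms in \<open>auto split: split_indicator\<close>)
  show "(L2_norm M (\<lambda>x. indicator A x :: complex))\<^sup>2 = measure M A"
    using assms sets.sets_into_space[OF assms(2)] by (simp add: L2_norm_sq 1 Int_absorb2)
qed

text \<open>Density: a \<open>\<pi>\<close>-\<open>\<lambda>\<close> argument passes from the generating sets to all measurable sets,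
  and dominated convergence from simple functions to \<open>L2\<close>.\<close>

lemma ortho_closure_eq_L2:
  assumes o: "orthonormal_family M e I" and fm: "finite_measure M"
    and sets: "sets M = sigma_sets (space M) C" and C: "Int_stable C" "C \<subseteq> Pow (space M)"
    and gen: "\<And>A. A \<in> C \<Longrightarrow> (\<lambda>x. indicator A x) \<in> ortho_closure M e I"
    and space: "(\<lambda>x. indicator (space M) x) \<in> ortho_closure M e I"
  shows "ortho_closure M e I = L2 M"
proof (intro equalityI subsetI)
  fix f assume "f \<in> ortho_closure M e I"
  then show "f \<in> L2 M" by (rule ortho_closure_L2)
next
  interpret finite_measure M by fact
  have ind: "(\<lambda>x. indicator A x) \<in> ortho_closure M e I" if "A \<in> sets M" for A
    using C that[unfolded sets]
  proof (induction rule: sigma_sets_induct_disjoint)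
    case (basic A)
    then show ?case by (rule gen)
  next
    case empty
    then show ?case by (simp add: ortho_closure_zero)
  next
    case (compl A)
    then have "A \<in> sets M" using sets by simp
    then have A: "A \<subseteq> space M" using sets.sets_into_space by auto
    show ?case
      by (rule ortho_closure_cong[OF ortho_closure_diff[OF o space compl.IH]])
        (use A in \<open>auto split: split_indicator\<close>)
  next
    case (union A)
    have As: "range A \<subseteq> sets M" using union sets by simp
    then have As': "A i \<in> sets M" for i by auto
    have U: "(\<Union>i. A i) \<in> sets M" using As by auto
    show ?case
    proof (rule ortho_closure_limit[OF o L2_indicator(1)[OF fm U]])
      fix \<epsilon> :: real assume \<epsilon>: "\<epsilon> > 0"
      \<comment> \<open>The squared L2 distance between the indicators of the union and of a finite
        partial union is the measure of the rest \<open>?W\<close>, which tends to 0.\<close>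
      have "(\<lambda>n. \<Sum>i<n. measure M (A i)) \<longlonglongrightarrow> measure M (\<Union>i. A i)"
        using finite_measure_UNION[OF As union(1)] by (simp add: sums_def)
      with \<epsilon> have "eventually (\<lambda>n. dist (\<Sum>i<n. measure M (A i)) (measure M (\<Union>i. A i)) < \<epsilon>) sequentially"
        by (intro tendstoD)
      then obtain n where n: "dist (\<Sum>i<n. measure M (A i)) (measure M (\<Union>i. A i)) < \<epsilon>"
        by (auto simp: eventually_sequentially)
      let ?V = "\<Union>i<n. A i" and ?W = "(\<Union>i. A i) - (\<Union>i<n. A i)"
      have V: "?V \<in> sets M" using As' by auto
      have dis: "disjoint_family_on A {..<n}" using union(1) by (auto simp: disjoint_family_on_def)
      have mV: "measure M ?V = (\<Sum>i<n. measure M (A i))"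
        by (rule finite_measure_finite_Union) (use As' dis in auto)
      have VI: "(\<lambda>x. indicator ?V x) \<in> ortho_closure M e I"
      proof (rule ortho_closure_cong[OF ortho_closure_sum[OF o, of "{..<n}" "\<lambda>i x. indicator (A i) x"]])
        fix x show "(\<Sum>i<n. indicator (A i) x) = (indicator ?V x :: complex)"
          by (subst indicator_UN_disjoint[OF _ dis]) simp_all
      qed (rule union.IH)
      have "(\<lambda>x. indicator (\<Union>i. A i) x - indicator ?V x :: complex) = (\<lambda>x. indicator ?W x)"
        by (auto split: split_indicator)
      then have "(L2_norm M (\<lambda>x. indicator (\<Union>i. A i) x - indicator ?V x :: complex))\<^sup>2 = measure M ?W"
        using L2_indicator(2)[OF fm, of ?W] U V by simp
      also have "\<dots> = measure M (\<Union>i. A i) - measure M ?V"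
        by (rule finite_measure_Diff[OF U V]) auto
      also have "\<dots> < \<epsilon>" using n mV by (simp add: dist_real_def)
      finally show "\<exists>g\<in>ortho_closure M e I. (L2_norm M (\<lambda>x. indicator (\<Union>i. A i) x - g x))\<^sup>2 < \<epsilon>"
        using VI by blast
    qed
  qed
  fix f assume f: "f \<in> L2 M"
  then have fb: "f \<in> borel_measurable M" by simp
  obtain s where s: "\<And>i. simple_function M (s i)" "\<And>x. x \<in> space M \<Longrightarrow> (\<lambda>i. s i x) \<longlonglongrightarrow> f x"
      "\<And>i x. x \<in> space M \<Longrightarrow> norm (s i x) \<le> 2 * norm (f x)"
    using borel_measurable_implies_sequence_metric[OF fb, of 0] unfolding dist_norm diff_0_right by blast
  have sc: "s i \<in> ortho_closure M e I" for i
  proof (rule ortho_closure_cong[OF ortho_closure_sum[OF o, of "s i ` space M"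
          "\<lambda>y x. y * indicator (s i -` {y} \<inter> space M) x"]])
    fix y show "(\<lambda>x. y * indicator (s i -` {y} \<inter> space M) x) \<in> ortho_closure M e I"
      by (rule ortho_closure_scale[OF ind]) (rule simple_functionD(2)[OF s(1)])
  next
    fix x assume x: "x \<in> space M"
    have "(\<Sum>y\<in>s i ` space M. y * indicator (s i -` {y} \<inter> space M) x)
        = (\<Sum>y\<in>s i ` space M. if y = s i x then y else 0)"
      using x by (intro sum.cong) (auto split: split_indicator)
    also have "\<dots> = s i x" using x simple_functionD(1)[OF s(1)] by simp
    finally show "(\<Sum>y\<in>s i ` space M. y * indicator (s i -` {y} \<inter> space M) x) = s i x" .
  qed
  \<comment> \<open>Since \<open>norm (s i x) \<le> 2 * norm (f x)\<close>, the difference is at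
    most 3 |f x|; hence the dominating function 9 |f x|^2.\<close>
  have lim: "(\<lambda>i. LINT x|M. (cmod (f x - s i x))\<^sup>2) \<longlonglongrightarrow> (LINT x|M. 0)"
  proof (rule integral_dominated_convergence[where w = "\<lambda>x. 9 * (cmod (f x))\<^sup>2"])
    show "integrable M (\<lambda>x. 9 * (cmod (f x))\<^sup>2)" using f by (simp add: L2_def)
    show "(\<lambda>x. (cmod (f x - s i x))\<^sup>2) \<in> borel_measurable M" for i
      using fb s(1)[of i, THEN borel_measurable_simple_function] by measurable
    show "AE x in M. (\<lambda>i. (cmod (f x - s i x))\<^sup>2) \<longlonglongrightarrow> 0"
    proof (rule AE_I2)
      fix x assume "x \<in> space M"
      from tendsto_diff[OF tendsto_const s(2)[OF this], of "f x"]
      have "(\<lambda>i. (cmod (f x - s i x))\<^sup>2) \<longlonglongrightarrow> (cmod (f x - f x))\<^sup>2" by (intro tendsto_power tendsto_norm)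
      then show "(\<lambda>i. (cmod (f x - s i x))\<^sup>2) \<longlonglongrightarrow> 0" by simp
    qed
    show "AE x in M. norm ((cmod (f x - s i x))\<^sup>2) \<le> 9 * (cmod (f x))\<^sup>2" for i
    proof (rule AE_I2)
      fix x assume "x \<in> space M"
      then have "cmod (f x - s i x) \<le> 3 * cmod (f x)"
        using s(3)[of x i] norm_triangle_ineq4[of "f x" "s i x"] by linarith
      then have "(cmod (f x - s i x))\<^sup>2 \<le> (3 * cmod (f x))\<^sup>2" by (rule power_mono) simp
      then show "norm ((cmod (f x - s i x))\<^sup>2) \<le> 9 * (cmod (f x))\<^sup>2" by (simp add: power_mult_distrib)
    qed
  qed auto
  show "f \<in> ortho_closure M e I"
  proof (rule ortho_closure_limit[OF o f])
    fix \<epsilon> :: real assume "\<epsilon> > 0"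
    with lim have "eventually (\<lambda>i. dist (LINT x|M. (cmod (f x - s i x))\<^sup>2) (LINT x|M. 0) < \<epsilon>) sequentially"
      by (intro tendstoD)
    then obtain i where "dist (LINT x|M. (cmod (f x - s i x))\<^sup>2) (LINT x|M. 0) < \<epsilon>"
      by (auto simp: eventually_sequentially)
    then have "(L2_norm M (\<lambda>x. f x - s i x))\<^sup>2 < \<epsilon>" by (simp add: L2_norm_sq)
    with sc show "\<exists>g\<in>ortho_closure M e I. (L2_norm M (\<lambda>x. f x - g x))\<^sup>2 < \<epsilon>" by blast
  qed
qed

section \<open>Unitary matrices and invariant subspaces\<close>

lemma dim_mat_adjoint [simp]: "dim_row (mat_adjoint A) = dim_col A" "dim_col (mat_adjoint A) = dim_row A"
  by (simp_all add: mat_adjoint_def)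

lemma index_mat_adjoint [simp]:
  fixes A :: "complex mat"
  shows "i < dim_col A \<Longrightarrow> j < dim_row A \<Longrightarrow> mat_adjoint A $$ (i, j) = cnj (A $$ (j, i))"
  by (simp add: mat_adjoint_def mat_of_rows_index conjugate_complex_def)

lemma mat_adjoint_carrier [simp, intro]: "A \<in> carrier_mat n m \<Longrightarrow> mat_adjoint A \<in> carrier_mat m n"
  by auto

lemma mat_adjoint_adjoint [simp]: "mat_adjoint (mat_adjoint (A :: complex mat)) = A"
  by (rule eq_matI) auto

lemma mult_mat_index_sum:
  "A \<in> carrier_mat n m \<Longrightarrow> B \<in> carrier_mat m k \<Longrightarrow> i < n \<Longrightarrow> j < k \<Longrightarrow>
    (A * B) $$ (i, j) = (\<Sum>l<m. A $$ (i, l) * B $$ (l, j))"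
  by (auto simp: scalar_prod_def lessThan_atLeast0 intro!: sum.cong)

lemma mult_mat_vec_index_sum:
  "A \<in> carrier_mat n m \<Longrightarrow> v \<in> carrier_vec m \<Longrightarrow> i < n \<Longrightarrow>
    vec_index (A *\<^sub>v v) i = (\<Sum>l<m. A $$ (i, l) * vec_index v l)"
  by (auto simp: scalar_prod_def lessThan_atLeast0 intro!: sum.cong)

lemma mat_adjoint_mult:
  fixes A B :: "complex mat"
  assumes "A \<in> carrier_mat n m" "B \<in> carrier_mat m k"
  shows "mat_adjoint (A * B) = mat_adjoint B * mat_adjoint A"
proof (rule eq_matI)
  fix i j assume "i < dim_row (mat_adjoint B * mat_adjoint A)" "j < dim_col (mat_adjoint B * mat_adjoint A)"
  then have ij: "i < k" "j < n" using assms by auto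
  have "mat_adjoint (A * B) $$ (i, j) = cnj ((A * B) $$ (j, i))"
    using assms ij by (subst index_mat_adjoint) auto
  also have "\<dots> = (\<Sum>l<m. mat_adjoint B $$ (i, l) * mat_adjoint A $$ (l, j))"
    using assms ij by (subst mult_mat_index_sum[OF assms]) (auto simp: mult.commute intro!: sum.cong)
  also have "\<dots> = (mat_adjoint B * mat_adjoint A) $$ (i, j)"
    by (rule mult_mat_index_sum[symmetric, where n = k and k = n]) (use assms ij in auto)
  finally show "mat_adjoint (A * B) $$ (i, j) = (mat_adjoint B * mat_adjoint A) $$ (i, j)" .
qed (use assms in auto)

lemma unitary_matrixD:
  assumes "unitary_matrix U" "U \<in> carrier_mat d d"
  shows "mat_adjoint U * U = 1\<^sub>m d" "U * mat_adjoint U = 1\<^sub>m d"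
  using assms by (auto simp: unitary_matrix_def)

lemma unitary_matrixI:
  "U \<in> carrier_mat d d \<Longrightarrow> mat_adjoint U * U = 1\<^sub>m d \<Longrightarrow> U * mat_adjoint U = 1\<^sub>m d \<Longrightarrow> unitary_matrix U"
  by (auto simp: unitary_matrix_def)

lemma unitary_matrix_adjoint: "unitary_matrix U \<Longrightarrow> unitary_matrix (mat_adjoint U)"
  by (force simp: unitary_matrix_def)

lemma mult_mat_assoc4:
  assumes "A \<in> carrier_mat a b" "B \<in> carrier_mat b c" "C \<in> carrier_mat c d" "D \<in> carrier_mat d e"
  shows "A * B * (C * D) = A * (B * C) * D"
proof -
  have "A * B * (C * D) = A * (B * (C * D))"
    using assms by (intro assoc_mult_mat) auto
  also have "B * (C * D) = B * C * D"
    using assms by (intro assoc_mult_mat[symmetric]) auto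
  also have "A * (B * C * D) = A * (B * C) * D"
    using assms by (intro assoc_mult_mat[symmetric]) auto
  finally show ?thesis .
qed

lemma unitary_matrix_mult:
  assumes "unitary_matrix U" "unitary_matrix V" "U \<in> carrier_mat d d" "V \<in> carrier_mat d d"
  shows "unitary_matrix (U * V)"
proof (rule unitary_matrixI[where d = d])
  note c = assms(3,4) and u = unitary_matrixD[OF assms(1,3)] and v = unitary_matrixD[OF assms(2,4)]
  have a: "mat_adjoint U \<in> carrier_mat d d" "mat_adjoint V \<in> carrier_mat d d" using c by auto
  have "mat_adjoint (U * V) * (U * V) = mat_adjoint V * (mat_adjoint U * U) * V"
    unfolding mat_adjoint_mult[OF c] using c a by (intro mult_mat_assoc4)
  then show "mat_adjoint (U * V) * (U * V) = 1\<^sub>m d" using c a u v by simp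
  have "U * V * mat_adjoint (U * V) = U * (V * mat_adjoint V) * mat_adjoint U"
    unfolding mat_adjoint_mult[OF c] using c a by (intro mult_mat_assoc4)
  then show "U * V * mat_adjoint (U * V) = 1\<^sub>m d" using c a u v by simp
qed (use assms in auto)

section \<open>Subspaces of complex coordinate space and Schur's lemma\<close>

lemma subspace_vec_iff:
  "VectorSpace.subspace class_ring W (module_vec TYPE(complex) d) \<longleftrightarrow>
    W \<subseteq> carrier_vec d \<and> 0\<^sub>v d \<in> W \<and> (\<forall>v\<in>W. \<forall>w\<in>W. v + w \<in> W) \<and> (\<forall>c. \<forall>v\<in>W. c \<cdot>\<^sub>v v \<in> W)"
  (is "?L \<longleftrightarrow> ?R")
proof
  assume ?L
  then have "LinearCombinations.submodule class_ring W (module_vec TYPE(complex) d)"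
    by (simp add: VectorSpace.subspace_def)
  then show ?R
    unfolding LinearCombinations.submodule_def by (simp add: module_vec_simps)
next
  assume R: ?R
  have m: "Module.module (class_ring :: complex ring) (module_vec TYPE(complex) d)"
    using vec_vs by (rule vectorspace.axioms(1))
  show ?L
    unfolding VectorSpace.subspace_def LinearCombinations.submodule_def
    using R m vec_vs by (simp add: module_vec_simps)
qed

text \<open>Bessel for the counting measure on \<open>{..<d}\<close>: testing with the l-th unit
  vector bounds the sum over i of |u_i(l)|^2 by 1. Summing over l and exchanging the sums gives k on
  the left and d on the right.\<close>

lemma orthonormal_vectors_le_dim:
  fixes u :: "nat \<Rightarrow> complex vec"
  assumes "\<And>i j. i < k \<Longrightarrow> j < k \<Longrightarrow>
    (\<Sum>l<d. vec_index (u i) l * cnj (vec_index (u j) l)) = (if i = j then 1 else 0)"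
  shows "k \<le> d"
proof -
  let ?M = "count_space {..<d}"
  have inner: "L2_inner ?M f g = (\<Sum>l<d. f l * cnj (g l))" for f g
    by (simp add: L2_inner_def lebesgue_integral_count_space_finite)
  have L: "f \<in> L2 ?M" for f by (simp add: L2_def integrable_count_space)
  have "(\<Sum>i<k. (cmod (vec_index (u i) l))\<^sup>2) \<le> 1" if l: "l < d" for l
  proof -
    let ?f = "\<lambda>x. if x = l then 1 else 0 :: complex"
    have on: "orthonormal_family ?M (\<lambda>i l. vec_index (u i) l) {..<k}"
      using assms L by (auto simp: orthonormal_family_def inner)
    have "L2_inner ?M ?f (\<lambda>l. vec_index (u i) l) = cnj (vec_index (u i) l)" for i
      using l by (simp add: inner if_distrib[of "\<lambda>x. x * _"] cong: if_cong)
    moreover have "(L2_norm ?M ?f)\<^sup>2 = 1"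
    proof -
      have "complex_of_real ((L2_norm ?M ?f)\<^sup>2) = 1"
        using l unfolding L2_inner_self[symmetric] inner by (simp add: if_distrib[of "\<lambda>x. x * _"] cong: if_cong)
      then show ?thesis using of_real_eq_1_iff by blast
    qed
    ultimately show ?thesis using bessel_inequality[OF on, of "{..<k}" ?f] L by simp
  qed
  then have "(\<Sum>l<d. \<Sum>i<k. (cmod (vec_index (u i) l))\<^sup>2) \<le> (\<Sum>l<d. 1)" by (intro sum_mono) auto
  moreover have "(\<Sum>l<d. \<Sum>i<k. (cmod (vec_index (u i) l))\<^sup>2) = (\<Sum>i<k. \<Sum>l<d. (cmod (vec_index (u i) l))\<^sup>2)"
    by (rule sum.swap)
  moreover have "(\<Sum>l<d. (cmod (vec_index (u i) l))\<^sup>2) = 1" if "i < k" for i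
  proof -
    have "complex_of_real (\<Sum>l<d. (cmod (vec_index (u i) l))\<^sup>2) = 1"
      using assms[OF that that] by (simp add: complex_norm_square del: of_real_power)
    then show ?thesis using of_real_eq_1_iff by blast
  qed
  ultimately show ?thesis by simp
qed

text \<open>The columns of \<open>P\<close> are a maximal orthonormal family in \<open>W\<close>.\<close>

lemma isometry_onto_subspace:
  assumes "VectorSpace.subspace class_ring W (module_vec TYPE(complex) d)"
  obtains k P where "k \<le> d" "P \<in> carrier_mat d k" "mat_adjoint P * P = 1\<^sub>m k"
    "\<And>v. v \<in> carrier_vec k \<Longrightarrow> P *\<^sub>v v \<in> W"
    "\<And>w. w \<in> W \<Longrightarrow> P *\<^sub>v (mat_adjoint P *\<^sub>v w) = w"
proof -
  from assms have W: "W \<subseteq> carrier_vec d" "0\<^sub>v d \<in> W" "\<And>v w. v \<in> W \<Longrightarrow> w \<in> W \<Longrightarrow> v + w \<in> W"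
      "\<And>c v. v \<in> W \<Longrightarrow> c \<cdot>\<^sub>v v \<in> W"
    by (auto simp: subspace_vec_iff)
  define ON where "ON k u \<longleftrightarrow> (\<forall>i<k. u i \<in> W) \<and> (\<forall>i<k. \<forall>j<k.
    (\<Sum>l<d. vec_index (u i) l * cnj (vec_index (u j) l)) = (if i = j then 1 else 0))"
    for k and u :: "nat \<Rightarrow> complex vec"
  \<comment> \<open>The summand \<open>w\<close> is kept general: the zero vector gives images of
    coefficient vectors under \<open>P\<close>, an arbitrary \<open>w\<close> gives its
    residual.\<close>
  have comb: "vec d (\<lambda>l. vec_index w l + (\<Sum>i<m. c i * vec_index (u i) l)) \<in> W"
    if "w \<in> W" "\<And>i. i < m \<Longrightarrow> u i \<in> W" for w u c and m :: nat
    using that(2)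
  proof (induction m)
    case 0
    have "vec d (\<lambda>l. vec_index w l) = w" using that(1) W(1) by (intro eq_vecI) auto
    then show ?case using that(1) by simp
  next
    case (Suc m)
    have "vec d (\<lambda>l. vec_index w l + (\<Sum>i<Suc m. c i * vec_index (u i) l))
        = vec d (\<lambda>l. vec_index w l + (\<Sum>i<m. c i * vec_index (u i) l)) + c m \<cdot>\<^sub>v u m"
      using Suc.prems[of m] W(1) by (intro eq_vecI) auto
    then show ?case using W(3)[OF Suc.IH W(4)[of "u m" "c m"]] Suc.prems by simp
  qed
  have "\<exists>u. ON 0 u" by (simp add: ON_def)
  moreover have "\<forall>k. (\<exists>u. ON k u) \<longrightarrow> k \<le> d"
    using orthonormal_vectors_le_dim unfolding ON_def by blast
  ultimately obtain k where k: "\<exists>u. ON k u" "\<And>k'. \<exists>u. ON k' u \<Longrightarrow> k' \<le> k" "k \<le> d"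
    using Nat.ex_has_greatest_nat[of "\<lambda>k. \<exists>u. ON k u" 0 d] by blast
  then obtain u where u: "ON k u" by blast
  have uW: "u i \<in> W" if "i < k" for i using u that by (simp add: ON_def)
  have uu: "(\<Sum>l<d. vec_index (u i) l * cnj (vec_index (u j) l)) = (if i = j then 1 else 0)"
    if "i < k" "j < k" for i j using u that unfolding ON_def by blast
  \<comment> \<open>If some coordinate failed, the residual \<open>r\<close> of \<open>w\<close>
    would be a nonzero element of \<open>W\<close> orthogonal to all \<open>u i\<close>; scaled by
    \<open>a\<close>, which is 1/sqrt s, it would extend the family to \<open>Suc k\<close> vectors,
    against the maximality of \<open>k\<close>.\<close>
  have expand: "vec_index w l = (\<Sum>i<k. (\<Sum>m<d. vec_index w m * cnj (vec_index (u i) m)) * vec_index (u i) l)"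
    if w: "w \<in> W" and l: "l < d" for w l
  proof (rule ccontr)
    assume ne: "\<not> ?thesis"
    define c where "c i = (\<Sum>m<d. vec_index w m * cnj (vec_index (u i) m))" for i
    define r where "r = vec d (\<lambda>l. vec_index w l + (\<Sum>i<k. (- c i) * vec_index (u i) l))"
    have rW: "r \<in> W" unfolding r_def by (rule comb[OF w uW])
    have rl: "vec_index r l \<noteq> 0" using ne l by (simp add: r_def c_def sum_negf)
    have ru: "(\<Sum>m<d. vec_index r m * cnj (vec_index (u j) m)) = 0" if j: "j < k" for j
    proof -
      have "(\<Sum>m<d. vec_index r m * cnj (vec_index (u j) m))
          = c j + (\<Sum>m<d. \<Sum>i<k. (- c i) * (vec_index (u i) m * cnj (vec_index (u j) m)))"
        by (simp add: r_def c_def distrib_right sum.distrib sum_distrib_right mult.assoc)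
      also have "(\<Sum>m<d. \<Sum>i<k. (- c i) * (vec_index (u i) m * cnj (vec_index (u j) m)))
          = (\<Sum>i<k. (- c i) * (\<Sum>m<d. vec_index (u i) m * cnj (vec_index (u j) m)))"
        by (subst sum.swap) (simp add: sum_distrib_left sum_negf)
      also have "\<dots> = (\<Sum>i<k. (- c i) * (if i = j then 1 else 0))"
        by (intro sum.cong refl) (use uu j in auto)
      also have "\<dots> = - c j" using j by (simp add: if_distrib cong: if_cong)
      finally show ?thesis by simp
    qed
    define s where "s = (\<Sum>m<d. (cmod (vec_index r m))\<^sup>2)"
    have "(cmod (vec_index r l))\<^sup>2 \<le> s" unfolding s_def by (rule member_le_sum) (use l in auto)
    then have s: "s > 0" using rl by (smt (verit) zero_less_norm_iff zero_less_power)
    have rr: "(\<Sum>m<d. vec_index r m * cnj (vec_index r m)) = complex_of_real s"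
      by (simp add: s_def complex_norm_square del: of_real_power)
    define a where "a = complex_of_real (1 / sqrt s)"
    have aa: "a * cnj a * complex_of_real s = 1"
      using s by (simp add: a_def flip: of_real_mult)
    define u' where "u' = u(k := a \<cdot>\<^sub>v r)"
    have r_dim: "dim_vec r = d" by (simp add: r_def)
    have n1: "(\<Sum>m<d. vec_index (a \<cdot>\<^sub>v r) m * cnj (vec_index (u j) m)) = 0" if "j < k" for j
      using ru[OF that] by (simp add: r_dim mult.assoc flip: sum_distrib_left)
    have n2: "(\<Sum>m<d. vec_index (u j) m * cnj (vec_index (a \<cdot>\<^sub>v r) m)) = 0" if "j < k" for j
    proof -
      have "(\<Sum>m<d. vec_index (u j) m * cnj (vec_index (a \<cdot>\<^sub>v r) m))
          = cnj (\<Sum>m<d. vec_index (a \<cdot>\<^sub>v r) m * cnj (vec_index (u j) m))"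
        by (simp add: mult.commute)
      then show ?thesis by (simp only: n1[OF that] complex_cnj_zero)
    qed
    have n3: "(\<Sum>m<d. vec_index (a \<cdot>\<^sub>v r) m * cnj (vec_index (a \<cdot>\<^sub>v r) m)) = 1"
    proof -
      have "(\<Sum>m<d. vec_index (a \<cdot>\<^sub>v r) m * cnj (vec_index (a \<cdot>\<^sub>v r) m))
          = a * cnj a * (\<Sum>m<d. vec_index r m * cnj (vec_index r m))"
        unfolding sum_distrib_left by (intro sum.cong refl) (simp add: r_dim)
      then show ?thesis using aa rr by simp
    qed
    have "ON (Suc k) u'"
      unfolding ON_def u'_def
      using uW uu n1 n2 n3 W(4)[OF rW] by (auto simp: less_Suc_eq simp del: index_smult_vec)
    then show False using k(2)[of "Suc k"] by auto
  qed
  define P where "P = mat d k (\<lambda>(l, i). vec_index (u i) l)"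
  have P: "P \<in> carrier_mat d k" by (simp add: P_def)
  show ?thesis
  proof (rule that[OF k(3) P])
    show "mat_adjoint P * P = 1\<^sub>m k"
    proof (rule eq_matI)
      fix i j assume "i < dim_row (1\<^sub>m k :: complex mat)" "j < dim_col (1\<^sub>m k :: complex mat)"
      then have ij: "i < k" "j < k" by auto
      have "(mat_adjoint P * P) $$ (i, j) = (\<Sum>l<d. mat_adjoint P $$ (i, l) * P $$ (l, j))"
        by (rule mult_mat_index_sum[where n = k and k = k]) (use P ij in auto)
      also have "\<dots> = (\<Sum>l<d. vec_index (u j) l * cnj (vec_index (u i) l))"
        using ij by (intro sum.cong) (auto simp: P_def mult.commute)
      also have "\<dots> = 1\<^sub>m k $$ (i, j)" using uu[of j i] ij by auto
      finally show "(mat_adjoint P * P) $$ (i, j) = 1\<^sub>m k $$ (i, j)" .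
    qed (use P in auto)
  next
    fix v :: "complex vec" assume v: "v \<in> carrier_vec k"
    have "P *\<^sub>v v = vec d (\<lambda>l. vec_index (0\<^sub>v d) l + (\<Sum>i<k. vec_index v i * vec_index (u i) l))"
    proof (rule eq_vecI)
      fix l assume "l < dim_vec (vec d (\<lambda>l. vec_index (0\<^sub>v d) l + (\<Sum>i<k. vec_index v i * vec_index (u i) l)))"
      then have l: "l < d" by simp
      show "vec_index (P *\<^sub>v v) l = vec_index (vec d (\<lambda>l. vec_index (0\<^sub>v d) l + (\<Sum>i<k. vec_index v i * vec_index (u i) l))) l"
        unfolding mult_mat_vec_index_sum[OF P v l] using l by (simp add: P_def mult.commute)
    qed (use P in auto)
    also have "\<dots> \<in> W" by (rule comb[OF W(2) uW])
    finally show "P *\<^sub>v v \<in> W" .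
  next
    fix w assume w: "w \<in> W"
    then have wc: "w \<in> carrier_vec d" using W(1) by auto
    have a: "mat_adjoint P \<in> carrier_mat k d" using P by auto
    then have av: "mat_adjoint P *\<^sub>v w \<in> carrier_vec k" using wc by (rule mult_mat_vec_carrier)
    show "P *\<^sub>v (mat_adjoint P *\<^sub>v w) = w"
    proof (rule eq_vecI)
      fix l assume "l < dim_vec w"
      then have l: "l < d" using wc by auto
      have "vec_index (P *\<^sub>v (mat_adjoint P *\<^sub>v w)) l = (\<Sum>i<k. P $$ (l, i) * (\<Sum>m<d. mat_adjoint P $$ (i, m) * vec_index w m))"
        unfolding mult_mat_vec_index_sum[OF P av l]
        by (intro sum.cong refl) (simp add: mult_mat_vec_index_sum[OF a wc])
      also have "\<dots> = (\<Sum>i<k. (\<Sum>m<d. vec_index w m * cnj (vec_index (u i) m)) * vec_index (u i) l)"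
        using l by (intro sum.cong refl) (simp add: P_def mult.commute)
      also have "\<dots> = vec_index w l" using expand[OF w l] by simp
      finally show "vec_index (P *\<^sub>v (mat_adjoint P *\<^sub>v w)) l = vec_index w l" .
    qed (use P wc in auto)
  qed
qed

text \<open>An eigenspace of \<open>A\<close> is invariant under everything that commutes with
  \<open>A\<close>, and it is not zero, so irreducibility makes it the whole space. The bound
  \<open>d > 0\<close> provides the eigenvalue.\<close>

lemma schur_scalar:
  fixes A :: "complex mat"
  assumes d: "d > 0" and A: "A \<in> carrier_mat d d"
    and \<xi>: "\<And>x. x \<in> X \<Longrightarrow> \<xi> x \<in> carrier_mat d d"
    and irr: "\<And>W. VectorSpace.subspace class_ring W (module_vec TYPE(complex) d) \<Longrightarrow>
      (\<And>x w. x \<in> X \<Longrightarrow> w \<in> W \<Longrightarrow> \<xi> x *\<^sub>v w \<in> W) \<Longrightarrow> W = {0\<^sub>v d} \<or> W = carrier_vec d"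
    and comm: "\<And>x. x \<in> X \<Longrightarrow> A * \<xi> x = \<xi> x * A"
  obtains c where "A = c \<cdot>\<^sub>m 1\<^sub>m d"
proof -
  obtain c where "eigenvalue A c"
    using spectrum_non_empty[OF A d] by (auto simp: spectrum_def)
  then obtain v where v: "v \<in> carrier_vec d" "v \<noteq> 0\<^sub>v d" "A *\<^sub>v v = c \<cdot>\<^sub>v v"
    using A by (auto simp: eigenvalue_def eigenvector_def)
  define W where "W = {w \<in> carrier_vec d. A *\<^sub>v w = c \<cdot>\<^sub>v w}"
  have "VectorSpace.subspace class_ring W (module_vec TYPE(complex) d)"
    unfolding subspace_vec_iff W_def
    using A by (auto simp: mult_add_distrib_mat_vec[OF A] smult_add_distrib_vec mult_mat_vec smult_smult_assoc mult.commute)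
  moreover have "\<xi> x *\<^sub>v w \<in> W" if x: "x \<in> X" and w: "w \<in> W" for x w
  proof -
    have wc: "w \<in> carrier_vec d" and wA: "A *\<^sub>v w = c \<cdot>\<^sub>v w" using w by (auto simp: W_def)
    have "A *\<^sub>v (\<xi> x *\<^sub>v w) = \<xi> x *\<^sub>v (A *\<^sub>v w)"
      using comm[OF x] A \<xi>[OF x] wc by (metis assoc_mult_mat_vec)
    also have "\<dots> = c \<cdot>\<^sub>v (\<xi> x *\<^sub>v w)" using \<xi>[OF x] wc wA by (simp add: mult_mat_vec)
    finally show ?thesis using \<xi>[OF x] wc by (simp add: W_def)
  qed
  ultimately have "W = {0\<^sub>v d} \<or> W = carrier_vec d" by (rule irr)
  moreover have "v \<in> W" using v by (simp add: W_def)
  ultimately have W: "W = carrier_vec d" using v by auto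
  have "A = c \<cdot>\<^sub>m 1\<^sub>m d"
  proof (rule eq_matI)
    fix i j assume "i < dim_row (c \<cdot>\<^sub>m 1\<^sub>m d)" "j < dim_col (c \<cdot>\<^sub>m 1\<^sub>m d)"
    then have ij: "i < d" "j < d" by auto
    have "unit_vec d j \<in> W" unfolding W by simp
    then have "vec_index (A *\<^sub>v unit_vec d j) i = vec_index (c \<cdot>\<^sub>v unit_vec d j) i" by (simp add: W_def)
    then show "A $$ (i, j) = (c \<cdot>\<^sub>m 1\<^sub>m d) $$ (i, j)"
      using ij A by (simp add: mult_mat_vec_index_sum[OF A] if_distrib cong: if_cong)
  qed (use A in auto)
  then show ?thesis by (rule that)
qed

section \<open>Hilbert-Schmidt norm and unitary matrices\<close>

lemma HS_norm_sq:
  "A \<in> carrier_mat n m \<Longrightarrow> (HS_norm A)\<^sup>2 = (\<Sum>i<n. \<Sum>j<m. (cmod (A $$ (i, j)))\<^sup>2)"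
  by (auto simp: HS_norm_def intro!: real_sqrt_pow2 sum_nonneg)

lemma HS_norm_nonneg [simp]: "0 \<le> HS_norm A"
  by (auto simp: HS_norm_def intro!: sum_nonneg)

text \<open>The squared norm of row i of a matrix is the diagonal entry (i, i) of its product with
  its adjoint, and this product is the same for \<open>A * U\<close> and for
  \<open>A\<close>.\<close>

lemma HS_norm_mult_unitary:
  assumes A: "A \<in> carrier_mat n d" and U: "U \<in> carrier_mat d d" "unitary_matrix U"
  shows "HS_norm (A * U) = HS_norm A"
proof -
  have AU: "A * U \<in> carrier_mat n d" using A U by auto
  have *: "complex_of_real (\<Sum>j<d. (cmod (B $$ (i, j)))\<^sup>2) = (B * mat_adjoint B) $$ (i, i)"
    if "B \<in> carrier_mat n d" "i < n" for B i
    using that by (subst mult_mat_index_sum[where n = n and m = d and k = n])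
      (auto simp: complex_norm_square simp del: of_real_power)
  have "A * U * mat_adjoint (A * U) = A * (U * mat_adjoint U) * mat_adjoint A"
    unfolding mat_adjoint_mult[OF A U(1)] using A U by (intro mult_mat_assoc4) auto
  also have "\<dots> = A * mat_adjoint A" using A unitary_matrixD[OF U(2,1)] by simp
  finally have "complex_of_real (\<Sum>j<d. (cmod ((A * U) $$ (i, j)))\<^sup>2) = complex_of_real (\<Sum>j<d. (cmod (A $$ (i, j)))\<^sup>2)"
    if "i < n" for i
    using *[OF AU that] *[OF A that] by simp
  then have "(\<Sum>j<d. (cmod ((A * U) $$ (i, j)))\<^sup>2) = (\<Sum>j<d. (cmod (A $$ (i, j)))\<^sup>2)" if "i < n" for i
    using that of_real_eq_iff by blast
  then have "(HS_norm (A * U))\<^sup>2 = (HS_norm A)\<^sup>2"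
    by (simp add: HS_norm_sq[OF A] HS_norm_sq[OF AU])
  then show ?thesis by simp
qed

lemma mult_mat_vec_zero:
  "A \<in> carrier_mat n m \<Longrightarrow> A *\<^sub>v 0\<^sub>v m = (0\<^sub>v n :: complex vec)"
  by (rule eq_vecI) auto

lemma smult_smult_mat: "a \<cdot>\<^sub>m (b \<cdot>\<^sub>m A) = (a * b :: complex) \<cdot>\<^sub>m A"
  by (rule eq_matI) auto

lemma unitary_entry_le:
  assumes "U \<in> carrier_mat d d" "unitary_matrix U" "i < d" "j < d"
  shows "cmod (U $$ (i, j)) \<le> 1"
proof -
  have a: "mat_adjoint U \<in> carrier_mat d d" using assms by auto
  have "complex_of_real (\<Sum>j<d. (cmod (U $$ (i, j)))\<^sup>2) = (U * mat_adjoint U) $$ (i, i)"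
    unfolding mult_mat_index_sum[OF assms(1) a assms(3) assms(3)]
    using assms by (simp add: complex_norm_square del: of_real_power)
  also have "\<dots> = 1" using unitary_matrixD(2)[OF assms(2,1)] assms(3) by simp
  finally have "(\<Sum>j<d. (cmod (U $$ (i, j)))\<^sup>2) = 1" using of_real_eq_1_iff by blast
  moreover have "(cmod (U $$ (i, j)))\<^sup>2 \<le> (\<Sum>j<d. (cmod (U $$ (i, j)))\<^sup>2)"
    by (rule member_le_sum) (use assms in auto)
  ultimately show ?thesis by (simp add: abs_square_le_1)
qed

text \<open>The scalars in front of \<open>B $$ (a, b)\<close> do not involve \<open>B\<close>; with
  \<rho>(x) for \<open>B\<close> the entry becomes a linear combination of the entries of \<rho>
  whose coefficients are independent of x.\<close>

lemma sandwich_index: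
  fixes A B C :: "complex mat"
  assumes "A \<in> carrier_mat d k" "B \<in> carrier_mat k k" "C \<in> carrier_mat k d" "i < d" "j < d"
  shows "(A * B * C) $$ (i, j) = (\<Sum>b<k. \<Sum>a<k. (A $$ (i, a) * C $$ (b, j)) * B $$ (a, b))"
proof -
  have "(A * B * C) $$ (i, j) = (\<Sum>b<k. (A * B) $$ (i, b) * C $$ (b, j))"
    by (rule mult_mat_index_sum[where n = d and k = d]) (use assms in auto)
  also have "\<dots> = (\<Sum>b<k. (\<Sum>a<k. A $$ (i, a) * B $$ (a, b)) * C $$ (b, j))"
    by (intro sum.cong refl arg_cong2[where f = "(*)"] mult_mat_index_sum[OF assms(1,2,4)]) simp
  finally show ?thesis unfolding sum_distrib_right by (simp only: mult_ac)
qed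

section \<open>The Haar measure on a compact Vilenkin group\<close>

locale vilenkin_haar = compact_vilenkin_group G T Gs
  for G :: "('a, 'b) monoid_scheme" (structure) and T :: "'a topology" and Gs :: "nat \<Rightarrow> 'a set" +
  fixes \<mu> :: "'a measure"
  assumes haar: "normalized_haar_measure G T \<mu>"
begin

lemma space_haar: "space \<mu> = carrier G"
  using haar topspace_eq by (simp add: normalized_haar_measure_def)

lemma sets_haar: "sets \<mu> = sigma_sets (carrier G) {U. openin T U}"
  using haar topspace_eq by (simp add: normalized_haar_measure_def)

lemma prob_space_haar: "emeasure \<mu> (space \<mu>) = 1"
  using haar unfolding normalized_haar_measure_def by blast

sublocale finite_measure \<mu>
  by (rule finite_measureI) (simp add: prob_space_haar)

lemma measure_space_haar: "measure \<mu> (carrier G) = 1"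
  using prob_space_haar by (simp add: measure_def space_haar)

lemma open_sets_haar: "openin T U \<Longrightarrow> U \<in> sets \<mu>"
  by (simp add: sets_haar)

lemma continuous_map_measurable:
  assumes "continuous_map T euclidean f"
  shows "f \<in> borel_measurable \<mu>"
proof (rule borel_measurableI)
  fix S :: "'c set" assume "open S"
  then have "openin T {x \<in> topspace T. f x \<in> S}"
    using assms by (simp add: continuous_map_def)
  moreover have "f -` S \<inter> space \<mu> = {x \<in> topspace T. f x \<in> S}"
    by (auto simp: space_haar topspace_eq)
  ultimately show "f -` S \<inter> space \<mu> \<in> sets \<mu>" by (simp add: open_sets_haar)
qed

lemma continuous_left_mult:
  assumes "h \<in> carrier G"
  shows "continuous_map T T (\<lambda>x. h \<otimes> x)"
proof -
  have "continuous_map T (prod_topology T T) (\<lambda>x. (h, x))"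
    using assms by (auto simp: continuous_map_pairwise o_def topspace_eq)
  from continuous_map_compose[OF this continuous_mult] show ?thesis by (simp add: o_def)
qed

lemma continuous_right_mult:
  assumes "h \<in> carrier G"
  shows "continuous_map T T (\<lambda>x. x \<otimes> h)"
proof -
  have "continuous_map T (prod_topology T T) (\<lambda>x. (x, h))"
    using assms by (auto simp: continuous_map_pairwise o_def topspace_eq)
  from continuous_map_compose[OF this continuous_mult] show ?thesis by (simp add: o_def)
qed

lemma l_coset_eq: "H \<subseteq> carrier G \<Longrightarrow> a \<in> carrier G \<Longrightarrow> a <# H = {x \<in> carrier G. inv a \<otimes> x \<in> H}"
proof (intro equalityI subsetI)
  fix x assume H: "H \<subseteq> carrier G" and a: "a \<in> carrier G" and "x \<in> a <# H"
  then obtain h where "h \<in> H" "h \<in> carrier G" "x = a \<otimes> h" by (auto simp: l_coset_def)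
  then show "x \<in> {x \<in> carrier G. inv a \<otimes> x \<in> H}" using a by (simp flip: m_assoc)
next
  fix x assume a: "a \<in> carrier G" and "x \<in> {x \<in> carrier G. inv a \<otimes> x \<in> H}"
  then have "inv a \<otimes> x \<in> H" "x = a \<otimes> (inv a \<otimes> x)" by (simp_all flip: m_assoc)
  then show "x \<in> a <# H" by (auto simp: l_coset_def)
qed

lemma left_mult_measurable:
  assumes "h \<in> carrier G"
  shows "(\<lambda>x. h \<otimes> x) \<in> measurable \<mu> \<mu>"
proof (rule measurable_sigma_sets[OF sets_haar])
  show "{U. openin T U} \<subseteq> Pow (carrier G)" using openin_subset topspace_eq by blast
  show "(\<lambda>x. h \<otimes> x) \<in> space \<mu> \<rightarrow> carrier G" using assms by (auto simp: space_haar)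
  fix U assume "U \<in> {U. openin T U}"
  then have "openin T {x \<in> topspace T. h \<otimes> x \<in> U}"
    using continuous_left_mult[OF assms] by (simp add: continuous_map_def)
  moreover have "(\<lambda>x. h \<otimes> x) -` U \<inter> space \<mu> = {x \<in> topspace T. h \<otimes> x \<in> U}"
    by (auto simp: space_haar topspace_eq)
  ultimately show "(\<lambda>x. h \<otimes> x) -` U \<inter> space \<mu> \<in> sets \<mu>" by (simp add: open_sets_haar)
qed

lemma sets_haar_subset: "A \<in> sets \<mu> \<Longrightarrow> A \<subseteq> carrier G"
  using sets.sets_into_space space_haar by blast

lemma distr_left_mult:
  assumes h: "h \<in> carrier G"
  shows "distr \<mu> \<mu> (\<lambda>x. h \<otimes> x) = \<mu>"
proof (rule measure_eqI)
  fix A assume "A \<in> sets (distr \<mu> \<mu> (\<lambda>x. h \<otimes> x))"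
  then have A: "A \<in> sets \<mu>" by simp
  have "(\<lambda>x. h \<otimes> x) -` A \<inter> space \<mu> = inv h <# A"
    using l_coset_eq[OF sets_haar_subset[OF A], of "inv h"] h by (auto simp: space_haar)
  moreover have "emeasure \<mu> (inv h <# A) = emeasure \<mu> A"
    using haar h A by (simp add: normalized_haar_measure_def)
  ultimately show "emeasure (distr \<mu> \<mu> (\<lambda>x. h \<otimes> x)) A = emeasure \<mu> A"
    using emeasure_distr[OF left_mult_measurable[OF h] A] by simp
qed simp

lemma integral_left_mult:
  fixes f :: "'a \<Rightarrow> 'c :: {banach, second_countable_topology}"
  assumes "h \<in> carrier G" "f \<in> borel_measurable \<mu>"
  shows "(LINT x|\<mu>. f (h \<otimes> x)) = (LINT x|\<mu>. f x)"
  using integral_distr[OF left_mult_measurable[OF assms(1)] assms(2)] distr_left_mult[OF assms(1)] by simp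

lemma L2_left_mult:
  assumes h: "h \<in> carrier G" and f: "f \<in> L2 \<mu>"
  shows "(\<lambda>x. f (h \<otimes> x)) \<in> L2 \<mu>" "L2_norm \<mu> (\<lambda>x. f (h \<otimes> x)) = L2_norm \<mu> f"
proof -
  have f': "f \<in> borel_measurable \<mu>" "integrable (distr \<mu> \<mu> (\<lambda>x. h \<otimes> x)) (\<lambda>x. (cmod (f x))\<^sup>2)"
    using f by (auto simp: L2_def distr_left_mult[OF h])
  have "integrable \<mu> (\<lambda>x. (cmod (f (h \<otimes> x)))\<^sup>2)"
    by (rule integrable_distr[OF left_mult_measurable[OF h] f'(2)])
  then show "(\<lambda>x. f (h \<otimes> x)) \<in> L2 \<mu>"
    using measurable_compose[OF left_mult_measurable[OF h] f'(1)] by (simp add: L2_def)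
  show "L2_norm \<mu> (\<lambda>x. f (h \<otimes> x)) = L2_norm \<mu> f"
    using integral_left_mult[OF h, of "\<lambda>x. (cmod (f x))\<^sup>2"] f'(1) by (simp add: L2_norm_def)
qed

section \<open>Cosets, indices and measures along the chain of subgroups\<close>

lemma Gs_subset: "Gs n \<subseteq> carrier G"
  using subgroups by (rule subgroup.subset)

lemma Gs_one: "\<one> \<in> Gs n"
  using subgroups by (rule subgroup.one_closed)

lemma Gs_mult: "x \<in> Gs n \<Longrightarrow> y \<in> Gs n \<Longrightarrow> x \<otimes> y \<in> Gs n"
  using subgroups by (rule subgroup.m_closed)

lemma Gs_inv: "x \<in> Gs n \<Longrightarrow> inv x \<in> Gs n"
  using subgroups by (rule subgroup.m_inv_closed)

lemma Gs_antimono: "m \<le> n \<Longrightarrow> Gs n \<subseteq> Gs m"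
  by (rule lift_Suc_antimono_le) (use strictly_decreasing in auto)

lemma Gs_0: "Gs 0 = carrier G"
  using union Gs_antimono[of 0] Gs_subset by blast

lemma Gs_sets: "Gs n \<in> sets \<mu>"
  by (intro open_sets_haar open_subgroups)

lemma l_coset_open: "a \<in> carrier G \<Longrightarrow> openin T (a <# Gs n)"
  using continuous_left_mult[of "inv a"] open_subgroups[of n]
  by (simp add: l_coset_eq[OF Gs_subset] continuous_map_def topspace_eq)

lemma mem_l_coset_self: "a \<in> carrier G \<Longrightarrow> a \<in> a <# Gs n"
  by (simp add: l_coset_eq[OF Gs_subset] Gs_one)

lemma l_coset_eq_iff:
  assumes "a \<in> carrier G" "b \<in> carrier G"
  shows "a <# Gs n = b <# Gs n \<longleftrightarrow> inv a \<otimes> b \<in> Gs n"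
proof
  assume "a <# Gs n = b <# Gs n"
  then have "b \<in> a <# Gs n" using mem_l_coset_self[OF assms(2), of n] by simp
  then show "inv a \<otimes> b \<in> Gs n" using assms by (simp add: l_coset_eq[OF Gs_subset])
next
  assume ab: "inv a \<otimes> b \<in> Gs n"
  then have ba: "inv b \<otimes> a \<in> Gs n" using Gs_inv[OF ab] assms by (simp add: inv_mult_group)
  have "inv a \<otimes> x \<in> Gs n \<longleftrightarrow> inv b \<otimes> x \<in> Gs n" if x: "x \<in> carrier G" for x
  proof -
    have "a \<otimes> (inv a \<otimes> x) = x" "b \<otimes> (inv b \<otimes> x) = x"
      using assms x by (simp_all flip: m_assoc)
    then have "(inv b \<otimes> a) \<otimes> (inv a \<otimes> x) = inv b \<otimes> x" "(inv a \<otimes> b) \<otimes> (inv b \<otimes> x) = inv a \<otimes> x"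
      using assms x by (simp_all add: m_assoc)
    then show ?thesis using Gs_mult[OF ba] Gs_mult[OF ab] by metis
  qed
  then show "a <# Gs n = b <# Gs n" using assms by (auto simp: l_coset_eq[OF Gs_subset])
qed

lemma mem_l_coset_iff:
  "a \<in> carrier G \<Longrightarrow> b \<in> carrier G \<Longrightarrow> b \<in> a <# Gs n \<longleftrightarrow> a <# Gs n = b <# Gs n"
  unfolding l_coset_eq_iff by (simp add: l_coset_eq[OF Gs_subset])

text \<open>Left cosets fit the left-invariant measure and the left action of G on its cosets,
  whereas \<open>group_index\<close> counts right cosets.\<close>

definition left_cosets :: "nat \<Rightarrow> 'a set set" where
  "left_cosets n = (\<lambda>a. a <# Gs n) ` carrier G"

lemma left_cosets_disjoint: "A \<in> left_cosets n \<Longrightarrow> B \<in> left_cosets n \<Longrightarrow> A \<noteq> B \<Longrightarrow> A \<inter> B = {}"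
proof (rule ccontr)
  assume AB: "A \<in> left_cosets n" "B \<in> left_cosets n" "A \<noteq> B" "A \<inter> B \<noteq> {}"
  then obtain a b x where *: "A = a <# Gs n" "B = b <# Gs n" "a \<in> carrier G" "b \<in> carrier G" "x \<in> A" "x \<in> B"
    by (auto simp: left_cosets_def)
  then have "x \<in> carrier G" by (auto simp: l_coset_eq[OF Gs_subset])
  then have "A = B" using * mem_l_coset_iff by metis
  then show False using AB by simp
qed

lemma Union_left_cosets: "\<Union> (left_cosets n) = carrier G"
  using mem_l_coset_self by (auto simp: left_cosets_def l_coset_eq[OF Gs_subset])

text \<open>A finite subfamily covers G by compactness, and a cover by pairwise disjoint nonempty
  sets has no proper subcover.\<close>

lemma finite_left_cosets: "finite (left_cosets n)"
proof -
  have "compactin T (carrier G)" using compact topspace_eq by (simp add: compact_space_def)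
  then obtain F where F: "finite F" "F \<subseteq> left_cosets n" "carrier G \<subseteq> \<Union> F"
  proof -
    have "\<forall>A\<in>left_cosets n. openin T A" using l_coset_open by (auto simp: left_cosets_def)
    then show ?thesis
      using \<open>compactin T (carrier G)\<close> Union_left_cosets[of n] that unfolding compactin_def by (metis order_refl)
  qed
  have "left_cosets n \<subseteq> F"
  proof
    fix A assume A: "A \<in> left_cosets n"
    then obtain a where a: "a \<in> carrier G" "A = a <# Gs n" by (auto simp: left_cosets_def)
    then obtain B where "B \<in> F" "a \<in> B" using F by auto
    then show "A \<in> F" using left_cosets_disjoint[OF A, of B] mem_l_coset_self[OF a(1), of n] F(2) a(2) by blast
  qed
  then show ?thesis using F(1) finite_subset by blast
qed

text \<open>Inversion maps \<open>a <# Gs n\<close> onto \<open>Gs n #> inv a\<close>, and applying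
  it twice returns every coset.\<close>

lemma card_left_cosets: "card (left_cosets n) = group_index G (Gs n)"
proof -
  have inv_l: "m_inv G ` (a <# Gs n) = Gs n #> inv a" if a: "a \<in> carrier G" for a
  proof -
    have "m_inv G ` (a <# Gs n) = (\<lambda>h. inv h \<otimes> inv a) ` Gs n"
      using a Gs_subset[of n] by (auto simp: l_coset_def inv_mult_group subset_iff image_UN)
    also have "\<dots> = Gs n #> inv a"
    proof -
      have "m_inv G ` Gs n = Gs n"
      proof (intro equalityI subsetI)
        fix x assume "x \<in> Gs n"
        then have "inv x \<in> Gs n" "x = inv (inv x)" using Gs_inv Gs_subset[of n] by auto
        then show "x \<in> m_inv G ` Gs n" by blast
      qed (use Gs_inv in auto)
      have "(\<lambda>h. inv h \<otimes> inv a) ` Gs n = (\<lambda>h. h \<otimes> inv a) ` m_inv G ` Gs n" by (simp add: image_image)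
      also have "\<dots> = Gs n #> inv a"
        unfolding \<open>m_inv G ` Gs n = Gs n\<close> by (auto simp: r_coset_def)
      finally show ?thesis .
    qed
    finally show ?thesis .
  qed
  have "bij_betw (\<lambda>A. m_inv G ` A) (left_cosets n) (rcosets (Gs n))"
  proof (rule bij_betw_byWitness[where f' = "\<lambda>A. m_inv G ` A"])
    show "\<forall>A\<in>left_cosets n. m_inv G ` m_inv G ` A = A"
      by (auto simp: left_cosets_def l_coset_eq[OF Gs_subset] image_image)
    show "\<forall>A\<in>rcosets Gs n. m_inv G ` m_inv G ` A = A"
    proof
      fix A assume "A \<in> rcosets Gs n"
      then have "A \<subseteq> carrier G" using rcosets_part_G[OF subgroups[of n]] by auto
      then have "inv (inv x) = x" if "x \<in> A" for x using that by auto
      then show "m_inv G ` m_inv G ` A = A" by (simp add: image_image)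
    qed
    show "(\<lambda>A. m_inv G ` A) ` left_cosets n \<subseteq> rcosets Gs n"
      by (auto simp: left_cosets_def inv_l RCOSETS_def intro!: bexI[of _ "inv _"])
    show "(\<lambda>A. m_inv G ` A) ` (rcosets Gs n) \<subseteq> left_cosets n"
    proof
      fix B assume "B \<in> (\<lambda>A. m_inv G ` A) ` (rcosets Gs n)"
      then obtain a where a: "a \<in> carrier G" "B = m_inv G ` (Gs n #> a)" by (auto simp: RCOSETS_def)
      then have "B = m_inv G ` m_inv G ` (inv a <# Gs n)" using inv_l[of "inv a"] by simp
      also have "\<dots> = inv a <# Gs n" using a(1) by (auto simp: l_coset_eq[OF Gs_subset] image_image)
      finally show "B \<in> left_cosets n" using a by (simp add: left_cosets_def)
    qed
  qed
  then show ?thesis unfolding group_index_def by (rule bij_betw_same_card)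
qed

lemma measure_l_coset: "a \<in> carrier G \<Longrightarrow> measure \<mu> (a <# Gs n) = measure \<mu> (Gs n)"
  using haar Gs_sets by (simp add: normalized_haar_measure_def measure_def)

text \<open>Total mass 1 splits into cosets of equal measure. In particular the index is not the
  default cardinality 0.\<close>

lemma index_measure: "real (group_index G (Gs n)) * measure \<mu> (Gs n) = 1"
proof -
  have "1 = measure \<mu> (\<Union>A\<in>left_cosets n. A)" using Union_left_cosets measure_space_haar by simp
  also have "\<dots> = (\<Sum>A\<in>left_cosets n. measure \<mu> A)"
    by (rule finite_measure_finite_Union)
      (use finite_left_cosets left_cosets_disjoint l_coset_open open_sets_haar in
        \<open>auto simp: disjoint_family_on_def left_cosets_def\<close>)
  also have "\<dots> = (\<Sum>A\<in>left_cosets n. measure \<mu> (Gs n))"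
    by (intro sum.cong refl) (auto simp: left_cosets_def measure_l_coset)
  finally show ?thesis by (simp add: card_left_cosets)
qed

lemma index_pos: "group_index G (Gs n) > 0"
  using index_measure[of n] by (intro Nat.gr0I) auto

lemma measure_Gs: "measure \<mu> (Gs n) = 1 / real (group_index G (Gs n))"
  using index_measure[of n] index_pos[of n] by (simp add: field_simps)

text \<open>Two disjoint cosets of \<open>Gs (Suc n)\<close> lie in \<open>Gs n\<close>, so the
  measure at least halves. Arguing by measure avoids a product formula for indices in different
  ambient groups.\<close>

lemma index_Suc: "group_index G (Gs n) < group_index G (Gs (Suc n))"
proof -
  obtain g where g: "g \<in> Gs n" "g \<notin> Gs (Suc n)" using strictly_decreasing[of n] by blast
  then have gc: "g \<in> carrier G" using Gs_subset by blast
  have "\<one> <# Gs (Suc n) \<noteq> g <# Gs (Suc n)" using g gc by (simp add: l_coset_eq_iff)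
  then have dis: "(\<one> <# Gs (Suc n)) \<inter> (g <# Gs (Suc n)) = {}"
    using left_cosets_disjoint[of "\<one> <# Gs (Suc n)" "Suc n" "g <# Gs (Suc n)"] gc
    by (auto simp: left_cosets_def)
  have one: "\<one> <# Gs (Suc n) = Gs (Suc n)" using Gs_subset[of "Suc n"] by (auto simp: l_coset_eq[OF Gs_subset])
  have sub: "(\<one> <# Gs (Suc n)) \<union> (g <# Gs (Suc n)) \<subseteq> Gs n"
    using g(1) Gs_antimono[of n "Suc n"] Gs_mult[of g n] unfolding one by (auto simp: l_coset_def)
  have "2 * measure \<mu> (Gs (Suc n)) = measure \<mu> ((\<one> <# Gs (Suc n)) \<union> (g <# Gs (Suc n)))"
    using dis gc by (subst finite_measure_Union) (auto intro: open_sets_haar l_coset_open simp: measure_l_coset)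
  also have "\<dots> \<le> measure \<mu> (Gs n)" using sub Gs_sets by (rule finite_measure_mono)
  finally have "2 * real (group_index G (Gs n)) \<le> real (group_index G (Gs (Suc n)))"
    using index_pos[of n] index_pos[of "Suc n"] by (simp add: measure_Gs field_simps)
  then show ?thesis using index_pos[of n] by linarith
qed

lemma index_strict_mono: "strict_mono (\<lambda>n. group_index G (Gs n))"
  by (simp add: strict_mono_Suc_iff index_Suc)

text \<open>Makes \<open>measure \<mu> (Gs m)\<close> smaller than 1/m for m \<ge> 1, the source of
  small sets for the sharpness.\<close>

lemma index_ge: "n < group_index G (Gs n)"
proof (induction n)
  case 0
  show ?case by (rule index_pos)
next
  case (Suc n)
  then show ?case using index_Suc[of n] by linarith
qed

section \<open>Unitary representations\<close>


lemma rep_carrier: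
  "\<xi> \<in> unitary_reps G T \<Longrightarrow> x \<in> carrier G \<Longrightarrow> \<xi> x \<in> carrier_mat (rep_dim G \<xi>) (rep_dim G \<xi>)"
  by (simp add: unitary_reps_def)

lemma rep_unitary: "\<xi> \<in> unitary_reps G T \<Longrightarrow> x \<in> carrier G \<Longrightarrow> unitary_matrix (\<xi> x)"
  by (simp add: unitary_reps_def)

lemma rep_mult:
  "\<xi> \<in> unitary_reps G T \<Longrightarrow> x \<in> carrier G \<Longrightarrow> y \<in> carrier G \<Longrightarrow> \<xi> (x \<otimes> y) = \<xi> x * \<xi> y"
  by (simp add: unitary_reps_def)

lemma rep_one:
  assumes "\<xi> \<in> unitary_reps G T"
  shows "\<xi> \<one> = 1\<^sub>m (rep_dim G \<xi>)"
proof -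
  let ?d = "rep_dim G \<xi>"
  have c: "\<xi> \<one> \<in> carrier_mat ?d ?d" by (rule rep_carrier[OF assms one_closed])
  have u: "mat_adjoint (\<xi> \<one>) * \<xi> \<one> = 1\<^sub>m ?d"
    by (rule unitary_matrixD(1)[OF rep_unitary[OF assms one_closed] c])
  have "mat_adjoint (\<xi> \<one>) * \<xi> \<one> * \<xi> \<one> = mat_adjoint (\<xi> \<one>) * (\<xi> \<one> * \<xi> \<one>)"
    by (rule assoc_mult_mat[OF mat_adjoint_carrier[OF c] c c])
  also have "\<xi> \<one> * \<xi> \<one> = \<xi> (\<one> \<otimes> \<one>)" by (rule rep_mult[OF assms one_closed one_closed, symmetric])
  finally show ?thesis using u c by simp
qed

lemma rep_inv:
  assumes "\<xi> \<in> unitary_reps G T" "x \<in> carrier G"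
  shows "\<xi> (inv x) = mat_adjoint (\<xi> x)"
proof -
  let ?d = "rep_dim G \<xi>"
  have c: "\<xi> x \<in> carrier_mat ?d ?d" "\<xi> (inv x) \<in> carrier_mat ?d ?d"
    using assms by (auto intro: rep_carrier)
  have u: "mat_adjoint (\<xi> x) * \<xi> x = 1\<^sub>m ?d"
    by (rule unitary_matrixD(1)[OF rep_unitary[OF assms] c(1)])
  have "\<xi> x * \<xi> (inv x) = 1\<^sub>m ?d"
    using rep_mult[OF assms(1,2), of "inv x"] assms(2) rep_one[OF assms(1)] by simp
  then have "mat_adjoint (\<xi> x) * \<xi> x * \<xi> (inv x) = mat_adjoint (\<xi> x)"
    using c by (simp add: assoc_mult_mat[where ?n\<^sub>1 = ?d and ?n\<^sub>2 = ?d and ?n\<^sub>3 = ?d and ?n\<^sub>4 = ?d])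
  then show ?thesis using u c by simp
qed

lemma rep_entry_measurable:
  "\<xi> \<in> unitary_reps G T \<Longrightarrow> i < rep_dim G \<xi> \<Longrightarrow> j < rep_dim G \<xi> \<Longrightarrow>
    (\<lambda>x. \<xi> x $$ (i, j)) \<in> borel_measurable \<mu>"
  by (rule continuous_map_measurable) (simp add: unitary_reps_def)

lemma rep_entry_L2:
  assumes "\<xi> \<in> unitary_reps G T" "i < rep_dim G \<xi>" "j < rep_dim G \<xi>"
  shows "(\<lambda>x. \<xi> x $$ (i, j)) \<in> L2 \<mu>"
proof (rule L2_bounded[where B = 1, OF finite_measure_axioms rep_entry_measurable[OF assms]])
  fix x assume "x \<in> space \<mu>"
  then have x: "x \<in> carrier G" by (simp add: space_haar)
  show "cmod (\<xi> x $$ (i, j)) \<le> 1"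
    by (rule unitary_entry_le[OF rep_carrier[OF assms(1) x] rep_unitary[OF assms(1) x] assms(2,3)])
qed

section \<open>Fourier coefficients and translation\<close>

lemma fourier_coeff_carrier: "fourier_coeff G \<mu> f \<xi> \<in> carrier_mat (rep_dim G \<xi>) (rep_dim G \<xi>)"
  by (simp add: fourier_coeff_def)

lemma dim_fourier_coeff [simp]:
  "dim_row (fourier_coeff G \<mu> f \<xi>) = rep_dim G \<xi>" "dim_col (fourier_coeff G \<mu> f \<xi>) = rep_dim G \<xi>"
  by (simp_all add: fourier_coeff_def)

text \<open>The adjoint transposes the indices. This turns Fourier coefficients into inner products
  with matrix entries, to which the L2 theory applies.\<close>

lemma fourier_coeff_index:
  assumes "\<xi> \<in> unitary_reps G T" "i < rep_dim G \<xi>" "j < rep_dim G \<xi>"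
  shows "fourier_coeff G \<mu> f \<xi> $$ (i, j) = L2_inner \<mu> f (\<lambda>x. \<xi> x $$ (j, i))"
proof -
  have "mat_adjoint (\<xi> x) $$ (i, j) = cnj (\<xi> x $$ (j, i))" if "x \<in> space \<mu>" for x
    using rep_carrier[OF assms(1), of x] that assms by (intro index_mat_adjoint) (auto simp: space_haar)
  then show ?thesis
    using assms by (simp add: fourier_coeff_def L2_inner_def cong: Bochner_Integration.integral_cong)
qed

lemma fourier_coeff_diff:
  assumes "\<xi> \<in> unitary_reps G T" "f \<in> L2 \<mu>" "g \<in> L2 \<mu>"
  shows "fourier_coeff G \<mu> (\<lambda>x. f x - g x) \<xi> = fourier_coeff G \<mu> f \<xi> - fourier_coeff G \<mu> g \<xi>"
  by (rule eq_matI)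
    (use assms in \<open>auto simp: fourier_coeff_index L2_inner_diff_left rep_entry_L2\<close>)

text \<open>Under y = h x the kernel becomes the adjoint of
  \<open>\<xi> (inv h \<otimes> y)\<close>, that is \<open>mat_adjoint (\<xi> y) * \<xi> h\<close>:
  left translation of the function acts on the coefficient by a matrix on the right.\<close>

lemma fourier_coeff_left_mult:
  assumes \<xi>: "\<xi> \<in> unitary_reps G T" and f: "f \<in> L2 \<mu>" and h: "h \<in> carrier G"
  shows "fourier_coeff G \<mu> (\<lambda>x. f (h \<otimes> x)) \<xi> = fourier_coeff G \<mu> f \<xi> * \<xi> h"
proof (rule eq_matI)
  let ?d = "rep_dim G \<xi>" and ?A = "fourier_coeff G \<mu> f \<xi>"
  have A: "?A \<in> carrier_mat ?d ?d" by (rule fourier_coeff_carrier)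
  have \<xi>h: "\<xi> h \<in> carrier_mat ?d ?d" by (rule rep_carrier[OF \<xi> h])
  fix i j assume "i < dim_row (?A * \<xi> h)" "j < dim_col (?A * \<xi> h)"
  then have ij: "i < ?d" "j < ?d" using A \<xi>h by auto
  have meas: "(\<lambda>y. f y * cnj (\<xi> (inv h \<otimes> y) $$ (j, i))) \<in> borel_measurable \<mu>"
    using f measurable_compose[OF left_mult_measurable rep_entry_measurable[OF \<xi> ij(2) ij(1)], of "inv h"] h
    by (intro borel_measurable_times borel_measurable_cnj) (auto simp: L2_def)
  have "fourier_coeff G \<mu> (\<lambda>x. f (h \<otimes> x)) \<xi> $$ (i, j) = (LINT x|\<mu>. f (h \<otimes> x) * cnj (\<xi> x $$ (j, i)))"
    using \<xi> ij by (simp add: fourier_coeff_index L2_inner_def)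
  \<comment> \<open>Inserting \<open>inv h\<close> and \<open>h\<close> makes the whole integrand a
    function of \<open>h \<otimes> x\<close>, so that invariance applies.\<close>
  also have "\<dots> = (LINT x|\<mu>. f (h \<otimes> x) * cnj (\<xi> (inv h \<otimes> (h \<otimes> x)) $$ (j, i)))"
    using h by (intro Bochner_Integration.integral_cong refl) (simp add: space_haar flip: m_assoc)
  also have "\<dots> = (LINT y|\<mu>. f y * cnj (\<xi> (inv h \<otimes> y) $$ (j, i)))"
    by (rule integral_left_mult[OF h meas])
  also have "\<dots> = (LINT y|\<mu>. (\<Sum>k<?d. \<xi> h $$ (k, j) * (f y * cnj (\<xi> y $$ (k, i)))))"
  proof (intro Bochner_Integration.integral_cong refl)
    fix y assume "y \<in> space \<mu>"
    then have y: "y \<in> carrier G" by (simp add: space_haar)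
    have "\<xi> (inv h \<otimes> y) = mat_adjoint (\<xi> h) * \<xi> y" using \<xi> h y by (simp add: rep_mult rep_inv)
    then have "\<xi> (inv h \<otimes> y) $$ (j, i) = (\<Sum>k<?d. mat_adjoint (\<xi> h) $$ (j, k) * \<xi> y $$ (k, i))"
      using mult_mat_index_sum[OF mat_adjoint_carrier[OF \<xi>h] rep_carrier[OF \<xi> y] ij(2,1)] by simp
    also have "\<dots> = (\<Sum>k<?d. cnj (\<xi> h $$ (k, j)) * \<xi> y $$ (k, i))"
      using \<xi>h ij by (intro sum.cong refl) auto
    finally show "f y * cnj (\<xi> (inv h \<otimes> y) $$ (j, i)) = (\<Sum>k<?d. \<xi> h $$ (k, j) * (f y * cnj (\<xi> y $$ (k, i))))"
      by (simp add: sum_distrib_left mult_ac)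
  qed
  also have "\<dots> = (\<Sum>k<?d. \<xi> h $$ (k, j) * L2_inner \<mu> f (\<lambda>y. \<xi> y $$ (k, i)))"
    unfolding L2_inner_def
    using L2_mult_cnj_integrable[OF f rep_entry_L2[OF \<xi> _ ij(1)]]
    by (subst Bochner_Integration.integral_sum) auto
  also have "\<dots> = (\<Sum>k<?d. ?A $$ (i, k) * \<xi> h $$ (k, j))"
    using \<xi> ij by (intro sum.cong refl) (simp add: fourier_coeff_index)
  also have "\<dots> = (?A * \<xi> h) $$ (i, j)" by (rule mult_mat_index_sum[OF A \<xi>h ij, symmetric])
  finally show "fourier_coeff G \<mu> (\<lambda>x. f (h \<otimes> x)) \<xi> $$ (i, j) = (?A * \<xi> h) $$ (i, j)" .
qed (use rep_carrier[OF \<xi> h] in auto)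

text \<open>A unitary matrix group near the identity is trivial: if \<open>s\<close> bounds the entries of
  \<open>B = \<xi> x - 1\<close> for all \<open>x\<close> in the subgroup, then \<open>2 B = (\<xi> (x x) - 1) - B B\<close> gives
  \<open>2 s \<le> s + d s\<^sup>2\<close>, so \<open>s = 0\<close> once \<open>d s < 1\<close>.\<close>

lemma rep_trivial_on_some_Gs:
  assumes \<xi>: "\<xi> \<in> unitary_reps G T"
  obtains m where "\<xi> \<in> annihilator G T (Gs m)"
proof -
  let ?d = "rep_dim G \<xi>"
  define b where "b x i j = \<xi> x $$ (i, j) - (1\<^sub>m ?d :: complex mat) $$ (i, j)" for x i j
  \<comment> \<open>Every nonnegative \<open>s \<le> r\<close> then satisfies
    \<open>real ?d * s \<le> 1 / 2\<close>; the successor keeps \<open>r\<close> positive in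
    dimension 0.\<close>
  define r where "r = 1 / (2 * real (Suc ?d))"
  have r: "r > 0" by (simp add: r_def)
  \<comment> \<open>In dimension 0 the indexed intersection runs over the empty set and is the whole
    type; intersecting with \<open>topspace T\<close> keeps \<open>V\<close> open.\<close>
  define V where "V = (\<Inter>p\<in>{..<?d} \<times> {..<?d}. {x \<in> topspace T. b x (fst p) (snd p) \<in> ball 0 r}) \<inter> topspace T"
  have "openin T V"
    unfolding V_def
  proof (cases "?d = 0")
    case True
    then show "openin T ((\<Inter>p\<in>{..<?d} \<times> {..<?d}. {x \<in> topspace T. b x (fst p) (snd p) \<in> ball 0 r}) \<inter> topspace T)" by simp
  next
    case False
    have "openin T {x \<in> topspace T. b x i j \<in> ball 0 r}" if "i < ?d" "j < ?d" for i j
    proof -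
      have "continuous_map T euclidean (\<lambda>x. \<xi> x $$ (i, j))" using \<xi> that by (simp add: unitary_reps_def)
      then have "continuous_map T euclidean (\<lambda>x. b x i j)"
        unfolding b_def by (intro continuous_map_diff) auto
      then show ?thesis by (rule openin_continuous_map_preimage) simp
    qed
    then show "openin T ((\<Inter>p\<in>{..<?d} \<times> {..<?d}. {x \<in> topspace T. b x (fst p) (snd p) \<in> ball 0 r}) \<inter> topspace T)"
      using False by (intro openin_Int openin_Inter) auto
  qed
  moreover have "\<one> \<in> V" using r by (auto simp: V_def b_def rep_one[OF \<xi>] topspace_eq)
  ultimately obtain m where m: "Gs m \<subseteq> V" using nhds_basis by blast
  have br: "cmod (b x i j) \<le> r" if "x \<in> Gs m" "i < ?d" "j < ?d" for x i j
  proof -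
    have "x \<in> V" using m that by blast
    then have "b x (fst (i, j)) (snd (i, j)) \<in> ball 0 r" using that unfolding V_def by blast
    then show ?thesis by (simp add: dist_norm)
  qed
  \<comment> \<open>The doubling identity gives 2 |b x i j| \<le> s + d s^2 \<le> s + s/2, hence the
    factor 3/4. Iterating this contraction from \<open>r\<close> replaces an argument with the
    supremum of the entries.\<close>
  have step: "\<forall>x\<in>Gs m. \<forall>i<?d. \<forall>j<?d. cmod (b x i j) \<le> 3 / 4 * s"
    if s: "\<forall>x\<in>Gs m. \<forall>i<?d. \<forall>j<?d. cmod (b x i j) \<le> s" "s \<le> r" for s
  proof (intro ballI allI impI)
    fix x i j assume x: "x \<in> Gs m" and ij: "i < ?d" "j < ?d"
    have xc: "x \<in> carrier G" using x Gs_subset by blast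
    note c = rep_carrier[OF \<xi> xc]
    have bs: "cmod (b y k l) \<le> s" if "y \<in> Gs m" "k < ?d" "l < ?d" for y k l
      using s(1) that by simp
    have s0: "0 \<le> s" by (rule order_trans[OF norm_ge_zero bs[OF x ij]])
    have "\<xi> (x \<otimes> x) $$ (i, j) = (\<Sum>l<?d. \<xi> x $$ (i, l) * \<xi> x $$ (l, j))"
      using rep_mult[OF \<xi> xc xc] mult_mat_index_sum[OF c c ij] by simp
    also have "\<dots> = (\<Sum>l<?d. b x i l * b x l j + (if l = i then b x l j else 0)
        + (if l = j then b x i l else 0) + (if l = j then (if i = j then 1 else 0) else 0))"
    proof (intro sum.cong refl)
      fix l assume "l \<in> {..<?d}"
      then have "\<xi> x $$ (i, l) = b x i l + (if l = i then 1 else 0)"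
          "\<xi> x $$ (l, j) = b x l j + (if l = j then 1 else 0)"
        using ij by (auto simp: b_def)
      then show "\<xi> x $$ (i, l) * \<xi> x $$ (l, j) = b x i l * b x l j + (if l = i then b x l j else 0)
          + (if l = j then b x i l else 0) + (if l = j then (if i = j then 1 else 0) else 0)"
        by (simp add: distrib_left distrib_right)
    qed
    also have "\<dots> = (\<Sum>l<?d. b x i l * b x l j) + b x i j + b x i j + (if i = j then 1 else 0)"
      using ij by (simp add: sum.distrib)
    finally have "2 * b x i j = b (x \<otimes> x) i j - (\<Sum>l<?d. b x i l * b x l j)"
      using ij by (simp add: b_def)
    then have "cmod (2 * b x i j) \<le> cmod (b (x \<otimes> x) i j) + cmod (\<Sum>l<?d. b x i l * b x l j)"
      by (simp only: norm_triangle_ineq4)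
    then have "2 * cmod (b x i j) \<le> cmod (b (x \<otimes> x) i j) + cmod (\<Sum>l<?d. b x i l * b x l j)"
      by (simp only: norm_mult norm_numeral)
    also have "cmod (b (x \<otimes> x) i j) \<le> s" by (rule bs[OF Gs_mult[OF x x] ij])
    also have "cmod (\<Sum>l<?d. b x i l * b x l j) \<le> (\<Sum>l<?d. s * s)"
      by (rule sum_norm_le) (simp add: norm_mult mult_mono bs x ij s0)
    also have "(\<Sum>l<?d. s * s) \<le> s / 2"
    proof -
      have "real ?d * s \<le> real (Suc ?d) * r" using s s0 by (intro mult_mono) auto
      also have "\<dots> = 1 / 2" by (simp add: r_def field_simps)
      finally show ?thesis using s0 mult_right_mono[of "real ?d * s" "1 / 2" s] by simp
    qed
    finally show "cmod (b x i j) \<le> 3 / 4 * s" by simp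
  qed
  have iter: "\<forall>x\<in>Gs m. \<forall>i<?d. \<forall>j<?d. cmod (b x i j) \<le> (3 / 4) ^ n * r" for n
  proof (induction n)
    case 0
    then show ?case using br by simp
  next
    case (Suc n)
    have "(3 / 4) ^ n * r \<le> 1 * r" by (intro mult_right_mono power_le_one) (use r in auto)
    then have "(3 / 4) ^ n * r \<le> r" by (simp only: mult_1)
    from step[OF Suc this] show ?case by (simp only: power_Suc mult.assoc)
  qed
  have b0: "b x i j = 0" if x: "x \<in> Gs m" "i < ?d" "j < ?d" for x i j
  proof -
    have "(\<lambda>n. (3 / 4) ^ n * r) \<longlonglongrightarrow> 0 * r" by (intro tendsto_mult tendsto_const LIMSEQ_power_zero) simp
    then have "cmod (b x i j) \<le> 0 * r"
    proof (rule LIMSEQ_le_const)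
      show "\<exists>N. \<forall>n\<ge>N. cmod (b x i j) \<le> (3 / 4) ^ n * r" using iter x by blast
    qed
    then show ?thesis by simp
  qed
  have "\<xi> x = 1\<^sub>m ?d" if "x \<in> Gs m" for x
  proof (rule eq_matI)
    have "x \<in> carrier G" using that Gs_subset by blast
    from rep_carrier[OF \<xi> this] show "dim_row (\<xi> x) = dim_row (1\<^sub>m ?d :: complex mat)"
      "dim_col (\<xi> x) = dim_col (1\<^sub>m ?d :: complex mat)" by auto
    fix i j assume "i < dim_row (1\<^sub>m ?d :: complex mat)" "j < dim_col (1\<^sub>m ?d :: complex mat)"
    then have "b x i j = 0" using b0 that by simp
    then show "\<xi> x $$ (i, j) = (1\<^sub>m ?d :: complex mat) $$ (i, j)" by (simp only: b_def right_minus_eq)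
  qed
  then show ?thesis using \<xi> by (intro that[of m]) (simp add: annihilator_def)
qed

section \<open>The level of a representation and its bracket\<close>

lemma annihilator_antimono: "H \<subseteq> K \<Longrightarrow> annihilator G T K \<subseteq> annihilator G T H"
  by (auto simp: annihilator_def)

text \<open>The subgroups shrink, so the levels on which \<xi> is trivial form a final segment; its
  least element \<open>k\<close>, when positive, is the only solution of the definite description. A
  representation trivial on G has \<open>k = 0\<close>, and the index of \<open>Gs 0\<close> is 1,
  in accordance with its bracket.\<close>

lemma rep_bracket_eq:
  assumes \<xi>: "\<xi> \<in> unitary_reps G T"
  shows "\<exists>k. rep_bracket G T Gs \<xi> = real (group_index G (Gs k)) \<and>
    (\<forall>n. \<xi> \<in> annihilator G T (Gs n) \<longleftrightarrow> k \<le> n)"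
proof -
  define k where "k = (LEAST n. \<xi> \<in> annihilator G T (Gs n))"
  obtain m where "\<xi> \<in> annihilator G T (Gs m)" by (rule rep_trivial_on_some_Gs[OF \<xi>])
  then have k: "\<xi> \<in> annihilator G T (Gs k)" unfolding k_def by (rule LeastI)
  have iff: "\<xi> \<in> annihilator G T (Gs n) \<longleftrightarrow> k \<le> n" for n
    using k annihilator_antimono[OF Gs_antimono, of k n] Least_le[of "\<lambda>n. \<xi> \<in> annihilator G T (Gs n)" n]
    unfolding k_def by blast
  have "rep_bracket G T Gs \<xi> = real (group_index G (Gs k))"
  proof (cases "k = 0")
    case True
    have "a <# Gs 0 = carrier G" if "a \<in> carrier G" for a
      using that unfolding Gs_0 l_coset_eq[OF subset_refl that] by blast
    then have "left_cosets 0 = {carrier G}"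
      unfolding left_cosets_def by (auto intro: image_eqI[of _ _ \<one>])
    then have "group_index G (Gs 0) = 1" using card_left_cosets[of 0] by simp
    moreover have "\<xi> \<in> annihilator G T (carrier G)" using True iff[of 0] by (simp add: Gs_0)
    ultimately show ?thesis using True by (simp add: rep_bracket_def)
  next
    case False
    \<comment> \<open>For \<open>n = 0\<close> truncated subtraction makes both sides false.\<close>
    have lev: "\<xi> \<in> Rep_level G T Gs n \<longleftrightarrow> k \<le> n \<and> \<not> k \<le> n - 1" for n
      unfolding Rep_level_def Diff_iff iff ..
    have "(THE n. n \<ge> 1 \<and> \<xi> \<in> Rep_level G T Gs n) = k"
      unfolding lev by (rule the_equality) (use False in auto)
    moreover have "\<xi> \<notin> annihilator G T (carrier G)" using False iff[of 0] by (simp add: Gs_0)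
    ultimately show ?thesis by (simp add: rep_bracket_def)
  qed
  then show ?thesis using iff by blast
qed

text \<open>Since the indices increase strictly, the condition on the bracket that cuts out the tail
  becomes nontriviality on \<open>Gs n\<close>, the form used in all estimates.\<close>

lemma rep_bracket_gt_iff:
  assumes "\<xi> \<in> unitary_reps G T"
  shows "rep_bracket G T Gs \<xi> > real (group_index G (Gs n)) \<longleftrightarrow> \<xi> \<notin> annihilator G T (Gs n)"
proof -
  obtain k where k: "rep_bracket G T Gs \<xi> = real (group_index G (Gs k))"
      "\<And>n. \<xi> \<in> annihilator G T (Gs n) \<longleftrightarrow> k \<le> n" using rep_bracket_eq[OF assms] by blast
  show ?thesis unfolding k using strict_mono_less[OF index_strict_mono, of n k] by auto
qed

lemma rep_bracket_pos: "\<xi> \<in> unitary_reps G T \<Longrightarrow> rep_bracket G T Gs \<xi> > 0"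
  using rep_bracket_eq index_pos by (metis of_nat_0_less_iff)

section \<open>Schur orthogonality\<close>


lemma irreducible_unitary: "\<xi> \<in> irreducible_reps G T \<Longrightarrow> \<xi> \<in> unitary_reps G T"
  by (simp add: irreducible_reps_def)

lemma irreducible_dim: "\<xi> \<in> irreducible_reps G T \<Longrightarrow> rep_dim G \<xi> > 0"
  by (simp add: irreducible_reps_def)

lemma irreducible_subspace:
  "\<xi> \<in> irreducible_reps G T \<Longrightarrow> VectorSpace.subspace class_ring W (module_vec TYPE(complex) (rep_dim G \<xi>)) \<Longrightarrow>
    (\<And>x w. x \<in> carrier G \<Longrightarrow> w \<in> W \<Longrightarrow> \<xi> x *\<^sub>v w \<in> W) \<Longrightarrow>
    W = {0\<^sub>v (rep_dim G \<xi>)} \<or> W = carrier_vec (rep_dim G \<xi>)"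
  unfolding irreducible_reps_def by blast

lemma irreducible_commutant:
  assumes "\<xi> \<in> irreducible_reps G T" "A \<in> carrier_mat (rep_dim G \<xi>) (rep_dim G \<xi>)"
    "\<And>x. x \<in> carrier G \<Longrightarrow> A * \<xi> x = \<xi> x * A"
  obtains c where "A = c \<cdot>\<^sub>m 1\<^sub>m (rep_dim G \<xi>)"
  using irreducible_unitary[OF assms(1)]
  by (rule schur_scalar[OF irreducible_dim[OF assms(1)] assms(2) rep_carrier irreducible_subspace[OF assms(1)] assms(3)])

text \<open>Take adjoints of the intertwining relation at \<open>inv x\<close>, where unitarity
  turns the value of a representation into the adjoint of its value at \<open>x\<close>.\<close>

lemma intertwiner_adjoint:
  assumes \<xi>: "\<xi> \<in> unitary_reps G T" and \<eta>: "\<eta> \<in> unitary_reps G T"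
    and S: "S \<in> carrier_mat (rep_dim G \<eta>) (rep_dim G \<xi>)"
    and int: "\<forall>x\<in>carrier G. \<eta> x * S = S * \<xi> x" and x: "x \<in> carrier G"
  shows "\<xi> x * mat_adjoint S = mat_adjoint S * \<eta> x"
proof -
  have ix: "inv x \<in> carrier G" using x by simp
  have "mat_adjoint (\<eta> (inv x) * S) = mat_adjoint (S * \<xi> (inv x))" using int ix by simp
  then have "mat_adjoint S * mat_adjoint (\<eta> (inv x)) = mat_adjoint (\<xi> (inv x)) * mat_adjoint S"
    using mat_adjoint_mult[OF rep_carrier[OF \<eta> ix] S] mat_adjoint_mult[OF S rep_carrier[OF \<xi> ix]] by simp
  then show ?thesis using rep_inv[OF \<eta> ix] rep_inv[OF \<xi> ix] x by simp
qed

lemma intertwiner_commutes: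
  assumes \<xi>: "\<xi> \<in> unitary_reps G T" and \<eta>: "\<eta> \<in> unitary_reps G T"
    and S: "S \<in> carrier_mat (rep_dim G \<eta>) (rep_dim G \<xi>)"
    and int: "\<forall>x\<in>carrier G. \<eta> x * S = S * \<xi> x" and x: "x \<in> carrier G"
  shows "(mat_adjoint S * S) * \<xi> x = \<xi> x * (mat_adjoint S * S)"
proof -
  let ?n = "rep_dim G \<xi>" and ?m = "rep_dim G \<eta>"
  have c: "\<xi> x \<in> carrier_mat ?n ?n" "\<eta> x \<in> carrier_mat ?m ?m" "mat_adjoint S \<in> carrier_mat ?n ?m"
    using rep_carrier[OF \<xi> x] rep_carrier[OF \<eta> x] S by auto
  have "(mat_adjoint S * S) * \<xi> x = mat_adjoint S * (\<eta> x * S)"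
    unfolding bspec[OF int x] by (rule assoc_mult_mat[OF c(3) S c(1)])
  also have "\<dots> = \<xi> x * mat_adjoint S * S"
    unfolding intertwiner_adjoint[OF \<xi> \<eta> S int x] by (rule assoc_mult_mat[OF c(3,2) S, symmetric])
  also have "\<dots> = \<xi> x * (mat_adjoint S * S)" by (rule assoc_mult_mat[OF c(1,3) S])
  finally show ?thesis .
qed

lemma adjoint_mult_self_diag:
  assumes "S \<in> carrier_mat m n" "j < n"
  shows "(mat_adjoint S * S) $$ (j, j) = complex_of_real (\<Sum>l<m. (cmod (S $$ (l, j)))\<^sup>2)"
proof -
  have "(mat_adjoint S * S) $$ (j, j) = (\<Sum>l<m. mat_adjoint S $$ (j, l) * S $$ (l, j))"
    by (rule mult_mat_index_sum[OF mat_adjoint_carrier[OF assms(1)] assms(1) assms(2,2)])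
  also have "\<dots> = complex_of_real (\<Sum>l<m. (cmod (S $$ (l, j)))\<^sup>2)"
    unfolding of_real_sum
    by (intro sum.cong refl) (use assms in \<open>auto simp: complex_norm_square mult.commute simp del: of_real_power\<close>)
  finally show ?thesis .
qed

text \<open>With S' the adjoint of S, both S' S and S S' are scalars c and c' by irreducibility;
  associating S S' S in two ways gives c = c' when S is nonzero. The sum of all |S_ij|^2 is n c by
  columns and m c' by rows, so n = m, and S / sqrt c is a unitary equivalence, which
  \<open>ne\<close> excludes.\<close>

lemma schur_inequivalent:
  assumes \<xi>: "\<xi> \<in> irreducible_reps G T" and \<eta>: "\<eta> \<in> irreducible_reps G T"
    and ne: "(\<xi>, \<eta>) \<notin> rep_equiv G T"
    and S: "S \<in> carrier_mat (rep_dim G \<eta>) (rep_dim G \<xi>)"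
    and int: "\<forall>x\<in>carrier G. \<eta> x * S = S * \<xi> x"
  shows "S = 0\<^sub>m (rep_dim G \<eta>) (rep_dim G \<xi>)"
proof (rule ccontr)
  assume "S \<noteq> 0\<^sub>m (rep_dim G \<eta>) (rep_dim G \<xi>)"
  let ?n = "rep_dim G \<xi>" and ?m = "rep_dim G \<eta>"
  let ?S' = "mat_adjoint S"
  note u = irreducible_unitary[OF \<xi>] irreducible_unitary[OF \<eta>]
  have S': "?S' \<in> carrier_mat ?n ?m" using S by auto
  have "\<exists>a b. a < ?m \<and> b < ?n \<and> S $$ (a, b) \<noteq> 0"
  proof (rule ccontr)
    assume "\<not> ?thesis"
    then have "S = 0\<^sub>m ?m ?n" using S by (intro eq_matI) auto
    with \<open>S \<noteq> 0\<^sub>m ?m ?n\<close> show False ..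
  qed
  then obtain a b where ab: "a < ?m" "b < ?n" "S $$ (a, b) \<noteq> 0" by blast
  obtain c where c: "?S' * S = c \<cdot>\<^sub>m 1\<^sub>m ?n"
    using irreducible_commutant[OF \<xi> mult_carrier_mat[OF S' S]] intertwiner_commutes[OF u S int] by blast
  have int': "\<forall>x\<in>carrier G. \<xi> x * ?S' = ?S' * \<eta> x"
    using intertwiner_adjoint[OF u S int] by blast
  obtain c' where c': "S * ?S' = c' \<cdot>\<^sub>m 1\<^sub>m ?m"
    using irreducible_commutant[OF \<eta> mult_carrier_mat[OF S S']] intertwiner_commutes[OF u(2,1) S' int'] by auto
  have col: "c = complex_of_real (\<Sum>l<?m. (cmod (S $$ (l, j)))\<^sup>2)" if "j < ?n" for j
    using adjoint_mult_self_diag[OF S that] c that by simp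
  have row: "c' = complex_of_real (\<Sum>l<?n. (cmod (S $$ (i, l)))\<^sup>2)" if "i < ?m" for i
    using adjoint_mult_self_diag[OF S' that] c' that S by simp
  define r where "r = (\<Sum>l<?m. (cmod (S $$ (l, b)))\<^sup>2)"
  have cr: "c = complex_of_real r" using col[OF ab(2)] by (simp add: r_def)
  have "(cmod (S $$ (a, b)))\<^sup>2 \<le> r" unfolding r_def by (rule member_le_sum) (use ab in auto)
  then have r: "r > 0" using ab(3) by (smt (verit) zero_less_norm_iff zero_less_power)
  have "S * ?S' * S = S * (?S' * S)" by (rule assoc_mult_mat[OF S S' S])
  then have "c' \<cdot>\<^sub>m S = c \<cdot>\<^sub>m S"
    unfolding c c' using S by (simp add: mult_smult_distrib[OF S one_carrier_mat] mult_smult_assoc_mat[OF one_carrier_mat S])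
  then have "(c' \<cdot>\<^sub>m S) $$ (a, b) = (c \<cdot>\<^sub>m S) $$ (a, b)" by simp
  then have cc': "c' = c" using ab S by simp
  have "complex_of_nat ?n * c = (\<Sum>j<?n. complex_of_real (\<Sum>l<?m. (cmod (S $$ (l, j)))\<^sup>2))"
  proof -
    have "(\<Sum>j<?n. c) = (\<Sum>j<?n. complex_of_real (\<Sum>l<?m. (cmod (S $$ (l, j)))\<^sup>2))"
      by (rule sum.cong[OF refl], rule col) simp
    then show ?thesis by simp
  qed
  also have "\<dots> = (\<Sum>i<?m. complex_of_real (\<Sum>l<?n. (cmod (S $$ (i, l)))\<^sup>2))"
    unfolding of_real_sum by (rule sum.swap)
  also have "\<dots> = (\<Sum>i<?m. c')"
    by (rule sum.cong[OF refl], rule row[symmetric]) simp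
  also have "\<dots> = complex_of_nat ?m * c'" by simp
  finally have nm: "?n = ?m" using cc' cr r by simp
  define U where "U = complex_of_real (1 / sqrt r) \<cdot>\<^sub>m S"
  have aa: "complex_of_real (1 / sqrt r) * complex_of_real (1 / sqrt r) * c = 1"
    using r unfolding cr by (simp flip: of_real_mult)
  have U: "U \<in> carrier_mat ?n ?n" using S nm by (simp add: U_def)
  have U': "mat_adjoint U = complex_of_real (1 / sqrt r) \<cdot>\<^sub>m ?S'"
    using S by (intro eq_matI) (auto simp: U_def)
  have sm: "(z \<cdot>\<^sub>m A) * (z \<cdot>\<^sub>m B) = (z * z) \<cdot>\<^sub>m (A * B)"
    if "A \<in> carrier_mat ?n ?n" "B \<in> carrier_mat ?n ?n" for z :: complex and A B
    using that by (simp add: mult_smult_distrib[where ?nr = ?n and ?n = ?n and ?nc = ?n]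
        mult_smult_assoc_mat[where ?nr = ?n and ?n = ?n and ?nc = ?n] smult_smult_mat)
  have "unitary_matrix U"
  proof (rule unitary_matrixI[OF U])
    show "mat_adjoint U * U = 1\<^sub>m ?n"
      unfolding U' unfolding U_def using S S' nm aa c by (subst sm) (auto simp: smult_smult_mat)
    show "U * mat_adjoint U = 1\<^sub>m ?n"
      unfolding U' unfolding U_def using S S' nm aa c' cc' by (subst sm) (auto simp: smult_smult_mat)
  qed
  moreover have "U * \<xi> x = \<eta> x * U" if x: "x \<in> carrier G" for x
    unfolding U_def using bspec[OF int x] mult_smult_assoc_mat[OF S rep_carrier[OF u(1) x]] mult_smult_distrib[OF rep_carrier[OF u(2) x] S]
    by simp
  ultimately have "(\<xi>, \<eta>) \<in> rep_equiv G T"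
    using u nm U unfolding rep_equiv_def by auto
  with ne show False ..
qed

text \<open>\<open>S\<close> is the average over x of \<eta>(x) E \<xi>(inv x), with E the matrix
  unit at (a, b). Row i of \<open>S\<close> is also row b of the Fourier coefficient at \<xi> of the
  entry (i, a) of \<eta>, so the translation rule for coefficients yields the relation.\<close>

lemma entry_integral_intertwines:
  assumes \<xi>: "\<xi> \<in> unitary_reps G T" and \<eta>: "\<eta> \<in> unitary_reps G T"
    and a: "a < rep_dim G \<eta>" and b: "b < rep_dim G \<xi>" and h: "h \<in> carrier G"
  defines "S \<equiv> mat (rep_dim G \<eta>) (rep_dim G \<xi>) (\<lambda>(i, j). L2_inner \<mu> (\<lambda>x. \<eta> x $$ (i, a)) (\<lambda>x. \<xi> x $$ (j, b)))"
  shows "\<eta> h * S = S * \<xi> h"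
proof (rule eq_matI)
  let ?n = "rep_dim G \<xi>" and ?m = "rep_dim G \<eta>"
  have S: "S \<in> carrier_mat ?m ?n" by (simp add: S_def)
  note c = rep_carrier[OF \<xi> h] rep_carrier[OF \<eta> h]
  fix i j assume "i < dim_row (S * \<xi> h)" "j < dim_col (S * \<xi> h)"
  then have ij: "i < ?m" "j < ?n" using S c by auto
  let ?f = "\<lambda>i x. \<eta> x $$ (i, a)"
  have f: "?f l \<in> L2 \<mu>" if "l < ?m" for l by (rule rep_entry_L2[OF \<eta> that a])
  have e: "(\<lambda>x. \<xi> x $$ (j, b)) \<in> L2 \<mu>" by (rule rep_entry_L2[OF \<xi> ij(2) b])
  have coeff: "fourier_coeff G \<mu> (?f l) \<xi> $$ (b, k) = S $$ (l, k)" if "l < ?m" "k < ?n" for l k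
    using that by (simp add: fourier_coeff_index[OF \<xi> b] S_def)
  have "(\<eta> h * S) $$ (i, j) = (\<Sum>l<?m. \<eta> h $$ (i, l) * S $$ (l, j))"
    by (rule mult_mat_index_sum[OF c(2) S ij])
  also have "\<dots> = (\<Sum>l<?m. L2_inner \<mu> (\<lambda>x. \<eta> h $$ (i, l) * ?f l x) (\<lambda>x. \<xi> x $$ (j, b)))"
    using ij by (intro sum.cong refl) (simp add: S_def L2_inner_scale_left)
  also have "\<dots> = L2_inner \<mu> (\<lambda>x. \<Sum>l<?m. \<eta> h $$ (i, l) * ?f l x) (\<lambda>x. \<xi> x $$ (j, b))"
    using f e by (intro L2_inner_sum_left[symmetric] L2_scale) auto
  also have "\<dots> = L2_inner \<mu> (\<lambda>x. ?f i (h \<otimes> x)) (\<lambda>x. \<xi> x $$ (j, b))"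
  proof (rule L2_inner_cong)
    fix x assume "x \<in> space \<mu>"
    then have x: "x \<in> carrier G" by (simp add: space_haar)
    show "(\<Sum>l<?m. \<eta> h $$ (i, l) * ?f l x) = ?f i (h \<otimes> x)"
      using mult_mat_index_sum[OF c(2) rep_carrier[OF \<eta> x] ij(1) a] rep_mult[OF \<eta> h x] by simp
  qed simp
  also have "\<dots> = fourier_coeff G \<mu> (\<lambda>x. ?f i (h \<otimes> x)) \<xi> $$ (b, j)"
    by (rule fourier_coeff_index[OF \<xi> b ij(2), symmetric])
  also have "\<dots> = (fourier_coeff G \<mu> (?f i) \<xi> * \<xi> h) $$ (b, j)"
    by (simp only: fourier_coeff_left_mult[OF \<xi> f[OF ij(1)] h])
  also have "\<dots> = (\<Sum>l<?n. fourier_coeff G \<mu> (?f i) \<xi> $$ (b, l) * \<xi> h $$ (l, j))"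
    by (rule mult_mat_index_sum[OF fourier_coeff_carrier c(1) b ij(2)])
  also have "\<dots> = (\<Sum>l<?n. S $$ (i, l) * \<xi> h $$ (l, j))" using coeff ij by simp
  also have "\<dots> = (S * \<xi> h) $$ (i, j)" by (rule mult_mat_index_sum[OF S c(1) ij, symmetric])
  finally show "(\<eta> h * S) $$ (i, j) = (S * \<xi> h) $$ (i, j)" .
qed (use rep_carrier[OF \<xi> h] rep_carrier[OF \<eta> h] in \<open>auto simp: S_def\<close>)

lemma schur_orthogonality_inequivalent:
  assumes \<xi>: "\<xi> \<in> irreducible_reps G T" and \<eta>: "\<eta> \<in> irreducible_reps G T"
    and ne: "(\<xi>, \<eta>) \<notin> rep_equiv G T"
    and "i < rep_dim G \<eta>" "a < rep_dim G \<eta>" "j < rep_dim G \<xi>" "b < rep_dim G \<xi>"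
  shows "L2_inner \<mu> (\<lambda>x. \<eta> x $$ (i, a)) (\<lambda>x. \<xi> x $$ (j, b)) = 0"
proof -
  let ?S = "mat (rep_dim G \<eta>) (rep_dim G \<xi>) (\<lambda>(i, j). L2_inner \<mu> (\<lambda>x. \<eta> x $$ (i, a)) (\<lambda>x. \<xi> x $$ (j, b)))"
  have "?S = 0\<^sub>m (rep_dim G \<eta>) (rep_dim G \<xi>)"
    by (rule schur_inequivalent[OF \<xi> \<eta> ne])
      (use entry_integral_intertwines[OF irreducible_unitary[OF \<xi>] irreducible_unitary[OF \<eta>]] assms in auto)
  then have "?S $$ (i, j) = 0\<^sub>m (rep_dim G \<eta>) (rep_dim G \<xi>) $$ (i, j)" by simp
  then show ?thesis using assms by simp
qed

text \<open>The averaged matrix \<open>S\<close> is a scalar c, and c is found from the trace: the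
  columns of a unitary matrix are orthonormal, so d c is 1 or 0 according to whether
  \<open>a = b\<close>.\<close>

lemma schur_orthogonality:
  assumes \<xi>: "\<xi> \<in> irreducible_reps G T"
    and "i < rep_dim G \<xi>" "a < rep_dim G \<xi>" "j < rep_dim G \<xi>" "b < rep_dim G \<xi>"
  shows "L2_inner \<mu> (\<lambda>x. \<xi> x $$ (i, a)) (\<lambda>x. \<xi> x $$ (j, b)) =
    (if i = j \<and> a = b then 1 / complex_of_nat (rep_dim G \<xi>) else 0)"
proof -
  let ?d = "rep_dim G \<xi>"
  note u = irreducible_unitary[OF \<xi>]
  define S where "S = mat ?d ?d (\<lambda>(i, j). L2_inner \<mu> (\<lambda>x. \<xi> x $$ (i, a)) (\<lambda>x. \<xi> x $$ (j, b)))"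
  have "S \<in> carrier_mat ?d ?d" by (simp add: S_def)
  then obtain c where c: "S = c \<cdot>\<^sub>m 1\<^sub>m ?d"
    using irreducible_commutant[OF \<xi>, of S] entry_integral_intertwines[OF u u assms(3,5)] unfolding S_def by auto
  have entry: "L2_inner \<mu> (\<lambda>x. \<xi> x $$ (i, a)) (\<lambda>x. \<xi> x $$ (j, b)) = (if i = j then c else 0)"
    if "i < ?d" "j < ?d" for i j
    using arg_cong[OF c, of "\<lambda>S. S $$ (i, j)"] that by (auto simp: S_def)
  have "complex_of_nat ?d * c = (\<Sum>i<?d. L2_inner \<mu> (\<lambda>x. \<xi> x $$ (i, a)) (\<lambda>x. \<xi> x $$ (i, b)))"
    using entry by simp
  also have "\<dots> = (LINT x|\<mu>. (\<Sum>i<?d. \<xi> x $$ (i, a) * cnj (\<xi> x $$ (i, b))))"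
    unfolding L2_inner_def
    by (rule Bochner_Integration.integral_sum[symmetric])
      (use assms rep_entry_L2[OF u] in \<open>auto intro: L2_mult_cnj_integrable\<close>)
  also have "\<dots> = (LINT x|\<mu>. (if a = b then 1 else 0))"
  proof (intro Bochner_Integration.integral_cong refl)
    fix x assume "x \<in> space \<mu>"
    then have x: "x \<in> carrier G" by (simp add: space_haar)
    note c = rep_carrier[OF u x]
    have "(\<Sum>i<?d. \<xi> x $$ (i, a) * cnj (\<xi> x $$ (i, b))) = (\<Sum>i<?d. mat_adjoint (\<xi> x) $$ (b, i) * \<xi> x $$ (i, a))"
      using c assms by (intro sum.cong refl) auto
    also have "\<dots> = (mat_adjoint (\<xi> x) * \<xi> x) $$ (b, a)"
      by (rule mult_mat_index_sum[OF mat_adjoint_carrier[OF c] c assms(5,3), symmetric])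
    also have "\<dots> = (if a = b then 1 else 0)"
      using unitary_matrixD(1)[OF rep_unitary[OF u x] c] assms by auto
    finally show "(\<Sum>i<?d. \<xi> x $$ (i, a) * cnj (\<xi> x $$ (i, b))) = (if a = b then 1 else 0)" .
  qed
  also have "\<dots> = (if a = b then 1 else 0)" using measure_space_haar by (simp add: space_haar)
  finally have "c = (if a = b then 1 / complex_of_nat ?d else 0)"
    using irreducible_dim[OF \<xi>] by (auto simp: field_simps split: if_splits)
  then show ?thesis using entry[OF assms(2,4)] by simp
qed

section \<open>The unitary dual\<close>

lemma rep_equiv_sym: "(\<pi>, \<rho>) \<in> rep_equiv G T \<Longrightarrow> (\<rho>, \<pi>) \<in> rep_equiv G T"
proof -
  assume "(\<pi>, \<rho>) \<in> rep_equiv G T"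
  then obtain U where *: "\<pi> \<in> unitary_reps G T" "\<rho> \<in> unitary_reps G T" "rep_dim G \<pi> = rep_dim G \<rho>"
      "U \<in> carrier_mat (rep_dim G \<pi>) (rep_dim G \<pi>)" "unitary_matrix U" "\<forall>x\<in>carrier G. \<rho> x * U = U * \<pi> x"
    by (auto simp: rep_equiv_def)
  have S: "U \<in> carrier_mat (rep_dim G \<rho>) (rep_dim G \<pi>)" using * by simp
  have "mat_adjoint U * \<rho> x = \<pi> x * mat_adjoint U" if "x \<in> carrier G" for x
    by (rule intertwiner_adjoint[OF *(1,2) S *(6) that, symmetric])
  then show ?thesis using *
    unfolding rep_equiv_def by (auto intro!: bexI[of _ "mat_adjoint U"] unitary_matrix_adjoint)
qed

lemma rep_equiv_trans:
  assumes "(\<pi>, \<rho>) \<in> rep_equiv G T" "(\<rho>, \<sigma>) \<in> rep_equiv G T"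
  shows "(\<pi>, \<sigma>) \<in> rep_equiv G T"
proof -
  let ?d = "rep_dim G \<pi>"
  obtain U where U: "\<pi> \<in> unitary_reps G T" "\<rho> \<in> unitary_reps G T" "?d = rep_dim G \<rho>"
      "U \<in> carrier_mat ?d ?d" "unitary_matrix U" "\<And>x. x \<in> carrier G \<Longrightarrow> U * \<pi> x = \<rho> x * U"
    using assms(1) by (auto simp: rep_equiv_def)
  obtain V where V: "\<sigma> \<in> unitary_reps G T" "?d = rep_dim G \<sigma>"
      "V \<in> carrier_mat ?d ?d" "unitary_matrix V" "\<And>x. x \<in> carrier G \<Longrightarrow> V * \<rho> x = \<sigma> x * V"
    using assms(2) U(3) by (auto simp: rep_equiv_def)
  have "V * U * \<pi> x = \<sigma> x * (V * U)" if x: "x \<in> carrier G" for x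
  proof -
    have c: "\<pi> x \<in> carrier_mat ?d ?d" "\<rho> x \<in> carrier_mat ?d ?d" "\<sigma> x \<in> carrier_mat ?d ?d"
      using rep_carrier[OF U(1) x] rep_carrier[OF U(2) x] rep_carrier[OF V(1) x] U(3) V(2) by auto
    have "V * U * \<pi> x = V * (\<rho> x * U)" using assoc_mult_mat[OF V(3) U(4) c(1)] U(6)[OF x] by simp
    also have "\<dots> = \<sigma> x * V * U" using assoc_mult_mat[OF V(3) c(2) U(4)] V(5)[OF x] by simp
    also have "\<dots> = \<sigma> x * (V * U)" by (rule assoc_mult_mat[OF c(3) V(3) U(4)])
    finally show ?thesis .
  qed
  then show ?thesis
    using U V unitary_matrix_mult[OF V(4) U(5) V(3) U(4)] unfolding rep_equiv_def
    by (auto intro!: bexI[of _ "V * U"])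
qed

text \<open>An invariant subspace \<open>W\<close> for \<eta> pulls back along \<open>U\<close> to
  one for \<xi>. Needed because \<open>class_rep\<close> may return any member of its class.\<close>

lemma irreducible_equiv:
  assumes \<xi>: "\<xi> \<in> irreducible_reps G T" and eq: "(\<xi>, \<eta>) \<in> rep_equiv G T"
  shows "\<eta> \<in> irreducible_reps G T"
proof -
  let ?d = "rep_dim G \<xi>"
  obtain U where U: "\<xi> \<in> unitary_reps G T" "\<eta> \<in> unitary_reps G T" "rep_dim G \<eta> = ?d"
      "U \<in> carrier_mat ?d ?d" "unitary_matrix U" "\<And>x. x \<in> carrier G \<Longrightarrow> U * \<xi> x = \<eta> x * U"
    using eq by (auto simp: rep_equiv_def)
  have Ua: "mat_adjoint U \<in> carrier_mat ?d ?d" using U by auto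
  have "W = {0\<^sub>v ?d} \<or> W = carrier_vec ?d"
    if W: "VectorSpace.subspace class_ring W (module_vec TYPE(complex) ?d)"
      "\<And>x w. x \<in> carrier G \<Longrightarrow> w \<in> W \<Longrightarrow> \<eta> x *\<^sub>v w \<in> W" for W
  proof -
    note Ws = W(1)[unfolded subspace_vec_iff]
    define W' where "W' = {v \<in> carrier_vec ?d. U *\<^sub>v v \<in> W}"
    have "VectorSpace.subspace class_ring W' (module_vec TYPE(complex) ?d)"
      unfolding subspace_vec_iff W'_def using Ws U(4) mult_mat_vec_zero[OF U(4)]
      by (auto simp: mult_add_distrib_mat_vec[OF U(4)] mult_mat_vec)
    moreover have "\<xi> x *\<^sub>v w \<in> W'" if x: "x \<in> carrier G" and w: "w \<in> W'" for x w
    proof -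
      have c: "\<xi> x \<in> carrier_mat ?d ?d" "\<eta> x \<in> carrier_mat ?d ?d"
        using rep_carrier[OF U(1) x] rep_carrier[OF U(2) x] U(3) by auto
      have wc: "w \<in> carrier_vec ?d" using w by (simp add: W'_def)
      have "U *\<^sub>v (\<xi> x *\<^sub>v w) = \<eta> x *\<^sub>v (U *\<^sub>v w)"
        using U(6)[OF x] assoc_mult_mat_vec[OF U(4) c(1) wc] assoc_mult_mat_vec[OF c(2) U(4) wc] by simp
      then show ?thesis using W(2)[OF x] w c wc by (simp add: W'_def)
    qed
    ultimately have or: "W' = {0\<^sub>v ?d} \<or> W' = carrier_vec ?d"
      by (rule irreducible_subspace[OF \<xi>])
    have inv: "U *\<^sub>v (mat_adjoint U *\<^sub>v w) = w" if "w \<in> carrier_vec ?d" for w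
      using assoc_mult_mat_vec[OF U(4) Ua that] unitary_matrixD(2)[OF U(5,4)] that by simp
    show ?thesis
    proof (cases "W' = {0\<^sub>v ?d}")
      case True
      have "w = 0\<^sub>v ?d" if "w \<in> W" for w
      proof -
        have wc: "w \<in> carrier_vec ?d" using that Ws by auto
        then have "mat_adjoint U *\<^sub>v w \<in> W'" using inv[OF wc] that Ua by (simp add: W'_def)
        then have "mat_adjoint U *\<^sub>v w = 0\<^sub>v ?d" using True by simp
        then show ?thesis using inv[OF wc] U(4) by (metis mult_mat_vec_zero[OF U(4)])
      qed
      then show ?thesis using Ws by auto
    next
      case False
      then have W': "W' = carrier_vec ?d" using or by simp
      have "w \<in> W" if "w \<in> carrier_vec ?d" for w
      proof -
        have "mat_adjoint U *\<^sub>v w \<in> W'" unfolding W' using Ua that by simp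
        then show ?thesis using inv[OF that] by (simp add: W'_def)
      qed
      then show ?thesis using Ws by auto
    qed
  qed
  then show ?thesis using U irreducible_dim[OF \<xi>] by (auto simp: irreducible_reps_def)
qed

lemma rep_equiv_refl: "\<xi> \<in> unitary_reps G T \<Longrightarrow> (\<xi>, \<xi>) \<in> rep_equiv G T"
proof -
  assume \<xi>: "\<xi> \<in> unitary_reps G T"
  have "unitary_matrix (1\<^sub>m (rep_dim G \<xi>) :: complex mat)" by (rule unitary_matrixI) auto
  moreover have "1\<^sub>m (rep_dim G \<xi>) * \<xi> x = \<xi> x * 1\<^sub>m (rep_dim G \<xi>)" if "x \<in> carrier G" for x
    using rep_carrier[OF \<xi> that] by simp
  ultimately show ?thesis
    using \<xi> unfolding rep_equiv_def by (auto intro!: bexI[of _ "1\<^sub>m (rep_dim G \<xi>)"])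
qed

lemma class_rep_equiv:
  assumes "c = rep_equiv G T `` {\<xi>}" "\<xi> \<in> unitary_reps G T"
  shows "(\<xi>, class_rep c) \<in> rep_equiv G T"
proof -
  have "\<xi> \<in> c" using assms rep_equiv_refl by auto
  then have "class_rep c \<in> c" unfolding class_rep_def by (rule someI[where P = "\<lambda>\<xi>. \<xi> \<in> c"])
  then show ?thesis using assms by auto
qed

lemma class_rep_irreducible:
  assumes "c \<in> unitary_dual G T"
  shows "class_rep c \<in> irreducible_reps G T"
proof -
  obtain \<xi> where "\<xi> \<in> irreducible_reps G T" "c = rep_equiv G T `` {\<xi>}"
    using assms by (auto simp: unitary_dual_def quotient_def)
  then show ?thesis using irreducible_equiv class_rep_equiv irreducible_unitary by blast
qed

lemmas class_rep_unitary = irreducible_unitary[OF class_rep_irreducible]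

lemma class_rep_inequivalent:
  assumes c: "c \<in> unitary_dual G T" and c': "c' \<in> unitary_dual G T"
    and eq: "(class_rep c, class_rep c') \<in> rep_equiv G T"
  shows "c = c'"
proof -
  obtain \<xi> where \<xi>: "\<xi> \<in> irreducible_reps G T" "c = rep_equiv G T `` {\<xi>}"
    using c by (auto simp: unitary_dual_def quotient_def)
  obtain \<eta> where \<eta>: "\<eta> \<in> irreducible_reps G T" "c' = rep_equiv G T `` {\<eta>}"
    using c' by (auto simp: unitary_dual_def quotient_def)
  have "(\<xi>, \<eta>) \<in> rep_equiv G T"
    using class_rep_equiv[OF \<xi>(2) irreducible_unitary[OF \<xi>(1)]] eq
      rep_equiv_sym[OF class_rep_equiv[OF \<eta>(2) irreducible_unitary[OF \<eta>(1)]]] rep_equiv_trans by blast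
  then show ?thesis unfolding \<xi>(2) \<eta>(2) using rep_equiv_trans rep_equiv_sym by blast
qed

section \<open>The orthonormal family of matrix coefficients\<close>

definition dual_index :: "(('a \<Rightarrow> complex mat) set \<times> nat \<times> nat) set" where
  "dual_index = (SIGMA c:unitary_dual G T. {..<rep_dim G (class_rep c)} \<times> {..<rep_dim G (class_rep c)})"

text \<open>The factor sqrt d compensates the squared norm 1/d of a matrix entry in the Schur
  relations.\<close>

definition dual_basis :: "('a \<Rightarrow> complex mat) set \<times> nat \<times> nat \<Rightarrow> 'a \<Rightarrow> complex" where
  "dual_basis = (\<lambda>(c, i, j) x. complex_of_real (sqrt (real (rep_dim G (class_rep c)))) * class_rep c x $$ (i, j))"

abbreviation "dual_closure \<equiv> ortho_closure \<mu> dual_basis dual_index"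

lemma dual_basis_L2: "k \<in> dual_index \<Longrightarrow> dual_basis k \<in> L2 \<mu>"
  using rep_entry_L2[OF class_rep_unitary] by (auto simp: dual_index_def dual_basis_def intro!: L2_scale)

lemma dual_basis_orthonormal: "orthonormal_family \<mu> dual_basis dual_index"
proof -
  have "L2_inner \<mu> (dual_basis k) (dual_basis k') = (if k = k' then 1 else 0)"
    if k: "k \<in> dual_index" and k': "k' \<in> dual_index" for k k'
  proof -
    obtain c i j where c: "k = (c, i, j)" "c \<in> unitary_dual G T" "i < rep_dim G (class_rep c)" "j < rep_dim G (class_rep c)"
      using k by (auto simp: dual_index_def)
    obtain c' i' j' where c': "k' = (c', i', j')" "c' \<in> unitary_dual G T" "i' < rep_dim G (class_rep c')" "j' < rep_dim G (class_rep c')"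
      using k' by (auto simp: dual_index_def)
    have "L2_inner \<mu> (dual_basis k) (dual_basis k') =
        complex_of_real (sqrt (real (rep_dim G (class_rep c)))) * complex_of_real (sqrt (real (rep_dim G (class_rep c'))))
        * L2_inner \<mu> (\<lambda>x. class_rep c x $$ (i, j)) (\<lambda>x. class_rep c' x $$ (i', j'))"
      unfolding c(1) c'(1) by (simp add: dual_basis_def L2_inner_scale_left L2_inner_scale_right)
    also have "\<dots> = (if k = k' then 1 else 0)"
    proof (cases "c = c'")
      case True
      have "complex_of_real (sqrt (real (rep_dim G (class_rep c)))) * complex_of_real (sqrt (real (rep_dim G (class_rep c))))
          = complex_of_nat (rep_dim G (class_rep c))"
        by (simp flip: of_real_mult)
      then show ?thesis
        using schur_orthogonality[OF class_rep_irreducible[OF c(2)] c(3,4), of i' j'] c c' True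
          irreducible_dim[OF class_rep_irreducible[OF c(2)]]
        by auto
    next
      case False
      then have "(class_rep c', class_rep c) \<notin> rep_equiv G T" using class_rep_inequivalent c(2) c'(2) by blast
      from schur_orthogonality_inequivalent[OF class_rep_irreducible[OF c'(2)] class_rep_irreducible[OF c(2)] this c(3,4) c'(3,4)]
      show ?thesis using False c(1) c'(1) by simp
    qed
    finally show ?thesis .
  qed
  then show ?thesis by (simp add: orthonormal_family_def dual_basis_L2)
qed

text \<open>For \<open>f\<close> in L2 a tail term is thus the squared norm of the projection of
  \<open>f\<close> onto the d^2-dimensional block of its class; swapping the sums undoes the
  transposition in the coefficient.\<close>

lemma tail_term_eq_sum:
  assumes "c \<in> unitary_dual G T"
  shows "tail_term G \<mu> f c = (\<Sum>(i, j)\<in>{..<rep_dim G (class_rep c)} \<times> {..<rep_dim G (class_rep c)}.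
    (cmod (L2_inner \<mu> f (dual_basis (c, i, j))))\<^sup>2)"
proof -
  let ?d = "rep_dim G (class_rep c)"
  have e: "(cmod (L2_inner \<mu> f (dual_basis (c, i, j))))\<^sup>2 = real ?d * (cmod (fourier_coeff G \<mu> f (class_rep c) $$ (j, i)))\<^sup>2"
    if "i < ?d" "j < ?d" for i j
    using that by (simp add: dual_basis_def L2_inner_scale_right norm_mult power_mult_distrib
        fourier_coeff_index[OF class_rep_unitary[OF assms]])
  have "(\<Sum>(i, j)\<in>{..<?d} \<times> {..<?d}. (cmod (L2_inner \<mu> f (dual_basis (c, i, j))))\<^sup>2)
      = (\<Sum>(i, j)\<in>{..<?d} \<times> {..<?d}. real ?d * (cmod (fourier_coeff G \<mu> f (class_rep c) $$ (j, i)))\<^sup>2)"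
    by (intro sum.cong refl) (auto simp: e)
  also have "\<dots> = (\<Sum>i<?d. \<Sum>j<?d. real ?d * (cmod (fourier_coeff G \<mu> f (class_rep c) $$ (j, i)))\<^sup>2)"
    by (rule sum.cartesian_product[symmetric])
  also have "\<dots> = (\<Sum>j<?d. \<Sum>i<?d. real ?d * (cmod (fourier_coeff G \<mu> f (class_rep c) $$ (j, i)))\<^sup>2)"
    by (rule sum.swap)
  also have "\<dots> = tail_term G \<mu> f c"
    by (simp add: tail_term_def HS_norm_sq[OF fourier_coeff_carrier] sum_distrib_left)
  finally show ?thesis ..
qed

lemma tail_term_nonneg: "0 \<le> tail_term G \<mu> f c"
  by (simp add: tail_term_def)

lemma tail_term_bessel:
  assumes "finite F" "F \<subseteq> unitary_dual G T" "f \<in> L2 \<mu>"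
  shows "(\<Sum>c\<in>F. tail_term G \<mu> f c) \<le> (L2_norm \<mu> f)\<^sup>2"
proof -
  let ?D = "\<lambda>c. {..<rep_dim G (class_rep c)} \<times> {..<rep_dim G (class_rep c)}"
  have "(\<Sum>c\<in>F. tail_term G \<mu> f c) = (\<Sum>c\<in>F. \<Sum>p\<in>?D c. (cmod (L2_inner \<mu> f (dual_basis (c, p))))\<^sup>2)"
    using assms(2) by (intro sum.cong refl) (auto simp: tail_term_eq_sum case_prod_beta)
  also have "\<dots> = (\<Sum>k\<in>Sigma F ?D. (cmod (L2_inner \<mu> f (dual_basis k)))\<^sup>2)"
    using assms(1) by (subst sum.Sigma) auto
  also have "\<dots> \<le> (L2_norm \<mu> f)\<^sup>2"
    by (rule bessel_inequality[OF dual_basis_orthonormal])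
      (use assms in \<open>auto simp: dual_index_def\<close>)
  finally show ?thesis .
qed

end

section \<open>Completeness of the matrix coefficients\<close>

lemma continuous_map_cmult:
  fixes f :: "'c \<Rightarrow> complex"
  assumes "continuous_map X euclidean f"
  shows "continuous_map X euclidean (\<lambda>x. c * f x)"
proof -
  have "continuous_map euclidean euclidean (\<lambda>z :: complex. c * z)"
    by (simp add: continuous_map_iff_continuous2 continuous_on_mult_left)
  from continuous_map_compose[OF assms this] show ?thesis by (simp add: o_def)
qed

lemma mat_eq_vecI:
  fixes A B :: "complex mat"
  assumes A: "A \<in> carrier_mat n m" and B: "B \<in> carrier_mat n m"
    and eq: "\<And>v. v \<in> carrier_vec m \<Longrightarrow> A *\<^sub>v v = B *\<^sub>v v"
  shows "A = B"
proof (rule eq_matI)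
  fix i j assume "i < dim_row B" "j < dim_col B"
  then have ij: "i < n" "j < m" using B by auto
  have "vec_index (A *\<^sub>v unit_vec m j) i = vec_index (B *\<^sub>v unit_vec m j) i" by (simp add: eq)
  then show "A $$ (i, j) = B $$ (i, j)"
    using ij by (simp add: mult_mat_vec_index_sum[OF A] mult_mat_vec_index_sum[OF B] if_distrib cong: if_cong)
qed (use A B in auto)

text \<open>\<open>P\<close> and \<open>Q\<close> are isometries onto \<open>W\<close> and onto its
  orthogonal complement, so the last equation adds the two orthogonal projections. Both dimensions
  drop because a square isometry is invertible: k = d would make \<open>W\<close> everything and m =
  d would make it zero.\<close>

lemma orthogonal_decomposition:
  assumes W: "VectorSpace.subspace class_ring W (module_vec TYPE(complex) d)"
    and ne: "W \<noteq> {0\<^sub>v d}" "W \<noteq> carrier_vec d"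
  obtains k P m Q where "k < d" "P \<in> carrier_mat d k" "mat_adjoint P * P = 1\<^sub>m k"
    "\<And>v. v \<in> carrier_vec k \<Longrightarrow> P *\<^sub>v v \<in> W"
    "\<And>w. w \<in> W \<Longrightarrow> P *\<^sub>v (mat_adjoint P *\<^sub>v w) = w"
    "m < d" "Q \<in> carrier_mat d m" "mat_adjoint Q * Q = 1\<^sub>m m"
    "mat_adjoint P * Q = 0\<^sub>m k m"
    "\<And>v. v \<in> carrier_vec d \<Longrightarrow> mat_adjoint P *\<^sub>v v = 0\<^sub>v k \<Longrightarrow> Q *\<^sub>v (mat_adjoint Q *\<^sub>v v) = v"
    "P * mat_adjoint P + Q * mat_adjoint Q = 1\<^sub>m d"
proof -
  note Ws = W[unfolded subspace_vec_iff]
  obtain k P where P: "k \<le> d" "P \<in> carrier_mat d k" "mat_adjoint P * P = 1\<^sub>m k"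
    "\<And>v. v \<in> carrier_vec k \<Longrightarrow> P *\<^sub>v v \<in> W"
    "\<And>w. w \<in> W \<Longrightarrow> P *\<^sub>v (mat_adjoint P *\<^sub>v w) = w"
    using isometry_onto_subspace[OF W] by metis
  have Pa: "mat_adjoint P \<in> carrier_mat k d" using P(2) by auto
  \<comment> \<open>Since the range of \<open>P\<close> is \<open>W\<close>, the kernel of its
    adjoint is the orthogonal complement of \<open>W\<close>.\<close>
  define W' where "W' = {v \<in> carrier_vec d. mat_adjoint P *\<^sub>v v = 0\<^sub>v k}"
  have W': "VectorSpace.subspace class_ring W' (module_vec TYPE(complex) d)"
    unfolding subspace_vec_iff W'_def using mult_mat_vec_zero[OF Pa] Pa
    by (auto simp: mult_add_distrib_mat_vec[OF Pa] mult_mat_vec[OF Pa])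
  obtain m Q where Q: "m \<le> d" "Q \<in> carrier_mat d m" "mat_adjoint Q * Q = 1\<^sub>m m"
    "\<And>v. v \<in> carrier_vec m \<Longrightarrow> Q *\<^sub>v v \<in> W'"
    "\<And>w. w \<in> W' \<Longrightarrow> Q *\<^sub>v (mat_adjoint Q *\<^sub>v w) = w"
    using isometry_onto_subspace[OF W'] by metis
  have Qa: "mat_adjoint Q \<in> carrier_mat m d" using Q(2) by auto
  have inW: "v \<in> W" if "k = d" "v \<in> carrier_vec d" for v
  proof -
    have "P * mat_adjoint P = 1\<^sub>m d"
      using mat_mult_left_right_inverse[of "mat_adjoint P" d P] P(2,3) Pa that(1) by simp
    then have "P *\<^sub>v (mat_adjoint P *\<^sub>v v) = v"
      using assoc_mult_mat_vec[OF P(2) Pa that(2)] that(2) by simp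
    moreover have "P *\<^sub>v (mat_adjoint P *\<^sub>v v) \<in> W" by (rule P(4)) (use Pa that in auto)
    ultimately show ?thesis by simp
  qed
  have "k < d"
  proof (rule ccontr)
    assume "\<not> k < d"
    then have "carrier_vec d \<subseteq> W" using inW P(1) by auto
    then show False using ne(2) Ws by auto
  qed
  have PQ: "mat_adjoint P * Q = 0\<^sub>m k m"
  proof (rule mat_eq_vecI)
    show "mat_adjoint P * Q \<in> carrier_mat k m" using Pa Q(2) by auto
    fix v :: "complex vec" assume v: "v \<in> carrier_vec m"
    have "mat_adjoint P * Q *\<^sub>v v = mat_adjoint P *\<^sub>v (Q *\<^sub>v v)" by (rule assoc_mult_mat_vec[OF Pa Q(2) v])
    also have "\<dots> = 0\<^sub>v k" using Q(4)[OF v] by (simp add: W'_def)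
    finally show "mat_adjoint P * Q *\<^sub>v v = 0\<^sub>m k m *\<^sub>v v" using v by (auto intro!: eq_vecI)
  qed simp
  have QP: "mat_adjoint Q * P = 0\<^sub>m m k"
  proof -
    have "mat_adjoint (mat_adjoint P * Q) = mat_adjoint (0\<^sub>m k m :: complex mat)" using PQ by simp
    then show ?thesis
      unfolding mat_adjoint_mult[OF Pa Q(2)] mat_adjoint_adjoint by (auto intro!: eq_matI)
  qed
  have sum1: "P * mat_adjoint P + Q * mat_adjoint Q = 1\<^sub>m d"
  proof (rule mat_eq_vecI)
    show "P * mat_adjoint P + Q * mat_adjoint Q \<in> carrier_mat d d" using P(2) Q(2) by auto
    fix v :: "complex vec" assume v: "v \<in> carrier_vec d"
    define p where "p = P *\<^sub>v (mat_adjoint P *\<^sub>v v)"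
    have av: "mat_adjoint P *\<^sub>v v \<in> carrier_vec k" using Pa v by auto
    have p: "p \<in> carrier_vec d" unfolding p_def using P(2) av by auto
    have Pp: "mat_adjoint P *\<^sub>v p = mat_adjoint P *\<^sub>v v"
      unfolding p_def using assoc_mult_mat_vec[OF Pa P(2) av] P(3) av by simp
    have Qp: "mat_adjoint Q *\<^sub>v p = 0\<^sub>v m"
    proof -
      have "mat_adjoint Q *\<^sub>v p = (mat_adjoint Q * P) *\<^sub>v (mat_adjoint P *\<^sub>v v)"
        unfolding p_def by (rule assoc_mult_mat_vec[OF Qa P(2) av, symmetric])
      also have "\<dots> = 0\<^sub>v m" unfolding QP using av by (auto intro!: eq_vecI)
      finally show ?thesis .
    qed
    have "v - p \<in> W'"
      unfolding W'_def using v p Pp Pa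
      by (auto simp: mult_minus_distrib_mat_vec[OF Pa v p])
    then have "Q *\<^sub>v (mat_adjoint Q *\<^sub>v (v - p)) = v - p" by (rule Q(5))
    moreover have "mat_adjoint Q *\<^sub>v (v - p) = mat_adjoint Q *\<^sub>v v"
      using mult_minus_distrib_mat_vec[OF Qa v p] Qp Qa v by auto
    ultimately have q: "Q *\<^sub>v (mat_adjoint Q *\<^sub>v v) = v - p" by simp
    have "(P * mat_adjoint P + Q * mat_adjoint Q) *\<^sub>v v = P * mat_adjoint P *\<^sub>v v + Q * mat_adjoint Q *\<^sub>v v"
      by (rule add_mult_distrib_mat_vec) (use P(2) Q(2) v in auto)
    also have "\<dots> = p + (v - p)"
      using assoc_mult_mat_vec[OF P(2) Pa v] assoc_mult_mat_vec[OF Q(2) Qa v] q by (simp add: p_def)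
    also have "\<dots> = v" using v p by (intro eq_vecI) auto
    finally show "(P * mat_adjoint P + Q * mat_adjoint Q) *\<^sub>v v = 1\<^sub>m d *\<^sub>v v" using v by simp
  qed simp
  have "m < d"
  proof (rule ccontr)
    assume "\<not> m < d"
    then have m: "m = d" using Q(1) by simp
    then have QQ: "Q * mat_adjoint Q = 1\<^sub>m d"
      using mat_mult_left_right_inverse[of "mat_adjoint Q" d Q] Q(2,3) Qa by simp
    have "w = 0\<^sub>v d" if "w \<in> W" for w
    proof -
      have w: "w \<in> carrier_vec d" using that Ws by auto
      have av: "mat_adjoint P *\<^sub>v w \<in> carrier_vec k" using Pa w by auto
      have "w = Q *\<^sub>v (mat_adjoint Q *\<^sub>v w)" using QQ assoc_mult_mat_vec[OF Q(2) Qa w] w by simp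
      also have "mat_adjoint Q *\<^sub>v w = mat_adjoint Q *\<^sub>v (P *\<^sub>v (mat_adjoint P *\<^sub>v w))"
        using P(5)[OF that] by simp
      also have "\<dots> = (mat_adjoint Q * P) *\<^sub>v (mat_adjoint P *\<^sub>v w)"
        by (rule assoc_mult_mat_vec[OF Qa P(2) av, symmetric])
      also have "\<dots> = 0\<^sub>v m" unfolding QP using av by (auto intro!: eq_vecI)
      finally show ?thesis using mult_mat_vec_zero[OF Q(2)] by simp
    qed
    then show False using ne(1) Ws by auto
  qed
  show ?thesis
    by (rule that[OF \<open>k < d\<close> P(2-5) \<open>m < d\<close> Q(2,3) PQ _ sum1]) (use Q(5) in \<open>auto simp: W'_def\<close>)
qed

context vilenkin_haar
begin

lemma sandwich_closure:
  assumes \<rho>: "\<And>x. x \<in> carrier G \<Longrightarrow> \<rho> x \<in> carrier_mat k k"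
    and cl: "\<And>a b. a < k \<Longrightarrow> b < k \<Longrightarrow> (\<lambda>x. \<rho> x $$ (a, b)) \<in> dual_closure"
    and A: "A \<in> carrier_mat d k" and C: "C \<in> carrier_mat k d" and ij: "i < d" "j < d"
  shows "(\<lambda>x. (A * \<rho> x * C) $$ (i, j)) \<in> dual_closure"
proof (rule ortho_closure_cong)
  show "(\<lambda>x. \<Sum>b<k. \<Sum>a<k. (A $$ (i, a) * C $$ (b, j)) * \<rho> x $$ (a, b)) \<in> dual_closure"
    by (intro ortho_closure_sum[OF dual_basis_orthonormal] ortho_closure_scale cl) auto
  fix x assume "x \<in> space \<mu>"
  then show "(\<Sum>b<k. \<Sum>a<k. (A $$ (i, a) * C $$ (b, j)) * \<rho> x $$ (a, b)) = (A * \<rho> x * C) $$ (i, j)"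
    using sandwich_index[OF A \<rho> C ij] by (simp add: space_haar)
qed

text \<open>The assumption \<open>inv\<close> is invariance of the range of \<open>P\<close>: the
  projection \<open>P * mat_adjoint P\<close> acts as the identity on \<open>\<pi> x * P\<close>.
  This cancels the projection in the middle of a product of two compressions; unitarity then
  follows, since the adjoint at x is the value at \<open>inv x\<close>.\<close>

lemma compression_unitary_rep:
  assumes \<pi>: "\<pi> \<in> unitary_reps G T" and P: "P \<in> carrier_mat (rep_dim G \<pi>) k" "mat_adjoint P * P = 1\<^sub>m k"
    and inv: "\<And>x. x \<in> carrier G \<Longrightarrow> P * (mat_adjoint P * (\<pi> x * P)) = \<pi> x * P"
  shows "(\<lambda>x. mat_adjoint P * \<pi> x * P) \<in> unitary_reps G T" "rep_dim G (\<lambda>x. mat_adjoint P * \<pi> x * P) = k"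
proof -
  let ?d = "rep_dim G \<pi>" and ?\<rho> = "\<lambda>x. mat_adjoint P * \<pi> x * P"
  have Pa: "mat_adjoint P \<in> carrier_mat k ?d" using P by auto
  note c = rep_carrier[OF \<pi>]
  have \<rho>c: "?\<rho> x \<in> carrier_mat k k" if "x \<in> carrier G" for x
    using c[OF that] P Pa by auto
  show dim: "rep_dim G ?\<rho> = k" using \<rho>c[of \<one>] by (auto simp: rep_dim_def)
  have one: "?\<rho> \<one> = 1\<^sub>m k" using rep_one[OF \<pi>] P Pa by simp
  have mult: "?\<rho> (x \<otimes> y) = ?\<rho> x * ?\<rho> y" if x: "x \<in> carrier G" and y: "y \<in> carrier G" for x y
  proof -
    note cx = c[OF x] and cy = c[OF y]
    have a: "mat_adjoint P * \<pi> x \<in> carrier_mat k ?d" "\<pi> y * P \<in> carrier_mat ?d k" using Pa cx cy P by auto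
    have "?\<rho> x * ?\<rho> y = mat_adjoint P * \<pi> x * P * (mat_adjoint P * (\<pi> y * P))"
      using assoc_mult_mat[OF Pa cy P(1)] by simp
    also have "\<dots> = mat_adjoint P * \<pi> x * (P * (mat_adjoint P * (\<pi> y * P)))"
      by (rule assoc_mult_mat[OF a(1) P(1) mult_carrier_mat[OF Pa a(2)]])
    also have "\<dots> = mat_adjoint P * \<pi> x * (\<pi> y * P)" by (simp only: inv[OF y])
    also have "\<dots> = mat_adjoint P * (\<pi> x * \<pi> y) * P"
      by (rule mult_mat_assoc4[OF Pa cx cy P(1)])
    finally show ?thesis using rep_mult[OF \<pi> x y] by simp
  qed
  have adj: "mat_adjoint (?\<rho> x) = ?\<rho> (inv x)" if x: "x \<in> carrier G" for x
  proof -
    note cx = c[OF x]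
    have "mat_adjoint (?\<rho> x) = mat_adjoint P * mat_adjoint (mat_adjoint P * \<pi> x)"
      by (rule mat_adjoint_mult) (use Pa cx P in auto)
    also have "mat_adjoint (mat_adjoint P * \<pi> x) = mat_adjoint (\<pi> x) * P"
      using mat_adjoint_mult[OF Pa cx] by simp
    also have "mat_adjoint P * (mat_adjoint (\<pi> x) * P) = mat_adjoint P * mat_adjoint (\<pi> x) * P"
      by (rule assoc_mult_mat[symmetric]) (use Pa cx P in auto)
    finally show ?thesis using rep_inv[OF \<pi> x] by simp
  qed
  have uni: "unitary_matrix (?\<rho> x)" if x: "x \<in> carrier G" for x
  proof (rule unitary_matrixI[OF \<rho>c[OF x]])
    show "mat_adjoint (?\<rho> x) * ?\<rho> x = 1\<^sub>m k" "?\<rho> x * mat_adjoint (?\<rho> x) = 1\<^sub>m k"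
      unfolding adj[OF x] using mult[of "inv x" x] mult[of x "inv x"] x one by simp_all
  qed
  have cont: "continuous_map T euclidean (\<lambda>x. ?\<rho> x $$ (i, j))" if ij: "i < k" "j < k" for i j
  proof (rule continuous_map_eq)
    show "continuous_map T euclidean (\<lambda>x. \<Sum>b<?d. \<Sum>a<?d. (mat_adjoint P $$ (i, a) * P $$ (b, j)) * \<pi> x $$ (a, b))"
      using \<pi> by (intro continuous_map_sum continuous_map_cmult) (auto simp: unitary_reps_def)
    fix x assume "x \<in> topspace T"
    then have x: "x \<in> carrier G" by (simp add: topspace_eq)
    note cx = c[OF x]
    show "(\<Sum>b<?d. \<Sum>a<?d. (mat_adjoint P $$ (i, a) * P $$ (b, j)) * \<pi> x $$ (a, b)) = ?\<rho> x $$ (i, j)"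
      by (rule sandwich_index[OF Pa cx P(1) ij, symmetric])
  qed
  show "?\<rho> \<in> unitary_reps G T"
    unfolding unitary_reps_def dim using \<rho>c uni mult cont dim by auto
qed

text \<open>A reducible representation splits along an invariant subspace and its orthogonal complement,
  both of smaller dimension.\<close>

lemma rep_entry_closure:
  assumes "\<pi> \<in> unitary_reps G T" "i < rep_dim G \<pi>" "j < rep_dim G \<pi>"
  shows "(\<lambda>x. \<pi> x $$ (i, j)) \<in> dual_closure"
  using assms
proof (induction "rep_dim G \<pi>" arbitrary: \<pi> i j rule: less_induct)
  case less
  let ?d = "rep_dim G \<pi>"
  note \<pi> = less.prems(1) and ij = less.prems(2,3)
  note c = rep_carrier[OF \<pi>]
  show ?case
  proof (cases "\<pi> \<in> irreducible_reps G T")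
    case True
    \<comment> \<open>\<open>dual_basis\<close> is built from the chosen representative of the
      class, so the entries of \<pi> are recovered from it by conjugation with the intertwiner
      \<open>U\<close>.\<close>
    define cl where "cl = rep_equiv G T `` {\<pi>}"
    have cl: "cl \<in> unitary_dual G T" using True by (auto simp: cl_def unitary_dual_def quotient_def)
    define \<rho> where "\<rho> = class_rep cl"
    have eq: "(\<pi>, \<rho>) \<in> rep_equiv G T" unfolding \<rho>_def by (rule class_rep_equiv[OF cl_def \<pi>])
    then obtain U where U: "\<rho> \<in> unitary_reps G T" "rep_dim G \<rho> = ?d" "U \<in> carrier_mat ?d ?d" "unitary_matrix U"
        "\<And>x. x \<in> carrier G \<Longrightarrow> U * \<pi> x = \<rho> x * U"
      by (auto simp: rep_equiv_def)
    have Ua: "mat_adjoint U \<in> carrier_mat ?d ?d" using U by auto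
    have \<rho>c: "\<rho> x \<in> carrier_mat ?d ?d" if "x \<in> carrier G" for x
      using rep_carrier[OF U(1) that] U(2) by simp
    have "(\<lambda>x. \<rho> x $$ (a, b)) \<in> dual_closure" if ab: "a < ?d" "b < ?d" for a b
    proof -
      have "(cl, a, b) \<in> dual_index" using cl ab U(2) by (simp add: dual_index_def \<rho>_def)
      then have "(\<lambda>x. 1 / complex_of_real (sqrt (real ?d)) * dual_basis (cl, a, b) x) \<in> dual_closure"
        by (intro ortho_closure_scale ortho_closure_base[OF dual_basis_orthonormal])
      then show ?thesis using ab U(2) by (simp add: dual_basis_def \<rho>_def)
    qed
    then have "(\<lambda>x. (mat_adjoint U * \<rho> x * U) $$ (i, j)) \<in> dual_closure"
      by (intro sandwich_closure[where k = ?d and d = ?d] \<rho>c Ua U(3) ij)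
    moreover have "mat_adjoint U * \<rho> x * U = \<pi> x" if x: "x \<in> carrier G" for x
    proof -
      have "mat_adjoint U * \<rho> x * U = mat_adjoint U * (U * \<pi> x)"
        unfolding U(5)[OF x] by (rule assoc_mult_mat[OF Ua \<rho>c[OF x] U(3)])
      also have "\<dots> = mat_adjoint U * U * \<pi> x" by (rule assoc_mult_mat[OF Ua U(3) c[OF x], symmetric])
      also have "\<dots> = \<pi> x" using unitary_matrixD(1)[OF U(4,3)] c[OF x] by simp
      finally show ?thesis .
    qed
    ultimately show ?thesis by (elim ortho_closure_cong) (simp add: space_haar)
  next
    case False
    then obtain W where W: "VectorSpace.subspace class_ring W (module_vec TYPE(complex) ?d)"
        "\<forall>x\<in>carrier G. \<forall>w\<in>W. \<pi> x *\<^sub>v w \<in> W" "W \<noteq> {0\<^sub>v ?d}" "W \<noteq> carrier_vec ?d"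
      using \<pi> ij(1) by (auto simp: irreducible_reps_def)
    obtain k P m Q where k: "k < ?d" and P: "P \<in> carrier_mat ?d k" "mat_adjoint P * P = 1\<^sub>m k"
      "\<And>v. v \<in> carrier_vec k \<Longrightarrow> P *\<^sub>v v \<in> W"
      "\<And>w. w \<in> W \<Longrightarrow> P *\<^sub>v (mat_adjoint P *\<^sub>v w) = w"
      and m: "m < ?d" and Q: "Q \<in> carrier_mat ?d m" "mat_adjoint Q * Q = 1\<^sub>m m"
      and PQ: "mat_adjoint P * Q = 0\<^sub>m k m"
      and Q': "\<And>v. v \<in> carrier_vec ?d \<Longrightarrow> mat_adjoint P *\<^sub>v v = 0\<^sub>v k \<Longrightarrow> Q *\<^sub>v (mat_adjoint Q *\<^sub>v v) = v"
      and sum1: "P * mat_adjoint P + Q * mat_adjoint Q = 1\<^sub>m ?d"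
      by (rule orthogonal_decomposition[OF W(1,3,4)]) (rule that; blast)
    have Pa: "mat_adjoint P \<in> carrier_mat k ?d" and Qa: "mat_adjoint Q \<in> carrier_mat m ?d" using P(1) Q(1) by auto
    have PP: "P * (mat_adjoint P * (\<pi> x * P)) = \<pi> x * P" if x: "x \<in> carrier G" for x
    proof (rule mat_eq_vecI)
      note cx = c[OF x]
      show "P * (mat_adjoint P * (\<pi> x * P)) \<in> carrier_mat ?d k" "\<pi> x * P \<in> carrier_mat ?d k" using P(1) cx Pa by auto
      fix v :: "complex vec" assume v: "v \<in> carrier_vec k"
      have Pv: "P *\<^sub>v v \<in> carrier_vec ?d" using P(1) v by auto
      have xPv: "\<pi> x * P *\<^sub>v v = \<pi> x *\<^sub>v (P *\<^sub>v v)" by (rule assoc_mult_mat_vec[OF cx P(1) v])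
      have "P * (mat_adjoint P * (\<pi> x * P)) *\<^sub>v v = P *\<^sub>v (mat_adjoint P * (\<pi> x * P) *\<^sub>v v)"
        by (rule assoc_mult_mat_vec[OF P(1) _ v]) (use Pa cx P(1) in auto)
      also have "mat_adjoint P * (\<pi> x * P) *\<^sub>v v = mat_adjoint P *\<^sub>v (\<pi> x * P *\<^sub>v v)"
        by (rule assoc_mult_mat_vec[OF Pa _ v]) (use cx P(1) in auto)
      also have "P *\<^sub>v (mat_adjoint P *\<^sub>v (\<pi> x * P *\<^sub>v v)) = \<pi> x * P *\<^sub>v v"
        unfolding xPv by (rule P(4)) (use W(2) x P(3)[OF v] in blast)
      finally show "P * (mat_adjoint P * (\<pi> x * P)) *\<^sub>v v = \<pi> x * P *\<^sub>v v" .
    qed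
    \<comment> \<open>\<open>W\<close> is invariant under \<pi>(inv x), the adjoint of \<pi>(x);
      hence \<pi>(x) preserves the orthogonal complement of \<open>W\<close>.\<close>
    have PxQ: "mat_adjoint P * (\<pi> x * Q) = 0\<^sub>m k m" if x: "x \<in> carrier G" for x
    proof -
      have ix: "inv x \<in> carrier G" using x by simp
      note cx = c[OF x] and cix = c[OF ix]
      have ad: "mat_adjoint (\<pi> (inv x)) = \<pi> x" using rep_inv[OF \<pi> ix] x by simp
      have "mat_adjoint P * \<pi> x = mat_adjoint (\<pi> (inv x) * P)"
        using mat_adjoint_mult[OF cix P(1)] ad by simp
      also have "\<dots> = mat_adjoint (P * (mat_adjoint P * (\<pi> (inv x) * P)))" by (simp only: PP[OF ix])
      also have "\<dots> = mat_adjoint (mat_adjoint P * (\<pi> (inv x) * P)) * mat_adjoint P"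
        by (rule mat_adjoint_mult[OF P(1)]) (use Pa cix P(1) in auto)
      finally have e: "mat_adjoint P * \<pi> x = mat_adjoint (mat_adjoint P * (\<pi> (inv x) * P)) * mat_adjoint P" .
      have B: "mat_adjoint (mat_adjoint P * (\<pi> (inv x) * P)) \<in> carrier_mat k k" using Pa cix P(1) by auto
      have "mat_adjoint P * (\<pi> x * Q) = mat_adjoint P * \<pi> x * Q" by (rule assoc_mult_mat[OF Pa cx Q(1), symmetric])
      also have "\<dots> = mat_adjoint (mat_adjoint P * (\<pi> (inv x) * P)) * (mat_adjoint P * Q)"
        unfolding e by (rule assoc_mult_mat[OF B Pa Q(1)])
      also have "\<dots> = 0\<^sub>m k m" unfolding PQ using B by (rule right_mult_zero_mat)
      finally show ?thesis .
    qed
    have QQ: "Q * (mat_adjoint Q * (\<pi> x * Q)) = \<pi> x * Q" if x: "x \<in> carrier G" for x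
    proof (rule mat_eq_vecI)
      note cx = c[OF x]
      show "Q * (mat_adjoint Q * (\<pi> x * Q)) \<in> carrier_mat ?d m" "\<pi> x * Q \<in> carrier_mat ?d m" using Q(1) cx Qa by auto
      then have xQ: "\<pi> x * Q \<in> carrier_mat ?d m" by simp
      fix v :: "complex vec" assume v: "v \<in> carrier_vec m"
      have "Q * (mat_adjoint Q * (\<pi> x * Q)) *\<^sub>v v = Q *\<^sub>v (mat_adjoint Q * (\<pi> x * Q) *\<^sub>v v)"
        by (rule assoc_mult_mat_vec[OF Q(1) _ v]) (use Qa xQ in auto)
      also have "mat_adjoint Q * (\<pi> x * Q) *\<^sub>v v = mat_adjoint Q *\<^sub>v (\<pi> x * Q *\<^sub>v v)"
        by (rule assoc_mult_mat_vec[OF Qa xQ v])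
      also have "Q *\<^sub>v (mat_adjoint Q *\<^sub>v (\<pi> x * Q *\<^sub>v v)) = \<pi> x * Q *\<^sub>v v"
      proof (rule Q')
        show "\<pi> x * Q *\<^sub>v v \<in> carrier_vec ?d" using xQ v by auto
        have "mat_adjoint P *\<^sub>v (\<pi> x * Q *\<^sub>v v) = mat_adjoint P * (\<pi> x * Q) *\<^sub>v v"
          by (rule assoc_mult_mat_vec[OF Pa xQ v, symmetric])
        also have "\<dots> = 0\<^sub>v k" unfolding PxQ[OF x] using v by (auto intro!: eq_vecI)
        finally show "mat_adjoint P *\<^sub>v (\<pi> x * Q *\<^sub>v v) = 0\<^sub>v k" .
      qed
      finally show "Q * (mat_adjoint Q * (\<pi> x * Q)) *\<^sub>v v = \<pi> x * Q *\<^sub>v v" .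
    qed
    let ?\<rho>1 = "\<lambda>x. mat_adjoint P * \<pi> x * P" and ?\<rho>2 = "\<lambda>x. mat_adjoint Q * \<pi> x * Q"
    note r1 = compression_unitary_rep[OF \<pi> P(1,2) PP] and r2 = compression_unitary_rep[OF \<pi> Q(1,2) QQ]
    have c1: "(\<lambda>x. ?\<rho>1 x $$ (a, b)) \<in> dual_closure" if "a < k" "b < k" for a b
      using less.hyps[of ?\<rho>1 a b] r1 k that by simp
    have c2: "(\<lambda>x. ?\<rho>2 x $$ (a, b)) \<in> dual_closure" if "a < m" "b < m" for a b
      using less.hyps[of ?\<rho>2 a b] r2 m that by simp
    \<comment> \<open>Applied with \<open>P\<close> and with \<open>Q\<close> for \<open>S\<close>:
      \<pi>(x) cut by the projection is rebuilt from the compression, whose entries are covered by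
      the induction.\<close>
    have part: "\<pi> x * (S * mat_adjoint S) = S * (mat_adjoint S * \<pi> x * S) * mat_adjoint S"
      if x: "x \<in> carrier G" and S: "S \<in> carrier_mat ?d l" and SS: "S * (mat_adjoint S * (\<pi> x * S)) = \<pi> x * S" for x S l
    proof -
      note cx = c[OF x]
      have Sa: "mat_adjoint S \<in> carrier_mat l ?d" using S by auto
      have "\<pi> x * (S * mat_adjoint S) = \<pi> x * S * mat_adjoint S" by (rule assoc_mult_mat[OF cx S Sa, symmetric])
      also have "\<dots> = S * (mat_adjoint S * (\<pi> x * S)) * mat_adjoint S" by (simp only: SS)
      also have "mat_adjoint S * (\<pi> x * S) = mat_adjoint S * \<pi> x * S" by (rule assoc_mult_mat[OF Sa cx S, symmetric])
      finally show ?thesis .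
    qed
    have split: "\<pi> x $$ (i, j) = (P * ?\<rho>1 x * mat_adjoint P) $$ (i, j) + (Q * ?\<rho>2 x * mat_adjoint Q) $$ (i, j)"
      if x: "x \<in> carrier G" for x
    proof -
      note cx = c[OF x]
      have "\<pi> x = \<pi> x * (P * mat_adjoint P + Q * mat_adjoint Q)" unfolding sum1 using cx by simp
      also have "\<dots> = \<pi> x * (P * mat_adjoint P) + \<pi> x * (Q * mat_adjoint Q)"
        by (rule mult_add_distrib_mat[OF cx]) (use P(1) Q(1) in auto)
      also have "\<dots> = P * ?\<rho>1 x * mat_adjoint P + Q * ?\<rho>2 x * mat_adjoint Q"
        using part[OF x P(1) PP[OF x]] part[OF x Q(1) QQ[OF x]] by simp
      finally have e: "\<pi> x = P * ?\<rho>1 x * mat_adjoint P + Q * ?\<rho>2 x * mat_adjoint Q" .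
      show ?thesis
        by (subst e, rule index_add_mat(1)) (use ij Q(1) in auto)
    qed
    show ?thesis
    proof (rule ortho_closure_cong[OF ortho_closure_add[OF dual_basis_orthonormal]])
      show "(\<lambda>x. (P * ?\<rho>1 x * mat_adjoint P) $$ (i, j)) \<in> dual_closure"
        by (rule sandwich_closure[OF _ c1 P(1) Pa ij]) (use c P(1) Pa in auto)
      show "(\<lambda>x. (Q * ?\<rho>2 x * mat_adjoint Q) $$ (i, j)) \<in> dual_closure"
        by (rule sandwich_closure[OF _ c2 Q(1) Qa ij]) (use c Q(1) Qa in auto)
      fix x assume "x \<in> space \<mu>"
      then show "(P * ?\<rho>1 x * mat_adjoint P) $$ (i, j) + (Q * ?\<rho>2 x * mat_adjoint Q) $$ (i, j) = \<pi> x $$ (i, j)"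
        using split by (simp add: space_haar)
    qed
  qed
qed

section \<open>The action of the group on cosets\<close>

lemma coset_action:
  assumes "x \<in> carrier G" "A \<in> left_cosets n"
  shows "x <# A \<in> left_cosets n"
proof -
  obtain a where "a \<in> carrier G" "A = a <# Gs n" using assms by (auto simp: left_cosets_def)
  then show ?thesis using assms(1) by (auto simp: left_cosets_def lcos_m_assoc[OF Gs_subset])
qed

lemma coset_subset: "A \<in> left_cosets n \<Longrightarrow> A \<subseteq> carrier G"
  using Union_left_cosets by blast

text \<open>The indicator of a coset is a matrix coefficient of the permutation representation on \<open>G/G\<^sub>n\<close>.\<close>

lemma permutation_rep:
  assumes e: "bij_betw e {..<m} (left_cosets n)"
  defines "\<pi> \<equiv> \<lambda>x. mat m m (\<lambda>(i, j). if x <# e j = e i then 1 else 0)"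
  shows "\<pi> \<in> unitary_reps G T" "rep_dim G \<pi> = m"
proof -
  show dim: "rep_dim G \<pi> = m" by (simp add: rep_dim_def \<pi>_def)
  have c: "\<pi> x \<in> carrier_mat m m" for x by (simp add: \<pi>_def)
  have eL: "e i \<in> left_cosets n" if "i < m" for i using e that by (auto simp: bij_betw_def)
  have e_inj: "e i = e j \<longleftrightarrow> i = j" if "i < m" "j < m" for i j
    using e that by (auto simp: bij_betw_def inj_on_def)
  have e_surj: "\<exists>i<m. A = e i" if "A \<in> left_cosets n" for A
    using e that by (auto simp: bij_betw_def)
  have mult: "\<pi> (x \<otimes> y) = \<pi> x * \<pi> y" if x: "x \<in> carrier G" and y: "y \<in> carrier G" for x y
  proof (rule eq_matI)
    fix i j assume "i < dim_row (\<pi> x * \<pi> y)" "j < dim_col (\<pi> x * \<pi> y)"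
    then have ij: "i < m" "j < m" by (auto simp: \<pi>_def)
    obtain l where l: "l < m" "y <# e j = e l" using e_surj[OF coset_action[OF y eL[OF ij(2)]]] by auto
    have "(\<pi> x * \<pi> y) $$ (i, j) = (\<Sum>l'<m. \<pi> x $$ (i, l') * \<pi> y $$ (l', j))"
      by (rule mult_mat_index_sum[OF c c ij])
    also have "\<dots> = (\<Sum>l'<m. if l' = l then \<pi> x $$ (i, l') else 0)"
      using ij l e_inj by (intro sum.cong refl) (auto simp: \<pi>_def)
    also have "\<dots> = \<pi> x $$ (i, l)" using l by simp
    also have "\<dots> = \<pi> (x \<otimes> y) $$ (i, j)"
      using ij l lcos_m_assoc[OF coset_subset[OF eL[OF ij(2)]] x y] by (simp add: \<pi>_def)
    finally show "\<pi> (x \<otimes> y) $$ (i, j) = (\<pi> x * \<pi> y) $$ (i, j)" ..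
  qed (auto simp: \<pi>_def)
  have one: "\<pi> \<one> = 1\<^sub>m m"
    using e_inj coset_subset[OF eL] by (intro eq_matI) (auto simp: \<pi>_def lcos_mult_one)
  have swap: "inv x <# A = B \<longleftrightarrow> x <# B = A" if "x \<in> carrier G" "A \<subseteq> carrier G" "B \<subseteq> carrier G" for x A B
    using that by (auto simp: lcos_m_assoc lcos_mult_one)
  have adj: "mat_adjoint (\<pi> x) = \<pi> (inv x)" if x: "x \<in> carrier G" for x
  proof (rule eq_matI)
    fix i j assume "i < dim_row (\<pi> (inv x))" "j < dim_col (\<pi> (inv x))"
    then have ij: "i < m" "j < m" by (auto simp: \<pi>_def)
    have "mat_adjoint (\<pi> x) $$ (i, j) = cnj (\<pi> x $$ (j, i))"
      using ij by (intro index_mat_adjoint) (auto simp: \<pi>_def)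
    then show "mat_adjoint (\<pi> x) $$ (i, j) = \<pi> (inv x) $$ (i, j)"
      using ij swap[OF x coset_subset[OF eL] coset_subset[OF eL], of j i] by (auto simp: \<pi>_def)
  qed (auto simp: \<pi>_def)
  have uni: "unitary_matrix (\<pi> x)" if x: "x \<in> carrier G" for x
    by (rule unitary_matrixI[OF c])
      (use mult[of "inv x" x] mult[of x "inv x"] x one in \<open>simp_all add: adj[OF x]\<close>)
  \<comment> \<open>With \<open>e j = b <# Gs n\<close> and \<open>e i = a <# Gs n\<close> the
    condition says that \<open>x \<otimes> b\<close> lies in an open coset.\<close>
  have open_trans: "openin T {x \<in> carrier G. x <# e j = e i}" if ij: "i < m" "j < m" for i j
  proof -
    obtain a b where ab: "a \<in> carrier G" "e i = a <# Gs n" "b \<in> carrier G" "e j = b <# Gs n"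
      using eL[OF ij(1)] eL[OF ij(2)] by (auto simp: left_cosets_def)
    have "{x \<in> carrier G. x <# e j = e i} = {x \<in> topspace T. x \<otimes> b \<in> a <# Gs n}"
      using ab by (auto simp: topspace_eq mem_l_coset_iff lcos_m_assoc[OF Gs_subset])
    then show ?thesis using continuous_right_mult[OF ab(3)] l_coset_open[OF ab(1)]
      by (simp add: continuous_map_def)
  qed
  have cont: "continuous_map T euclidean (\<lambda>x. \<pi> x $$ (i, j))" if ij: "i < m" "j < m" for i j
    unfolding continuous_map_def
  proof (intro conjI allI impI)
    fix S :: "complex set"
    \<comment> \<open>The entry is constant on each set of x with \<open>x <# e j = e i'\<close>;
      these sets are open and cover G, so the preimage of every \<open>S\<close> is open.\<close>
    have "{x \<in> topspace T. \<pi> x $$ (i, j) \<in> S}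
        = (\<Union>i'\<in>{i'. i' < m \<and> (if i' = i then 1 else 0) \<in> S}. {x \<in> carrier G. x <# e j = e i'})"
    proof (intro equalityI subsetI)
      fix x assume "x \<in> {x \<in> topspace T. \<pi> x $$ (i, j) \<in> S}"
      then have x: "x \<in> carrier G" "\<pi> x $$ (i, j) \<in> S" by (auto simp: topspace_eq)
      obtain i' where "i' < m" "x <# e j = e i'" using e_surj[OF coset_action[OF x(1) eL[OF ij(2)]]] by auto
      then show "x \<in> (\<Union>i'\<in>{i'. i' < m \<and> (if i' = i then 1 else 0) \<in> S}. {x \<in> carrier G. x <# e j = e i'})"
        using x ij e_inj[of i' i] by (auto simp: \<pi>_def split: if_splits)
    next
      fix x assume "x \<in> (\<Union>i'\<in>{i'. i' < m \<and> (if i' = i then 1 else 0) \<in> S}. {x \<in> carrier G. x <# e j = e i'})"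
      then obtain i' where "i' < m" "(if i' = i then 1 else 0) \<in> S" "x \<in> carrier G" "x <# e j = e i'" by blast
      then show "x \<in> {x \<in> topspace T. \<pi> x $$ (i, j) \<in> S}"
        using ij e_inj[of i' i] by (auto simp: \<pi>_def topspace_eq split: if_splits)
    qed
    then show "openin T {x \<in> topspace T. \<pi> x $$ (i, j) \<in> S}"
      using open_trans[OF _ ij(2)] by (auto intro!: openin_Union)
  qed auto
  show "\<pi> \<in> unitary_reps G T"
    unfolding unitary_reps_def dim using c uni mult cont dim by auto
qed

text \<open>Take the column of the coset \<open>Gs n\<close> itself and the row of \<open>A\<close>:
  the entry at x is 1 exactly when \<open>x <# Gs n\<close> is \<open>A\<close>, that is, when x
  lies in \<open>A\<close>.\<close>

lemma coset_indicator_closure: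
  assumes "A \<in> left_cosets n"
  shows "(\<lambda>x. indicator A x) \<in> dual_closure"
proof -
  obtain e where e: "bij_betw e {..<card (left_cosets n)} (left_cosets n)"
    using ex_bij_betw_nat_finite[OF finite_left_cosets[of n]] by (auto simp: atLeast0LessThan)
  let ?m = "card (left_cosets n)"
  let ?\<pi> = "\<lambda>x. mat ?m ?m (\<lambda>(i, j). if x <# e j = e i then 1 else 0)"
  have one: "\<one> <# Gs n = Gs n" by (rule lcos_mult_one[OF Gs_subset])
  have "Gs n \<in> left_cosets n" unfolding left_cosets_def using one by (intro image_eqI[of _ _ \<one>]) auto
  then obtain j where j: "j < ?m" "e j = Gs n" using e unfolding bij_betw_def by (metis imageE lessThan_iff)
  obtain i where i: "i < ?m" "e i = A" using e assms unfolding bij_betw_def by (metis imageE lessThan_iff)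
  obtain a where a: "a \<in> carrier G" "A = a <# Gs n" using assms by (auto simp: left_cosets_def)
  show ?thesis
  proof (rule ortho_closure_cong)
    show "(\<lambda>x. ?\<pi> x $$ (i, j)) \<in> dual_closure"
      by (rule rep_entry_closure) (use permutation_rep[OF e] i j in simp_all)
    fix x assume "x \<in> space \<mu>"
    then have "x \<in> carrier G" by (simp add: space_haar)
    then show "?\<pi> x $$ (i, j) = indicator A x"
      using i j a mem_l_coset_iff[of a x n] by (auto split: split_indicator)
  qed
qed

section \<open>Cosets generate the Borel sets; completeness\<close>

text \<open>Each level has finitely many cosets and there are countably many levels, so an open set
  is a countable union of cosets and lies in the sigma-algebra that they generate.\<close>

lemma open_is_union_of_cosets:
  assumes "openin T U"
  shows "U = (\<Union>n. \<Union>{A \<in> left_cosets n. A \<subseteq> U})"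
proof (intro equalityI subsetI)
  fix a assume a: "a \<in> U"
  then have ac: "a \<in> carrier G" using openin_subset[OF assms] topspace_eq by auto
  have "openin T {x \<in> topspace T. a \<otimes> x \<in> U}"
    using continuous_left_mult[OF ac] assms by (simp add: continuous_map_def)
  moreover have "\<one> \<in> {x \<in> topspace T. a \<otimes> x \<in> U}" using a ac by (simp add: topspace_eq)
  ultimately obtain n where "Gs n \<subseteq> {x \<in> topspace T. a \<otimes> x \<in> U}" using nhds_basis by blast
  then have "a <# Gs n \<subseteq> U" by (auto simp: l_coset_def)
  then show "a \<in> (\<Union>n. \<Union>{A \<in> left_cosets n. A \<subseteq> U})"
    using mem_l_coset_self[OF ac, of n] ac by (auto simp: left_cosets_def)
qed auto

text \<open>The cosets of the chain form a tree in which two of them are nested or disjoint. With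
  the empty set added they are therefore closed under intersection, as the \<pi>-\<lambda> argument
  requires.\<close>

lemma left_coset_refine:
  assumes "A \<in> left_cosets n" "B \<in> left_cosets m" "n \<le> m"
  shows "A \<inter> B = {} \<or> A \<inter> B = B"
proof (cases "A \<inter> B = {}")
  case False
  then obtain x where x: "x \<in> A" "x \<in> B" by blast
  obtain a b where ab: "a \<in> carrier G" "A = a <# Gs n" "b \<in> carrier G" "B = b <# Gs m"
    using assms by (auto simp: left_cosets_def)
  have xc: "x \<in> carrier G" using x coset_subset[OF assms(1)] by blast
  have "A = x <# Gs n" "B = x <# Gs m" using x ab xc mem_l_coset_iff by auto
  then have "B \<subseteq> A" using Gs_antimono[OF assms(3)] by (auto simp: l_coset_def)
  then show ?thesis by blast
qed simp

lemma ortho_closure_dual_basis: "dual_closure = L2 \<mu>"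
proof (rule ortho_closure_eq_L2[where C = "insert {} (\<Union>n. left_cosets n)"])
  show "orthonormal_family \<mu> dual_basis dual_index" by (rule dual_basis_orthonormal)
  show "finite_measure \<mu>" by (rule finite_measure_axioms)
  show "Int_stable (insert {} (\<Union>n. left_cosets n))"
  proof (rule Int_stableI)
    fix A B assume AB: "A \<in> insert {} (\<Union>n. left_cosets n)" "B \<in> insert {} (\<Union>n. left_cosets n)"
    show "A \<inter> B \<in> insert {} (\<Union>n. left_cosets n)"
    proof (cases "A = {} \<or> B = {}")
      case False
      then obtain n m where nm: "A \<in> left_cosets n" "B \<in> left_cosets m" using AB by auto
      have "A \<inter> B = {} \<or> A \<inter> B = B \<or> A \<inter> B = A"
      proof (cases "n \<le> m")
        case True
        then show ?thesis using left_coset_refine[OF nm] by blast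
      next
        case False
        then have "m \<le> n" by simp
        then show ?thesis using left_coset_refine[OF nm(2,1)] by blast
      qed
      then show ?thesis using nm by auto
    qed auto
  qed
  show "insert {} (\<Union>n. left_cosets n) \<subseteq> Pow (space \<mu>)"
    using coset_subset by (auto simp: space_haar)
  show "sets \<mu> = sigma_sets (space \<mu>) (insert {} (\<Union>n. left_cosets n))"
    unfolding sets_haar space_haar
  proof (rule sigma_sets_eqI)
    fix U assume "U \<in> {U. openin T U}"
    then have U: "U = (\<Union>n. \<Union>{A \<in> left_cosets n. A \<subseteq> U})" using open_is_union_of_cosets by simp
    have sa: "sigma_algebra (carrier G) (sigma_sets (carrier G) (insert {} (\<Union>n. left_cosets n)))"
      by (rule sigma_algebra_sigma_sets) (use coset_subset in auto)
    interpret sa: sigma_algebra "carrier G" "sigma_sets (carrier G) (insert {} (\<Union>n. left_cosets n))" by (rule sa)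
    have "\<Union>{A \<in> left_cosets n. A \<subseteq> U} \<in> sigma_sets (carrier G) (insert {} (\<Union>n. left_cosets n))" for n
      using finite_left_cosets[of n] by (intro sa.finite_Union) (auto intro: sigma_sets.Basic)
    then have "(\<Union>n. \<Union>{A \<in> left_cosets n. A \<subseteq> U}) \<in> sigma_sets (carrier G) (insert {} (\<Union>n. left_cosets n))"
      by (intro sigma_sets.Union) auto
    then show "U \<in> sigma_sets (carrier G) (insert {} (\<Union>n. left_cosets n))" using U by simp
  next
    fix B assume "B \<in> insert {} (\<Union>n. left_cosets n)"
    then have "openin T B" using l_coset_open by (auto simp: left_cosets_def)
    then show "B \<in> sigma_sets (carrier G) {U. openin T U}" by (intro sigma_sets.Basic) simp
  qed
  show "(\<lambda>x. indicator A x) \<in> dual_closure" if "A \<in> insert {} (\<Union>n. left_cosets n)" for A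
    using that coset_indicator_closure by (auto simp: ortho_closure_zero)
  have "\<one> <# Gs 0 \<in> left_cosets 0" by (auto simp: left_cosets_def)
  then show "(\<lambda>x. indicator (space \<mu>) x) \<in> dual_closure"
    using coset_indicator_closure[of "\<one> <# Gs 0" 0] lcos_mult_one[OF subset_refl] by (simp add: Gs_0 space_haar)
qed

text \<open>The finite index set from Parseval is enlarged to full blocks over the classes it meets;
  each block then sums to one tail term.\<close>

lemma tail_term_parseval:
  assumes f: "f \<in> L2 \<mu>" and \<epsilon>: "\<epsilon> > 0"
  obtains F where "finite F" "F \<subseteq> unitary_dual G T" "(L2_norm \<mu> f)\<^sup>2 < (\<Sum>c\<in>F. tail_term G \<mu> f c) + \<epsilon>"
proof -
  have "f \<in> dual_closure" using f ortho_closure_dual_basis by simp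
  then obtain F where F: "finite F" "F \<subseteq> dual_index"
      "(L2_norm \<mu> f)\<^sup>2 < (\<Sum>k\<in>F. (cmod (L2_inner \<mu> f (dual_basis k)))\<^sup>2) + \<epsilon>"
    using ortho_closure_parseval[OF dual_basis_orthonormal _ \<epsilon>] by blast
  let ?D = "\<lambda>c. {..<rep_dim G (class_rep c)} \<times> {..<rep_dim G (class_rep c)}"
  have sub: "fst ` F \<subseteq> unitary_dual G T" using F(2) by (auto simp: dual_index_def)
  have "(\<Sum>k\<in>F. (cmod (L2_inner \<mu> f (dual_basis k)))\<^sup>2)
      \<le> (\<Sum>k\<in>Sigma (fst ` F) ?D. (cmod (L2_inner \<mu> f (dual_basis k)))\<^sup>2)"
    by (rule sum_mono2) (use F in \<open>force simp: dual_index_def\<close>)+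
  also have "\<dots> = (\<Sum>c\<in>fst ` F. \<Sum>p\<in>?D c. (cmod (L2_inner \<mu> f (dual_basis (c, p))))\<^sup>2)"
    using F(1) by (subst sum.Sigma) auto
  also have "\<dots> = (\<Sum>c\<in>fst ` F. tail_term G \<mu> f c)"
    using sub by (intro sum.cong refl) (auto simp: tail_term_eq_sum case_prod_beta)
  finally show ?thesis using F by (intro that[OF _ sub]) auto
qed

end

section \<open>Fourier tails and the modulus of continuity\<close>

lemma HS_norm_diff_sq:
  assumes A: "A \<in> carrier_mat n m" and B: "B \<in> carrier_mat n m"
  shows "(HS_norm (A - B))\<^sup>2 = (HS_norm A)\<^sup>2 + (HS_norm B)\<^sup>2
    - 2 * Re (\<Sum>i<n. \<Sum>j<m. A $$ (i, j) * cnj (B $$ (i, j)))"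
proof -
  have AB: "A - B \<in> carrier_mat n m" using A B by auto
  have e: "(cmod (z - w))\<^sup>2 = (cmod z)\<^sup>2 + (cmod w)\<^sup>2 - 2 * Re (z * cnj w)" for z w
    unfolding cmod_power2 by (simp add: power2_eq_square algebra_simps)
  have "(HS_norm (A - B))\<^sup>2 = (\<Sum>i<n. \<Sum>j<m. (cmod (A $$ (i, j) - B $$ (i, j)))\<^sup>2)"
    unfolding HS_norm_sq[OF AB] using A B by (intro sum.cong refl) auto
  then show ?thesis
    unfolding e HS_norm_sq[OF A] HS_norm_sq[OF B] Re_sum by (simp add: sum.distrib sum_subtractf sum_distrib_left)
qed

lemma HS_norm_diff_sq_le:
  assumes A: "A \<in> carrier_mat n m" and B: "B \<in> carrier_mat n m"
  shows "(HS_norm (A - B))\<^sup>2 \<le> 2 * (HS_norm A)\<^sup>2 + 2 * (HS_norm B)\<^sup>2"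
proof -
  have AB: "A - B \<in> carrier_mat n m" using A B by auto
  have "(cmod ((A - B) $$ (i, j)))\<^sup>2 \<le> 2 * (cmod (A $$ (i, j)))\<^sup>2 + 2 * (cmod (B $$ (i, j)))\<^sup>2"
    if "i < n" "j < m" for i j
    using cmod_add_sq_le[of "A $$ (i, j)" "- B $$ (i, j)"] that A B by simp
  then have "(HS_norm (A - B))\<^sup>2 \<le> (\<Sum>i<n. \<Sum>j<m. 2 * (cmod (A $$ (i, j)))\<^sup>2 + 2 * (cmod (B $$ (i, j)))\<^sup>2)"
    unfolding HS_norm_sq[OF AB] by (intro sum_mono) auto
  also have "\<dots> = 2 * (HS_norm A)\<^sup>2 + 2 * (HS_norm B)\<^sup>2"
    unfolding HS_norm_sq[OF A] HS_norm_sq[OF B] by (simp add: sum.distrib sum_distrib_left)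
  finally show ?thesis .
qed

lemma HS_norm_zero [simp]: "HS_norm (0\<^sub>m n m) = 0"
  by (simp add: HS_norm_def)

lemma HS_norm_eq_0D:
  assumes "A \<in> carrier_mat n m" "HS_norm A = 0" "i < n" "j < m"
  shows "A $$ (i, j) = 0"
proof -
  have "(\<Sum>i<n. \<Sum>j<m. (cmod (A $$ (i, j)))\<^sup>2) = 0" using HS_norm_sq[OF assms(1)] assms(2) by simp
  then show ?thesis using assms by (simp add: sum_nonneg_eq_0_iff sum_nonneg)
qed

context vilenkin_haar
begin

lemma tail_classes_iff:
  "c \<in> tail_classes G T Gs n \<longleftrightarrow> c \<in> unitary_dual G T \<and> class_rep c \<notin> annihilator G T (Gs n)"
  using rep_bracket_gt_iff[OF class_rep_unitary] by (auto simp: tail_classes_def)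

text \<open>The infinite sum of a family that is not summable is 0 by convention, so this is what
  gives the tail its meaning. The bound on finite sums is Bessel's inequality.\<close>

lemma tail_term_summable:
  assumes "f \<in> L2 \<mu>"
  shows "tail_term G \<mu> f summable_on tail_classes G T Gs n"
proof (rule nonneg_bdd_above_summable_on)
  show "bdd_above (sum (tail_term G \<mu> f) ` {F. F \<subseteq> tail_classes G T Gs n \<and> finite F})"
    by (rule bdd_aboveI[where M = "(L2_norm \<mu> f)\<^sup>2"]) (use assms in \<open>auto simp: tail_classes_iff intro!: tail_term_bessel\<close>)
qed (rule tail_term_nonneg)

lemma fourier_tail_nonneg: "0 \<le> fourier_tail G T \<mu> Gs f n"
  by (simp add: fourier_tail_def infsum_nonneg tail_term_nonneg)

lemma fourier_tail_sq: "(fourier_tail G T \<mu> Gs f n)\<^sup>2 = (\<Sum>\<^sub>\<infinity>c\<in>tail_classes G T Gs n. tail_term G \<mu> f c)"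
  by (simp add: fourier_tail_def infsum_nonneg tail_term_nonneg)

lemma sum_tail_term_le:
  assumes "f \<in> L2 \<mu>" "finite F" "F \<subseteq> tail_classes G T Gs n"
  shows "(\<Sum>c\<in>F. tail_term G \<mu> f c) \<le> (fourier_tail G T \<mu> Gs f n)\<^sup>2"
  unfolding fourier_tail_sq
  by (rule finite_sum_le_infsum[OF tail_term_summable[OF assms(1)] assms(2,3)]) (rule tail_term_nonneg)

lemma translate_diff_L2: "f \<in> L2 \<mu> \<Longrightarrow> h \<in> carrier G \<Longrightarrow> (\<lambda>x. f (h \<otimes> x) - f x) \<in> L2 \<mu>"
  by (intro L2_diff L2_left_mult(1))

lemma translate_diff_norm_le:
  assumes "f \<in> L2 \<mu>" "h \<in> carrier G"
  shows "L2_norm \<mu> (\<lambda>x. f (h \<otimes> x) - f x) \<le> 2 * L2_norm \<mu> f"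
proof -
  have "(L2_norm \<mu> (\<lambda>x. f (h \<otimes> x) - f x))\<^sup>2 \<le> (2 * L2_norm \<mu> f)\<^sup>2"
    using L2_norm_diff_sq_le[OF L2_left_mult(1)[OF assms(2,1)] assms(1)] L2_left_mult(2)[OF assms(2,1)]
    by (simp add: power_mult_distrib)
  then show ?thesis by (rule power2_le_imp_le) simp
qed

text \<open>A real supremum is known to dominate its elements only when they are bounded above;
  translation invariance supplies the bound \<open>2 * L2_norm \<mu> f\<close>.\<close>

lemma modulus2_upper:
  assumes "f \<in> L2 \<mu>" "h \<in> Gs n"
  shows "L2_norm \<mu> (\<lambda>x. f (h \<otimes> x) - f x) \<le> modulus2 G \<mu> Gs f n"
  unfolding modulus2_def
proof (rule cSUP_upper[OF assms(2)])
  show "bdd_above ((\<lambda>h. L2_norm \<mu> (\<lambda>x. f (h \<otimes> x) - f x)) ` Gs n)"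
    by (rule bdd_aboveI[where M = "2 * L2_norm \<mu> f"])
      (use translate_diff_norm_le[OF assms(1)] Gs_subset[of n] in auto)
qed

lemma modulus2_least:
  assumes "\<And>h. h \<in> Gs n \<Longrightarrow> L2_norm \<mu> (\<lambda>x. f (h \<otimes> x) - f x) \<le> B"
  shows "modulus2 G \<mu> Gs f n \<le> B"
  unfolding modulus2_def by (rule cSUP_least) (use assms Gs_one in auto)

lemma modulus2_nonneg: "f \<in> L2 \<mu> \<Longrightarrow> 0 \<le> modulus2 G \<mu> Gs f n"
  using modulus2_upper[OF _ Gs_one] L2_norm_nonneg order_trans by blast

lemma fourier_coeff_translate_diff:
  assumes "\<xi> \<in> unitary_reps G T" "f \<in> L2 \<mu>" "h \<in> carrier G"
  shows "fourier_coeff G \<mu> (\<lambda>x. f (h \<otimes> x) - f x) \<xi> = fourier_coeff G \<mu> f \<xi> * \<xi> h - fourier_coeff G \<mu> f \<xi>"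
  by (simp only: fourier_coeff_diff[OF assms(1) L2_left_mult(1)[OF assms(3,2)] assms(2)]
      fourier_coeff_left_mult[OF assms])

lemma half_modulus2_le_fourier_tail:
  assumes f: "f \<in> L2 \<mu>"
  shows "1 / 2 * modulus2 G \<mu> Gs f n \<le> fourier_tail G T \<mu> Gs f n"
proof -
  have "L2_norm \<mu> (\<lambda>x. f (h \<otimes> x) - f x) \<le> 2 * fourier_tail G T \<mu> Gs f n" if h: "h \<in> Gs n" for h
  proof -
    have hc: "h \<in> carrier G" using h Gs_subset by blast
    let ?g = "\<lambda>x. f (h \<otimes> x) - f x"
    have g: "?g \<in> L2 \<mu>" by (rule translate_diff_L2[OF f hc])
    have tail: "tail_term G \<mu> ?g c \<le> (if c \<in> tail_classes G T Gs n then 4 * tail_term G \<mu> f c else 0)"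
      if c: "c \<in> unitary_dual G T" for c
    proof -
      let ?\<xi> = "class_rep c" and ?d = "rep_dim G (class_rep c)"
      let ?A = "fourier_coeff G \<mu> f ?\<xi>"
      note u = class_rep_unitary[OF c]
      have A: "?A \<in> carrier_mat ?d ?d" by (rule fourier_coeff_carrier)
      note \<xi>h = rep_carrier[OF u hc]
      have co: "fourier_coeff G \<mu> ?g ?\<xi> = ?A * ?\<xi> h - ?A" by (rule fourier_coeff_translate_diff[OF u f hc])
      show ?thesis
      proof (cases "c \<in> tail_classes G T Gs n")
        case True
        have "(HS_norm (?A * ?\<xi> h - ?A))\<^sup>2 \<le> 2 * (HS_norm (?A * ?\<xi> h))\<^sup>2 + 2 * (HS_norm ?A)\<^sup>2"
          by (rule HS_norm_diff_sq_le[OF mult_carrier_mat[OF A \<xi>h] A])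
        \<comment> \<open>Unitarity makes the two norms equal, so 2 + 2 becomes 4.\<close>
        also have "\<dots> = 4 * (HS_norm ?A)\<^sup>2"
          using HS_norm_mult_unitary[OF A \<xi>h rep_unitary[OF u hc]] by simp
        finally have "real ?d * (HS_norm (?A * ?\<xi> h - ?A))\<^sup>2 \<le> real ?d * (4 * (HS_norm ?A)\<^sup>2)"
          by (rule mult_left_mono) simp
        then show ?thesis using True by (simp add: tail_term_def co mult_ac)
      next
        case False
        then have "?\<xi> \<in> annihilator G T (Gs n)" using c by (simp add: tail_classes_iff)
        then have "?\<xi> h = 1\<^sub>m ?d" using h by (simp add: annihilator_def)
        then have "?A * ?\<xi> h - ?A = 0\<^sub>m ?d ?d" using A by simp
        then show ?thesis using False by (simp add: tail_term_def co)
      qed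
    qed
    have "(L2_norm \<mu> ?g)\<^sup>2 \<le> 4 * (fourier_tail G T \<mu> Gs f n)\<^sup>2"
    proof (rule field_le_epsilon)
      fix \<epsilon> :: real assume "\<epsilon> > 0"
      then obtain F where F: "finite F" "F \<subseteq> unitary_dual G T" "(L2_norm \<mu> ?g)\<^sup>2 < (\<Sum>c\<in>F. tail_term G \<mu> ?g c) + \<epsilon>"
        using tail_term_parseval[OF g] by blast
      \<comment> \<open>Parseval supplies classes from the whole dual; those outside the tail
        contribute 0 and are dropped before the comparison with the infinite sum.\<close>
      have "(\<Sum>c\<in>F. tail_term G \<mu> ?g c) \<le> (\<Sum>c\<in>F. if c \<in> tail_classes G T Gs n then 4 * tail_term G \<mu> f c else 0)"
        using F(2) by (intro sum_mono tail) auto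
      also have "\<dots> = 4 * (\<Sum>c\<in>F \<inter> tail_classes G T Gs n. tail_term G \<mu> f c)"
        using F(1) by (simp add: sum.inter_restrict sum_distrib_left if_distrib cong: if_cong)
      also have "\<dots> \<le> 4 * (fourier_tail G T \<mu> Gs f n)\<^sup>2"
        using sum_tail_term_le[OF f, of "F \<inter> tail_classes G T Gs n" n] F(1) by simp
      finally show "(L2_norm \<mu> ?g)\<^sup>2 \<le> 4 * (fourier_tail G T \<mu> Gs f n)\<^sup>2 + \<epsilon>" using F(3) by linarith
    qed
    also have "\<dots> = (2 * fourier_tail G T \<mu> Gs f n)\<^sup>2" by (simp add: power_mult_distrib)
    finally show ?thesis by (rule power2_le_imp_le) (simp add: fourier_tail_nonneg)
  qed
  then have "modulus2 G \<mu> Gs f n \<le> 2 * fourier_tail G T \<mu> Gs f n" by (rule modulus2_least)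
  then show ?thesis by simp
qed

section \<open>Consequences of Condition (A) and the upper estimate\<close>

text \<open>The value is positive, so x is not the identity and leaves the chain at exactly one
  level; strict growth of the indices identifies that level as k. This puts the points of Condition
  (A) into \<open>Gs k\<close>.\<close>

lemma vilenkin_abs_eqD:
  assumes x: "x \<in> carrier G" and abs: "vilenkin_abs G Gs \<mu> x = 1 / real (group_index G (Gs k))"
  shows "x \<in> Gs k"
proof -
  have "x \<noteq> \<one>" using abs index_pos[of k] by (auto simp: vilenkin_abs_def)
  then have "\<exists>m. x \<notin> Gs m" using inter by blast
  define m where "m = (LEAST m. x \<notin> Gs m)"
  have m: "x \<notin> Gs m" unfolding m_def using \<open>\<exists>m. x \<notin> Gs m\<close> by (rule LeastI_ex)
  have "m \<noteq> 0"
  proof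
    assume "m = 0"
    with m have "x \<notin> Gs 0" by simp
    then show False using x Gs_0 by simp
  qed
  then obtain n where n: "m = Suc n" by (cases m) auto
  have xn: "x \<in> Gs n" using not_less_Least[of n "\<lambda>m. x \<notin> Gs m"] n unfolding m_def by auto
  have "(THE n. x \<in> Gs n - Gs (Suc n)) = n"
  proof (rule the_equality)
    show "x \<in> Gs n - Gs (Suc n)" using xn m n by simp
    fix l assume l: "x \<in> Gs l - Gs (Suc l)"
    show "l = n"
    proof (rule linorder_cases[of l n])
      assume "l < n"
      then show ?thesis using l xn Gs_antimono[of "Suc l" n] by auto
    next
      assume "n < l"
      then show ?thesis using l m n Gs_antimono[of "Suc n" l] by auto
    qed
  qed
  then have "1 / real (group_index G (Gs n)) = 1 / real (group_index G (Gs k))"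
    using abs \<open>x \<noteq> \<one>\<close> by (simp add: vilenkin_abs_def measure_Gs)
  then have "group_index G (Gs n) = group_index G (Gs k)" by simp
  then show ?thesis using strict_mono_eq[OF index_strict_mono, of n k] xn by simp
qed

lemma Gs_indicator_L2: "(\<lambda>x. indicator (Gs n) x :: complex) \<in> L2 \<mu>"
  by (rule L2_indicator(1)[OF finite_measure_axioms Gs_sets])

text \<open>Condition (A) demands nontriviality on the layer, while membership in the tail gives it
  only on \<open>Gs n\<close>. For y in \<open>Gs (Suc n)\<close> and z in the layer, z y is again
  in the layer, so triviality there forces \<xi>(y) to be the identity.\<close>

lemma nontrivial_on_layer:
  assumes \<xi>: "\<xi> \<in> unitary_reps G T" and "\<xi> \<notin> annihilator G T (Gs n)"
  shows "\<exists>x \<in> Gs n - Gs (Suc n). \<xi> x \<noteq> 1\<^sub>m (rep_dim G \<xi>)"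
proof (rule ccontr)
  assume "\<not> ?thesis"
  then have triv: "\<xi> x = 1\<^sub>m (rep_dim G \<xi>)" if "x \<in> Gs n" "x \<notin> Gs (Suc n)" for x using that by blast
  obtain z where z: "z \<in> Gs n" "z \<notin> Gs (Suc n)" using strictly_decreasing[of n] by blast
  have "\<xi> y = 1\<^sub>m (rep_dim G \<xi>)" if y: "y \<in> Gs n" for y
  proof (cases "y \<in> Gs (Suc n)")
    case True
    have c: "z \<in> carrier G" "y \<in> carrier G" using z y Gs_subset by auto
    have "z \<otimes> y \<notin> Gs (Suc n)"
    proof
      assume "z \<otimes> y \<in> Gs (Suc n)"
      then have "z \<otimes> y \<otimes> inv y \<in> Gs (Suc n)" using Gs_mult Gs_inv[OF True] by blast
      then show False using z c by (simp add: m_assoc)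
    qed
    then have "\<xi> (z \<otimes> y) = 1\<^sub>m (rep_dim G \<xi>)" using triv Gs_mult[OF z(1) y] by blast
    then show ?thesis using rep_mult[OF \<xi> c] triv[OF z] rep_carrier[OF \<xi> c(2)] by simp
  qed (use triv y in blast)
  then show False using assms by (simp add: annihilator_def)
qed

text \<open>Condition (A), applied to the Fourier coefficient of the indicator function of \<open>G\<^sub>n\<close>: that function
  is invariant under translation by the points \<open>h\<^sub>i\<close>, so its coefficient vanishes.\<close>

lemma condition_A_annihilates:
  assumes A: "condition_A G T \<mu> Gs" and \<xi>: "\<xi> \<in> irreducible_reps G T" and n: "\<xi> \<notin> annihilator G T (Gs n)"
    and ij: "i < rep_dim G \<xi>" "j < rep_dim G \<xi>"
  shows "L2_inner \<mu> (\<lambda>x. indicator (Gs n) x) (\<lambda>x. \<xi> x $$ (i, j)) = 0"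
proof -
  obtain N and h :: "nat \<Rightarrow> nat \<Rightarrow> 'a" where
    h: "\<forall>k. \<forall>i<N. h k i \<in> carrier G \<and> vilenkin_abs G Gs \<mu> (h k i) = 1 / real (group_index G (Gs k))"
    and q: "\<forall>q::real. q \<ge> 1 \<longrightarrow> (\<exists>C>0. \<forall>k. \<forall>\<xi>\<in>irreducible_reps G T.
           (\<exists>x \<in> Gs k - Gs (Suc k). \<xi> x \<noteq> 1\<^sub>m (rep_dim G \<xi>)) \<longrightarrow>
           (\<forall>f\<in>L2 \<mu>. let A = fourier_coeff G \<mu> f \<xi> in
              real (group_index G (Gs k)) powr q * rep_bracket G T Gs \<xi> powr (- q)
                * HS_norm A powr q
              \<le> C * (\<Sum>i<N. HS_norm (A * (\<xi> (h k i) - 1\<^sub>m (rep_dim G \<xi>))) powr q)))"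
    using A unfolding condition_A_def by blast
  let ?f = "\<lambda>x. indicator (Gs n) x :: complex" and ?d = "rep_dim G \<xi>"
  define B where "B = fourier_coeff G \<mu> ?f \<xi>"
  have B: "B \<in> carrier_mat ?d ?d" unfolding B_def by (rule fourier_coeff_carrier)
  note u = irreducible_unitary[OF \<xi>]
  \<comment> \<open>Condition (A) at q = 1 and k = n, where the powers of the norms are the norms
    themselves.\<close>
  obtain C where "real (group_index G (Gs n)) powr 1 * rep_bracket G T Gs \<xi> powr (- 1) * HS_norm B powr 1
      \<le> C * (\<Sum>i<N. HS_norm (B * (\<xi> (h n i) - 1\<^sub>m ?d)) powr 1)"
    using q[rule_format, of 1] \<xi> nontrivial_on_layer[OF u n] Gs_indicator_L2[of n] unfolding B_def Let_def by auto
  moreover have "B * (\<xi> (h n i) - 1\<^sub>m ?d) = 0\<^sub>m ?d ?d" if i: "i < N" for i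
  proof -
    let ?h = "h n i"
    have hc: "?h \<in> carrier G" and hn: "?h \<in> Gs n" using h i vilenkin_abs_eqD by auto
    note c = rep_carrier[OF u hc]
    have inv: "?h \<otimes> x \<in> Gs n \<longleftrightarrow> x \<in> Gs n" if x: "x \<in> carrier G" for x
    proof
      assume "?h \<otimes> x \<in> Gs n"
      then have "inv ?h \<otimes> (?h \<otimes> x) \<in> Gs n" using Gs_mult Gs_inv[OF hn] by blast
      then show "x \<in> Gs n" using hc x by (simp flip: m_assoc)
    qed (rule Gs_mult[OF hn])
    have "B * \<xi> ?h = fourier_coeff G \<mu> (\<lambda>x. ?f (?h \<otimes> x)) \<xi>"
      unfolding B_def by (rule fourier_coeff_left_mult[OF u Gs_indicator_L2 hc, symmetric])
    also have "\<dots> = B"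
      unfolding B_def fourier_coeff_def
      using inv by (auto intro!: cong_mat Bochner_Integration.integral_cong simp: space_haar indicator_def)
    finally have "B * \<xi> ?h = B" .
    then show ?thesis using mult_minus_distrib_mat[OF B c one_carrier_mat] B by simp
  qed
  ultimately have "real (group_index G (Gs n)) * rep_bracket G T Gs \<xi> powr (- 1) * HS_norm B \<le> 0"
    by simp
  moreover have "real (group_index G (Gs n)) * rep_bracket G T Gs \<xi> powr (- 1) > 0"
    using index_pos[of n] rep_bracket_pos[OF u] by simp
  ultimately have "HS_norm B = 0"
    using HS_norm_nonneg[of B] by (metis antisym mult_le_0_iff not_less)
  then have "B $$ (j, i) = 0" by (rule HS_norm_eq_0D[OF B _ ij(2,1)])
  then show ?thesis unfolding B_def fourier_coeff_index[OF u ij(2,1)] .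
qed

text \<open>Bessel's inequality for \<open>f(h \<cdot>) - f\<close>, averaged over \<open>h \<in> G\<^sub>n\<close>; the cross terms
  \<open>\<langle>A \<xi>(h), A\<rangle>\<close> average to \<open>0\<close>.\<close>

lemma fourier_tail_le_modulus2:
  assumes A: "condition_A G T \<mu> Gs" and f: "f \<in> L2 \<mu>"
  shows "fourier_tail G T \<mu> Gs f n \<le> 1 / sqrt 2 * modulus2 G \<mu> Gs f n"
proof -
  let ?M = "modulus2 G \<mu> Gs f n" and ?I = "\<lambda>x. indicator (Gs n) x :: complex"
  have mpos: "measure \<mu> (Gs n) > 0" using index_pos[of n] by (simp add: measure_Gs)
  have fin: "(\<Sum>c\<in>F. tail_term G \<mu> f c) \<le> ?M\<^sup>2 / 2"
    if F: "finite F" "F \<subseteq> tail_classes G T Gs n" for F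
  proof -
    define d where "d c = rep_dim G (class_rep c)" for c :: "('a \<Rightarrow> complex mat) set"
    define a where "a c = fourier_coeff G \<mu> f (class_rep c)" for c
    \<comment> \<open>\<open>Z c x\<close> is the Hilbert-Schmidt inner product of A \<xi>(x) with
      A, expanded into matrix entries so that it is a linear combination of functions orthogonal to
      the indicator of \<open>Gs n\<close>.\<close>
    define Z where "Z c x = (\<Sum>i<d c. \<Sum>j<d c. \<Sum>k<d c. (a c $$ (i, k) * cnj (a c $$ (i, j))) * class_rep c x $$ (k, j))" for c x
    \<comment> \<open>For x in \<open>Gs n\<close> the real part of \<open>W x\<close> is the sum
      over \<open>F\<close> of the tail terms of \<open>f (x \<otimes> y) - f y\<close> as a
      function of y. Keeping \<open>W\<close> complex lets its integral over \<open>Gs n\<close> be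
      an inner product with the indicator.\<close>
    define W where "W x = (\<Sum>c\<in>F. complex_of_real (2 * tail_term G \<mu> f c) - complex_of_real (2 * real (d c)) * Z c x)" for x
    have dual: "c \<in> unitary_dual G T" "class_rep c \<notin> annihilator G T (Gs n)" if "c \<in> F" for c
      using F(2) that by (auto simp: tail_classes_iff)
    have ZL: "Z c \<in> L2 \<mu>" if "c \<in> F" for c
      unfolding Z_def[abs_def] d_def
      by (intro L2_sum L2_scale rep_entry_L2[OF class_rep_unitary[OF dual(1)[OF that]]]) auto
    have constL: "(\<lambda>x. z) \<in> L2 \<mu>" for z :: complex
      by (rule L2_bounded[OF finite_measure_axioms, where B = "cmod z"]) auto
    have Z0: "L2_inner \<mu> (Z c) ?I = 0" if c: "c \<in> F" for c
    proof -
      note u = class_rep_unitary[OF dual(1)[OF c]]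
      have e0: "L2_inner \<mu> (\<lambda>x. class_rep c x $$ (k, j)) ?I = 0" if "k < d c" "j < d c" for k j
        using condition_A_annihilates[OF A class_rep_irreducible[OF dual(1)[OF c]] dual(2)[OF c], of k j] that
          L2_inner_cnj[of \<mu> ?I "\<lambda>x. class_rep c x $$ (k, j)"] by (simp add: d_def)
      have eL: "(\<lambda>x. class_rep c x $$ (k, j)) \<in> L2 \<mu>" if "k < d c" "j < d c" for k j
        using that by (intro rep_entry_L2[OF u]) (auto simp: d_def)
      have inner0: "L2_inner \<mu> (\<lambda>x. \<Sum>k<d c. z k * class_rep c x $$ (k, j)) ?I = 0" if j: "j < d c" for z j
      proof -
        have "L2_inner \<mu> (\<lambda>x. \<Sum>k<d c. z k * class_rep c x $$ (k, j)) ?I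
            = (\<Sum>k<d c. L2_inner \<mu> (\<lambda>x. z k * class_rep c x $$ (k, j)) ?I)"
          by (rule L2_inner_sum_left[OF L2_scale[OF eL] Gs_indicator_L2]) (use j in auto)
        also have "\<dots> = 0" unfolding L2_inner_scale_left using e0[OF _ j] by simp
        finally show ?thesis .
      qed
      have "L2_inner \<mu> (Z c) ?I = (\<Sum>i<d c. L2_inner \<mu> (\<lambda>x. \<Sum>j<d c. \<Sum>k<d c.
          (a c $$ (i, k) * cnj (a c $$ (i, j))) * class_rep c x $$ (k, j)) ?I)"
        unfolding Z_def[abs_def]
        by (rule L2_inner_sum_left[OF L2_sum[OF L2_sum[OF L2_scale[OF eL]]] Gs_indicator_L2]) auto
      also have "\<dots> = (\<Sum>i<d c. \<Sum>j<d c. L2_inner \<mu> (\<lambda>x. \<Sum>k<d c.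
          (a c $$ (i, k) * cnj (a c $$ (i, j))) * class_rep c x $$ (k, j)) ?I)"
        by (intro sum.cong refl L2_inner_sum_left[OF L2_sum[OF L2_scale[OF eL]] Gs_indicator_L2]) auto
      also have "\<dots> = 0" using inner0 by simp
      finally show ?thesis .
    qed
    have WL: "W \<in> L2 \<mu>" unfolding W_def[abs_def] by (intro L2_sum L2_diff L2_scale constL ZL)
    have WI: "L2_inner \<mu> W ?I = complex_of_real (2 * (\<Sum>c\<in>F. tail_term G \<mu> f c) * measure \<mu> (Gs n))"
    proof -
      have cI: "L2_inner \<mu> (\<lambda>x. z) ?I = z * complex_of_real (measure \<mu> (Gs n))" for z
      proof -
        have "L2_inner \<mu> (\<lambda>x. z) ?I = (LINT x|\<mu>. z * complex_of_real (indicator (Gs n) x))"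
          unfolding L2_inner_def by (intro Bochner_Integration.integral_cong refl) (simp split: split_indicator)
        also have "\<dots> = z * complex_of_real (measure \<mu> (Gs n))"
          using sets_haar_subset[OF Gs_sets[of n]] by (simp add: space_haar Int_absorb2 Int_absorb1)
        finally show ?thesis .
      qed
      have "L2_inner \<mu> W ?I = (\<Sum>c\<in>F. L2_inner \<mu> (\<lambda>x. complex_of_real (2 * tail_term G \<mu> f c) - complex_of_real (2 * real (d c)) * Z c x) ?I)"
        unfolding W_def[abs_def] by (rule L2_inner_sum_left[OF _ Gs_indicator_L2]) (intro L2_diff L2_scale constL ZL)
      also have "\<dots> = (\<Sum>c\<in>F. complex_of_real (2 * tail_term G \<mu> f c) * complex_of_real (measure \<mu> (Gs n)))"
      proof (intro sum.cong refl)
        fix c assume c: "c \<in> F"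
        have "L2_inner \<mu> (\<lambda>x. complex_of_real (2 * tail_term G \<mu> f c) - complex_of_real (2 * real (d c)) * Z c x) ?I
            = L2_inner \<mu> (\<lambda>x. complex_of_real (2 * tail_term G \<mu> f c)) ?I - L2_inner \<mu> (\<lambda>x. complex_of_real (2 * real (d c)) * Z c x) ?I"
          by (rule L2_inner_diff_left[OF constL L2_scale[OF ZL[OF c]] Gs_indicator_L2])
        also have "L2_inner \<mu> (\<lambda>x. complex_of_real (2 * real (d c)) * Z c x) ?I = 0"
          unfolding L2_inner_scale_left Z0[OF c] by simp
        finally show "L2_inner \<mu> (\<lambda>x. complex_of_real (2 * tail_term G \<mu> f c) - complex_of_real (2 * real (d c)) * Z c x) ?I
            = complex_of_real (2 * tail_term G \<mu> f c) * complex_of_real (measure \<mu> (Gs n))"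
          unfolding cI by simp
      qed
      finally show ?thesis by (simp add: sum_distrib_left sum_distrib_right)
    qed
    have pt: "Re (W x) \<le> ?M\<^sup>2" if x: "x \<in> Gs n" for x
    proof -
      have xc: "x \<in> carrier G" using x Gs_subset by blast
      let ?g = "\<lambda>y. f (x \<otimes> y) - f y"
      have "tail_term G \<mu> ?g c = Re (complex_of_real (2 * tail_term G \<mu> f c) - complex_of_real (2 * real (d c)) * Z c x)"
        if c: "c \<in> F" for c
      proof -
        note u = class_rep_unitary[OF dual(1)[OF c]]
        have a: "a c \<in> carrier_mat (d c) (d c)" unfolding a_def d_def by (rule fourier_coeff_carrier)
        have \<xi>x: "class_rep c x \<in> carrier_mat (d c) (d c)" unfolding d_def by (rule rep_carrier[OF u xc])
        have "Z c x = (\<Sum>i<d c. \<Sum>j<d c. (a c * class_rep c x) $$ (i, j) * cnj (a c $$ (i, j)))"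
          unfolding Z_def
        proof (intro sum.cong refl)
          fix i j assume "i \<in> {..<d c}" "j \<in> {..<d c}"
          then have ij: "i < d c" "j < d c" by auto
          show "(\<Sum>k<d c. (a c $$ (i, k) * cnj (a c $$ (i, j))) * class_rep c x $$ (k, j))
              = (a c * class_rep c x) $$ (i, j) * cnj (a c $$ (i, j))"
            unfolding mult_mat_index_sum[OF a \<xi>x ij] sum_distrib_right by (simp add: mult_ac)
        qed
        then have "(HS_norm (a c * class_rep c x - a c))\<^sup>2 = 2 * (HS_norm (a c))\<^sup>2 - 2 * Re (Z c x)"
          using HS_norm_diff_sq[OF mult_carrier_mat[OF a \<xi>x] a] HS_norm_mult_unitary[OF a \<xi>x rep_unitary[OF u xc]]
          by simp
        then show ?thesis
          unfolding tail_term_def fourier_coeff_translate_diff[OF u f xc] a_def[symmetric] d_def[symmetric]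
          by (simp add: right_diff_distrib)
      qed
      then have "Re (W x) = (\<Sum>c\<in>F. tail_term G \<mu> ?g c)" by (simp add: W_def)
      also have "\<dots> \<le> (L2_norm \<mu> ?g)\<^sup>2"
        by (rule tail_term_bessel[OF F(1) _ translate_diff_L2[OF f xc]]) (use dual in auto)
      also have "\<dots> \<le> ?M\<^sup>2" by (rule power_mono[OF modulus2_upper[OF f x]]) simp
      finally show ?thesis .
    qed
    have int: "integrable \<mu> (\<lambda>x. W x * cnj (?I x))" by (rule L2_mult_cnj_integrable[OF WL Gs_indicator_L2])
    \<comment> \<open>The pointwise bound is integrated over \<open>Gs n\<close>, whose positive
      measure then cancels.\<close>
    have "2 * (\<Sum>c\<in>F. tail_term G \<mu> f c) * measure \<mu> (Gs n) = Re (L2_inner \<mu> W ?I)"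
      unfolding WI by simp
    also have "\<dots> = (LINT x|\<mu>. Re (W x * cnj (?I x)))"
      unfolding L2_inner_def by (rule integral_Re[OF int, symmetric])
    also have "\<dots> \<le> (LINT x|\<mu>. ?M\<^sup>2 * indicator (Gs n) x)"
    proof (rule integral_mono)
      show "integrable \<mu> (\<lambda>x. Re (W x * cnj (?I x)))" by (rule integrable_Re[OF int])
      show "integrable \<mu> (\<lambda>x. ?M\<^sup>2 * indicator (Gs n) x)"
        using Gs_sets by (intro integrable_mult_right) (auto simp: integrable_indicator_iff less_top[symmetric])
      show "Re (W x * cnj (?I x)) \<le> ?M\<^sup>2 * indicator (Gs n) x" for x
        using pt[of x] by (simp split: split_indicator)
    qed
    also have "\<dots> = ?M\<^sup>2 * measure \<mu> (Gs n)"
      using sets_haar_subset[OF Gs_sets[of n]] by (simp add: space_haar Int_absorb2 Int_absorb1)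
    finally have "2 * (\<Sum>c\<in>F. tail_term G \<mu> f c) \<le> ?M\<^sup>2" using mpos by simp
    then show ?thesis by simp
  qed
  have "(fourier_tail G T \<mu> Gs f n)\<^sup>2 \<le> ?M\<^sup>2 / 2"
    unfolding fourier_tail_sq by (rule infsum_le_finite_sums[OF tail_term_summable[OF f]]) (rule fin)
  also have "\<dots> = (1 / sqrt 2 * ?M)\<^sup>2" by (simp add: power_mult_distrib power_divide)
  finally show ?thesis by (rule power2_le_imp_le) (simp add: modulus2_nonneg[OF f])
qed

section \<open>Sharpness of the constant 1/sqrt 2\<close>

text \<open>For the indicator function of \<open>G\<^sub>m\<close> with \<open>|G\<^sub>m| = a\<close> the squared tail is \<open>a - a\<^sup>2\<close> and the squared
  modulus is at most \<open>2 a\<close>; the ratio tends to \<open>1/2\<close> as \<open>m\<close> grows.\<close>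

lemma indicator_modulus2_le:
  "(modulus2 G \<mu> Gs (\<lambda>x. indicator (Gs m) x) 0)\<^sup>2 \<le> 2 * measure \<mu> (Gs m)"
proof -
  let ?f = "\<lambda>x. indicator (Gs m) x :: complex"
  note fL = Gs_indicator_L2[of m]
  have "L2_norm \<mu> (\<lambda>x. ?f (h \<otimes> x) - ?f x) \<le> sqrt (2 * measure \<mu> (Gs m))" if "h \<in> Gs 0" for h
  proof -
    have h: "h \<in> carrier G" using that Gs_0 by simp
    have n: "(L2_norm \<mu> ?f)\<^sup>2 = measure \<mu> (Gs m)" by (rule L2_indicator(2)[OF finite_measure_axioms Gs_sets])
    note hL = L2_left_mult[OF h fL]
    have "(L2_norm \<mu> (\<lambda>x. ?f (h \<otimes> x) - ?f x))\<^sup>2 \<le> (LINT x|\<mu>. (cmod (?f (h \<otimes> x)))\<^sup>2 + (cmod (?f x))\<^sup>2)"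
      unfolding L2_norm_sq
      by (rule integral_mono) (use L2_diff[OF hL(1) fL] hL(1) fL in \<open>auto simp: L2_def split: split_indicator\<close>)
    also have "\<dots> = (L2_norm \<mu> (\<lambda>x. ?f (h \<otimes> x)))\<^sup>2 + (L2_norm \<mu> ?f)\<^sup>2"
      unfolding L2_norm_sq by (rule Bochner_Integration.integral_add) (use hL(1) fL in \<open>auto simp: L2_def\<close>)
    also have "\<dots> = 2 * measure \<mu> (Gs m)" unfolding hL(2) n by simp
    finally show ?thesis by (rule real_le_rsqrt)
  qed
  then have "modulus2 G \<mu> Gs ?f 0 \<le> sqrt (2 * measure \<mu> (Gs m))" by (rule modulus2_least)
  then have "(modulus2 G \<mu> Gs ?f 0)\<^sup>2 \<le> (sqrt (2 * measure \<mu> (Gs m)))\<^sup>2"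
    by (rule power_mono) (rule modulus2_nonneg[OF fL])
  then show ?thesis by simp
qed

text \<open>Subtracting the mean a removes the coefficient at representations trivial on G. It
  changes no coefficient in the tail: a constant is a multiple of the indicator of
  \<open>Gs 0\<close>, which Condition (A) makes orthogonal to every irreducible occurring there. So
  the full squared norm a - a^2 of the difference lies in the tail.\<close>

lemma indicator_fourier_tail_ge:
  assumes A: "condition_A G T \<mu> Gs"
  shows "measure \<mu> (Gs m) - (measure \<mu> (Gs m))\<^sup>2 \<le> (fourier_tail G T \<mu> Gs (\<lambda>x. indicator (Gs m) x) 0)\<^sup>2"
proof -
  let ?f = "\<lambda>x. indicator (Gs m) x :: complex" and ?a = "measure \<mu> (Gs m)"
  let ?k = "\<lambda>x :: 'a. complex_of_real ?a"
  let ?g = "\<lambda>x. ?f x - ?k x"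
  note fL = Gs_indicator_L2[of m]
  have kL: "?k \<in> L2 \<mu>" by (rule L2_bounded[OF finite_measure_axioms, where B = "?a"]) auto
  have gL: "?g \<in> L2 \<mu>" by (rule L2_diff[OF fL kL])
  have int: "(LINT x|\<mu>. ?f x) = complex_of_real ?a"
  proof -
    have "(LINT x|\<mu>. ?f x) = (LINT x|\<mu>. complex_of_real (indicator (Gs m) x))"
      by (intro Bochner_Integration.integral_cong refl) (simp split: split_indicator)
    also have "\<dots> = complex_of_real ?a"
      using sets_haar_subset[OF Gs_sets[of m]] by (simp add: space_haar Int_absorb2 Int_absorb1)
    finally show ?thesis .
  qed
  have fint: "integrable \<mu> ?f"
  proof -
    have "integrable \<mu> (\<lambda>x. ?f x * cnj (?f x))" by (rule L2_mult_cnj_integrable[OF fL fL])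
    moreover have "(\<lambda>x. ?f x * cnj (?f x)) = ?f" by (auto split: split_indicator)
    ultimately show ?thesis by simp
  qed
  have norm_g: "(L2_norm \<mu> ?g)\<^sup>2 = ?a - ?a\<^sup>2"
  proof -
    have "L2_inner \<mu> ?f ?k = complex_of_real (?a * ?a)" unfolding L2_inner_def using int by simp
    moreover have "(L2_norm \<mu> ?k)\<^sup>2 = ?a\<^sup>2" unfolding L2_norm_sq using measure_space_haar by (simp add: space_haar)
    moreover have "(L2_norm \<mu> ?f)\<^sup>2 = ?a" by (rule L2_indicator(2)[OF finite_measure_axioms Gs_sets])
    ultimately show ?thesis using L2_norm_diff_sq[OF fL kL] by (simp add: power2_eq_square)
  qed
  have in_tail: "tail_term G \<mu> ?g c = tail_term G \<mu> ?f c" if c: "c \<in> tail_classes G T Gs 0" for c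
  proof -
    have cd: "c \<in> unitary_dual G T" "class_rep c \<notin> annihilator G T (Gs 0)" using c by (auto simp: tail_classes_iff)
    note u = class_rep_unitary[OF cd(1)]
    have "fourier_coeff G \<mu> ?g (class_rep c) = fourier_coeff G \<mu> ?f (class_rep c)"
    proof (rule eq_matI)
      fix i j assume "i < dim_row (fourier_coeff G \<mu> ?f (class_rep c))" "j < dim_col (fourier_coeff G \<mu> ?f (class_rep c))"
      then have ij: "i < rep_dim G (class_rep c)" "j < rep_dim G (class_rep c)" by auto
      let ?e = "\<lambda>x. class_rep c x $$ (j, i)"
      have eL: "?e \<in> L2 \<mu>" by (rule rep_entry_L2[OF u ij(2,1)])
      have "L2_inner \<mu> ?k ?e = L2_inner \<mu> (\<lambda>x. complex_of_real ?a * indicator (Gs 0) x) ?e"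
        by (rule L2_inner_cong) (auto simp: space_haar Gs_0)
      also have "\<dots> = 0"
        unfolding L2_inner_scale_left condition_A_annihilates[OF A class_rep_irreducible[OF cd(1)] cd(2) ij(2,1)] by simp
      finally show "fourier_coeff G \<mu> ?g (class_rep c) $$ (i, j) = fourier_coeff G \<mu> ?f (class_rep c) $$ (i, j)"
        unfolding fourier_coeff_index[OF u ij] L2_inner_diff_left[OF fL kL eL] by simp
    qed auto
    then show ?thesis by (simp only: tail_term_def)
  qed
  have off_tail: "tail_term G \<mu> ?g c = 0" if c: "c \<in> unitary_dual G T" "c \<notin> tail_classes G T Gs 0" for c
  proof -
    let ?d = "rep_dim G (class_rep c)"
    note u = class_rep_unitary[OF c(1)]
    have triv: "class_rep c x = 1\<^sub>m ?d" if "x \<in> carrier G" for x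
      using c that by (auto simp: tail_classes_iff annihilator_def Gs_0)
    have "fourier_coeff G \<mu> ?g (class_rep c) = 0\<^sub>m ?d ?d"
    proof (rule eq_matI)
      fix i j assume "i < dim_row (0\<^sub>m ?d ?d :: complex mat)" "j < dim_col (0\<^sub>m ?d ?d :: complex mat)"
      then have ij: "i < ?d" "j < ?d" by auto
      have "L2_inner \<mu> ?g (\<lambda>x. class_rep c x $$ (j, i)) = L2_inner \<mu> ?g (\<lambda>x. (if i = j then 1 else 0) * 1)"
        by (rule L2_inner_cong) (use triv ij in \<open>auto simp: space_haar\<close>)
      also have "\<dots> = cnj (if i = j then 1 else 0) * L2_inner \<mu> ?g (\<lambda>x. 1)" by (rule L2_inner_scale_right)
      also have "L2_inner \<mu> ?g (\<lambda>x. 1) = 0"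
        unfolding L2_inner_def using int fint measure_space_haar by (simp add: space_haar)
      finally show "fourier_coeff G \<mu> ?g (class_rep c) $$ (i, j) = 0\<^sub>m ?d ?d $$ (i, j)"
        unfolding fourier_coeff_index[OF u ij] using ij by simp
    qed auto
    then show ?thesis by (simp add: tail_term_def)
  qed
  have "?a - ?a\<^sup>2 \<le> (fourier_tail G T \<mu> Gs ?f 0)\<^sup>2"
  proof (rule field_le_epsilon)
    fix \<epsilon> :: real assume "\<epsilon> > 0"
    then obtain F where F: "finite F" "F \<subseteq> unitary_dual G T" "(L2_norm \<mu> ?g)\<^sup>2 < (\<Sum>c\<in>F. tail_term G \<mu> ?g c) + \<epsilon>"
      using tail_term_parseval[OF gL] by blast
    have "(\<Sum>c\<in>F. tail_term G \<mu> ?g c) = (\<Sum>c\<in>F. if c \<in> tail_classes G T Gs 0 then tail_term G \<mu> ?f c else 0)"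
      using F(2) in_tail off_tail by (intro sum.cong refl) auto
    also have "\<dots> = (\<Sum>c\<in>F \<inter> tail_classes G T Gs 0. tail_term G \<mu> ?f c)"
      using F(1) by (simp add: sum.inter_restrict)
    also have "\<dots> \<le> (fourier_tail G T \<mu> Gs ?f 0)\<^sup>2"
      using sum_tail_term_le[OF fL, of "F \<inter> tail_classes G T Gs 0" 0] F(1) by simp
    finally show "?a - ?a\<^sup>2 \<le> (fourier_tail G T \<mu> Gs ?f 0)\<^sup>2 + \<epsilon>" using F(3) norm_g by linarith
  qed
  then show ?thesis .
qed

lemma inverse_sqrt2_sharp:
  assumes A: "condition_A G T \<mu> Gs" and c: "c < 1 / sqrt 2"
  shows "\<exists>f\<in>L2 \<mu>. \<exists>n. c * modulus2 G \<mu> Gs f n < fourier_tail G T \<mu> Gs f n"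
proof (rule ccontr)
  assume "\<not> ?thesis"
  then have le: "fourier_tail G T \<mu> Gs f n \<le> c * modulus2 G \<mu> Gs f n" if "f \<in> L2 \<mu>" for f n
    using that by (meson not_le)
  \<comment> \<open>The bound comes from a (1 - a) \<le> 2 a c^2 and a < 1/m. Positivity of
    \<open>c\<close> is recorded as well because \<open>c\<close> could be negative, and c < 1/sqrt
    2 can be squared only once this is excluded.\<close>
  have key: "1 - 1 / real m < 2 * c\<^sup>2 \<and> 0 < c" if m: "m \<ge> 1" for m
  proof -
    let ?f = "\<lambda>x. indicator (Gs m) x :: complex"
    define a where "a = measure \<mu> (Gs m)"
    have idx: "real m < real (group_index G (Gs m))" using index_ge by simp
    then have a: "0 < a" "a < 1 / real m" using m by (auto simp: a_def measure_Gs intro!: divide_strict_left_mono)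
    have "1 / real m \<le> 1" using m by simp
    then have a1: "a < 1" using a(2) by linarith
    have M0: "0 \<le> modulus2 G \<mu> Gs ?f 0" by (rule modulus2_nonneg[OF Gs_indicator_L2])
    have "0 < a * (1 - a)" using a a1 by simp
    also have "a * (1 - a) = a - a\<^sup>2" by (simp add: power2_eq_square algebra_simps)
    also have t: "a - a\<^sup>2 \<le> (fourier_tail G T \<mu> Gs ?f 0)\<^sup>2"
      unfolding a_def by (rule indicator_fourier_tail_ge[OF A])
    finally have tpos: "fourier_tail G T \<mu> Gs ?f 0 > 0"
      using fourier_tail_nonneg[of ?f 0] by (simp add: less_le)
    then have "0 < c * modulus2 G \<mu> Gs ?f 0" using le[OF Gs_indicator_L2, of m 0] by linarith
    then have cpos: "0 < c" using M0 by (simp add: zero_less_mult_iff)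
    have "(fourier_tail G T \<mu> Gs ?f 0)\<^sup>2 \<le> (c * modulus2 G \<mu> Gs ?f 0)\<^sup>2"
      by (rule power_mono[OF le[OF Gs_indicator_L2] fourier_tail_nonneg])
    also have "\<dots> \<le> c\<^sup>2 * (2 * a)"
      unfolding power_mult_distrib a_def by (rule mult_left_mono[OF indicator_modulus2_le]) simp
    finally have "a * (1 - a) \<le> a * (2 * c\<^sup>2)" using t by (simp add: power2_eq_square algebra_simps)
    then have "1 - a \<le> 2 * c\<^sup>2" using a(1) by simp
    then show ?thesis using a(2) cpos by simp
  qed
  have cpos: "0 < c" using key[of 1] by simp
  have "c\<^sup>2 < (1 / sqrt 2)\<^sup>2" by (rule power_strict_mono[OF c]) (use cpos in auto)
  then have "0 < 1 - 2 * c\<^sup>2" by (simp add: power_divide)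
  then obtain m where m: "m \<noteq> 0" "inverse (real m) < 1 - 2 * c\<^sup>2"
    using real_arch_inverse by blast
  then show False using key[of m] by (simp add: inverse_eq_divide)
qed

end

theorem theorem1p14:
  fixes G :: "('a, 'b) monoid_scheme"
    and T :: "'a topology"
    and Gs :: "nat \<Rightarrow> 'a set"
    and \<mu> :: "'a measure"
  assumes "compact_vilenkin_group G T Gs"
    and "normalized_haar_measure G T \<mu>"
    and "condition_A G T \<mu> Gs"
  shows "(\<forall>f\<in>L2 \<mu>. \<forall>n.
            tail_term G \<mu> f summable_on tail_classes G T Gs n \<and>
            1 / 2 * modulus2 G \<mu> Gs f n \<le> fourier_tail G T \<mu> Gs f n \<and>
            fourier_tail G T \<mu> Gs f n \<le> 1 / sqrt 2 * modulus2 G \<mu> Gs f n) \<and>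
         \<not> (\<exists>c < 1 / sqrt 2. \<forall>f\<in>L2 \<mu>. \<forall>n.
            fourier_tail G T \<mu> Gs f n \<le> c * modulus2 G \<mu> Gs f n) \<and>
         (\<forall>\<omega> :: nat \<Rightarrow> real. decseq \<omega> \<and> \<omega> \<longlonglongrightarrow> 0 \<longrightarrow>
            (\<forall>f\<in>L2 \<mu>. f \<in> M2_class G \<mu> Gs \<omega> \<longleftrightarrow>
               (\<exists>C>0. \<forall>n. fourier_tail G T \<mu> Gs f n \<le> C * \<omega> n)))"
proof -
  interpret compact_vilenkin_group G T Gs by fact
  interpret vilenkin_haar G T Gs \<mu> by unfold_locales fact
  note lower = half_modulus2_le_fourier_tail and upper = fourier_tail_le_modulus2[OF assms(3)]
  \<comment> \<open>The two-sided estimate is applied at each n separately: C passes to C/sqrt 2 in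
    one direction and to 2 C in the other.\<close>
  have "f \<in> M2_class G \<mu> Gs \<omega> \<longleftrightarrow> (\<exists>C>0. \<forall>n. fourier_tail G T \<mu> Gs f n \<le> C * \<omega> n)"
    if f: "f \<in> L2 \<mu>" for f \<omega>
  proof
    assume "f \<in> M2_class G \<mu> Gs \<omega>"
    then obtain C where C: "C > 0" "\<And>n. modulus2 G \<mu> Gs f n \<le> C * \<omega> n" by (auto simp: M2_class_def)
    have "fourier_tail G T \<mu> Gs f n \<le> (1 / sqrt 2 * C) * \<omega> n" for n
      using upper[OF f, of n] mult_left_mono[OF C(2)[of n], of "1 / sqrt 2"] by (simp add: mult.assoc)
    moreover have "1 / sqrt 2 * C > 0" using C(1) by simp
    ultimately show "\<exists>C>0. \<forall>n. fourier_tail G T \<mu> Gs f n \<le> C * \<omega> n" by blast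
  next
    assume "\<exists>C>0. \<forall>n. fourier_tail G T \<mu> Gs f n \<le> C * \<omega> n"
    then obtain C where C: "C > 0" "\<And>n. fourier_tail G T \<mu> Gs f n \<le> C * \<omega> n" by blast
    have "modulus2 G \<mu> Gs f n \<le> (2 * C) * \<omega> n" for n
      using lower[OF f, of n] C(2)[of n] by simp
    moreover have "2 * C > 0" using C(1) by simp
    ultimately show "f \<in> M2_class G \<mu> Gs \<omega>" using f unfolding M2_class_def by blast
  qed
  then show ?thesis
    using tail_term_summable lower upper inverse_sqrt2_sharp[OF assms(3)] by (meson not_less)
qed

end
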